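(* Let $k$ be a field and $\beta\in k$. As a strict $k$-linear monoidal category, the affine rook category $aRo^k(\beta)$ has a presentation with a single generating object $1$, generating morphisms $X:2\to2$, $\eta:0\to1$, $\varepsilon:1\to0$, $\phi^{+},\phi^-:1\to1$, and defining relations (where $\iota_n$ is the identity of the object $n$ and $I=\iota_1$): (1) $X\circ X=\iota_2$, $\ \varepsilon\circ\eta=\beta\,\iota_0$; (2) $(X\otimes I)\circ(I\otimes X)\circ(X\otimes I)=(I\otimes X)\circ(X\otimes I)\circ(I\otimes X)$; (3) $(I\otimes\varepsilon)\circ X=\varepsilon\otimes I$, $\ X\circ(I\otimes\eta)=\eta\otimes I$; (4) $\phi^+\circ\phi^-=I=\phi^-\circ\phi^+$; (5) $(\phi^\pm\otimes I)\circ X=X\circ(I\otimes\phi^\pm)$, $\ (I\otimes\phi^\pm)\circ X=X\circ(\phi^\pm\otimes I)$; (6) $\phi^\pm\circ\eta=\eta$, $\ \varepsilon\circ\phi^\pm=\varepsilon$.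
   Context: The category $aRo^k(\beta)$ has objects the nonnegative integers. The morphism space from $s$ to $t$ is the free $k$-vector space on affine rook $(s,t)$-diagrams (diagrams on a translation-invariant strip with $s$ bottom and $t$ top vertices per fundamental rectangle, whose components contain at most one top and at most one bottom vertex, without non-contractible loops). Equivalently, such a diagram is a partial injection from $\{1,\dots,s\}$ (bottom vertices) to $\{1,\dots,t\}$ (top vertices) together with an integer label on each matched pair, recording the winding (the number of boundaries between translates of the fundamental rectangle crossed, with sign, going from bottom to top). Composition is by stacking ($a\circ b$ has $a$ on top of $b$): partial injections are composed, labels add along composite strands, and each closed component in the middle (a middle vertex isolated in both diagrams) is removed with a factor $\beta$. The tensor product is addition on objects and horizontal juxtaposition of labelled diagrams on morphisms. The generators are: $X$ the crossing with labels $0$; $\eta$ the single isolated top vertex; $\varepsilon$ the single isolated bottom vertex; $\phi^{\pm}$ the single strand with label $\pm1$. *)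

theory Defs
  imports "HOL-Library.Poly_Mapping"
begin

record ('o, 'm, 'k) lmcat =
  Obj :: "'o set"
  Hom :: "'o \<Rightarrow> 'o \<Rightarrow> 'm set"
  Idt :: "'o \<Rightarrow> 'm"
  Cmp :: "'m \<Rightarrow> 'm \<Rightarrow> 'm"  \<comment> \<open>\<open>Cmp C g f\<close> is "first f, then g"\<close>
  Zer :: "'o \<Rightarrow> 'o \<Rightarrow> 'm"
  Add :: "'m \<Rightarrow> 'm \<Rightarrow> 'm"
  Scl :: "'k \<Rightarrow> 'm \<Rightarrow> 'm"
  UnitO :: "'o"
  TensO :: "'o \<Rightarrow> 'o \<Rightarrow> 'o"
  TensM :: "'m \<Rightarrow> 'm \<Rightarrow> 'm"

text \<open>Hom-sets of distinct pairs of objects are disjoint, which is why the operations on morphisms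
  need not be indexed by objects. Additive inverses are given by \<open>Scl C (- 1)\<close>.\<close>

locale strict_linear_monoidal_category =
  fixes C :: "('o, 'm, 'k::field) lmcat"
  assumes hom_disjoint:
      "\<lbrakk>x \<in> Obj C; y \<in> Obj C; x' \<in> Obj C; y' \<in> Obj C; f \<in> Hom C x y; f \<in> Hom C x' y'\<rbrakk>
        \<Longrightarrow> x = x' \<and> y = y'"
    and idt_closed: "x \<in> Obj C \<Longrightarrow> Idt C x \<in> Hom C x x"
    and cmp_closed:
      "\<lbrakk>x \<in> Obj C; y \<in> Obj C; z \<in> Obj C; f \<in> Hom C x y; g \<in> Hom C y z\<rbrakk> \<Longrightarrow> Cmp C g f \<in> Hom C x z"
    and idt_left: "\<lbrakk>x \<in> Obj C; y \<in> Obj C; f \<in> Hom C x y\<rbrakk> \<Longrightarrow> Cmp C (Idt C y) f = f"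
    and idt_right: "\<lbrakk>x \<in> Obj C; y \<in> Obj C; f \<in> Hom C x y\<rbrakk> \<Longrightarrow> Cmp C f (Idt C x) = f"
    and cmp_assoc:
      "\<lbrakk>w \<in> Obj C; x \<in> Obj C; y \<in> Obj C; z \<in> Obj C; f \<in> Hom C w x; g \<in> Hom C x y; h \<in> Hom C y z\<rbrakk>
        \<Longrightarrow> Cmp C (Cmp C h g) f = Cmp C h (Cmp C g f)"
    and zer_closed: "\<lbrakk>x \<in> Obj C; y \<in> Obj C\<rbrakk> \<Longrightarrow> Zer C x y \<in> Hom C x y"
    and add_closed:
      "\<lbrakk>x \<in> Obj C; y \<in> Obj C; f \<in> Hom C x y; g \<in> Hom C x y\<rbrakk> \<Longrightarrow> Add C f g \<in> Hom C x y"
    and scl_closed: "\<lbrakk>x \<in> Obj C; y \<in> Obj C; f \<in> Hom C x y\<rbrakk> \<Longrightarrow> Scl C c f \<in> Hom C x y"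
    and add_assoc:
      "\<lbrakk>x \<in> Obj C; y \<in> Obj C; f \<in> Hom C x y; g \<in> Hom C x y; h \<in> Hom C x y\<rbrakk>
        \<Longrightarrow> Add C (Add C f g) h = Add C f (Add C g h)"
    and add_commute:
      "\<lbrakk>x \<in> Obj C; y \<in> Obj C; f \<in> Hom C x y; g \<in> Hom C x y\<rbrakk> \<Longrightarrow> Add C f g = Add C g f"
    and add_zero: "\<lbrakk>x \<in> Obj C; y \<in> Obj C; f \<in> Hom C x y\<rbrakk> \<Longrightarrow> Add C (Zer C x y) f = f"
    and scl_zero: "\<lbrakk>x \<in> Obj C; y \<in> Obj C; f \<in> Hom C x y\<rbrakk> \<Longrightarrow> Scl C 0 f = Zer C x y"
    and scl_one: "\<lbrakk>x \<in> Obj C; y \<in> Obj C; f \<in> Hom C x y\<rbrakk> \<Longrightarrow> Scl C 1 f = f"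
    and scl_scl: "\<lbrakk>x \<in> Obj C; y \<in> Obj C; f \<in> Hom C x y\<rbrakk> \<Longrightarrow> Scl C c (Scl C d f) = Scl C (c * d) f"
    and scl_add_left:
      "\<lbrakk>x \<in> Obj C; y \<in> Obj C; f \<in> Hom C x y\<rbrakk> \<Longrightarrow> Scl C (c + d) f = Add C (Scl C c f) (Scl C d f)"
    and scl_add_right:
      "\<lbrakk>x \<in> Obj C; y \<in> Obj C; f \<in> Hom C x y; g \<in> Hom C x y\<rbrakk>
        \<Longrightarrow> Scl C c (Add C f g) = Add C (Scl C c f) (Scl C c g)"
    and cmp_add_left:
      "\<lbrakk>x \<in> Obj C; y \<in> Obj C; z \<in> Obj C; f \<in> Hom C x y; g \<in> Hom C y z; h \<in> Hom C y z\<rbrakk>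
        \<Longrightarrow> Cmp C (Add C g h) f = Add C (Cmp C g f) (Cmp C h f)"
    and cmp_add_right:
      "\<lbrakk>x \<in> Obj C; y \<in> Obj C; z \<in> Obj C; f \<in> Hom C x y; g \<in> Hom C x y; h \<in> Hom C y z\<rbrakk>
        \<Longrightarrow> Cmp C h (Add C f g) = Add C (Cmp C h f) (Cmp C h g)"
    and cmp_scl_left:
      "\<lbrakk>x \<in> Obj C; y \<in> Obj C; z \<in> Obj C; f \<in> Hom C x y; g \<in> Hom C y z\<rbrakk>
        \<Longrightarrow> Cmp C (Scl C c g) f = Scl C c (Cmp C g f)"
    and cmp_scl_right:
      "\<lbrakk>x \<in> Obj C; y \<in> Obj C; z \<in> Obj C; f \<in> Hom C x y; g \<in> Hom C y z\<rbrakk>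
        \<Longrightarrow> Cmp C g (Scl C c f) = Scl C c (Cmp C g f)"
    and unit_closed: "UnitO C \<in> Obj C"
    and tensO_closed: "\<lbrakk>x \<in> Obj C; y \<in> Obj C\<rbrakk> \<Longrightarrow> TensO C x y \<in> Obj C"
    and tensO_assoc:
      "\<lbrakk>x \<in> Obj C; y \<in> Obj C; z \<in> Obj C\<rbrakk> \<Longrightarrow> TensO C (TensO C x y) z = TensO C x (TensO C y z)"
    and tensO_unit_left: "x \<in> Obj C \<Longrightarrow> TensO C (UnitO C) x = x"
    and tensO_unit_right: "x \<in> Obj C \<Longrightarrow> TensO C x (UnitO C) = x"
    and tensM_closed:
      "\<lbrakk>x \<in> Obj C; y \<in> Obj C; x' \<in> Obj C; y' \<in> Obj C; f \<in> Hom C x y; g \<in> Hom C x' y'\<rbrakk>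
        \<Longrightarrow> TensM C f g \<in> Hom C (TensO C x x') (TensO C y y')"
    and tensM_idt:
      "\<lbrakk>x \<in> Obj C; y \<in> Obj C\<rbrakk> \<Longrightarrow> TensM C (Idt C x) (Idt C y) = Idt C (TensO C x y)"
    and interchange:
      "\<lbrakk>x \<in> Obj C; y \<in> Obj C; z \<in> Obj C; x' \<in> Obj C; y' \<in> Obj C; z' \<in> Obj C;
        f \<in> Hom C x y; g \<in> Hom C y z; f' \<in> Hom C x' y'; g' \<in> Hom C y' z'\<rbrakk>
        \<Longrightarrow> Cmp C (TensM C g g') (TensM C f f') = TensM C (Cmp C g f) (Cmp C g' f')"
    and tensM_assoc:
      "\<lbrakk>x \<in> Obj C; y \<in> Obj C; x' \<in> Obj C; y' \<in> Obj C; x'' \<in> Obj C; y'' \<in> Obj C;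
        f \<in> Hom C x y; g \<in> Hom C x' y'; h \<in> Hom C x'' y''\<rbrakk>
        \<Longrightarrow> TensM C (TensM C f g) h = TensM C f (TensM C g h)"
    and tensM_unit_left:
      "\<lbrakk>x \<in> Obj C; y \<in> Obj C; f \<in> Hom C x y\<rbrakk> \<Longrightarrow> TensM C (Idt C (UnitO C)) f = f"
    and tensM_unit_right:
      "\<lbrakk>x \<in> Obj C; y \<in> Obj C; f \<in> Hom C x y\<rbrakk> \<Longrightarrow> TensM C f (Idt C (UnitO C)) = f"
    and tensM_add_left:
      "\<lbrakk>x \<in> Obj C; y \<in> Obj C; x' \<in> Obj C; y' \<in> Obj C; f \<in> Hom C x y; g \<in> Hom C x y; h \<in> Hom C x' y'\<rbrakk>
        \<Longrightarrow> TensM C (Add C f g) h = Add C (TensM C f h) (TensM C g h)"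
    and tensM_add_right:
      "\<lbrakk>x \<in> Obj C; y \<in> Obj C; x' \<in> Obj C; y' \<in> Obj C; f \<in> Hom C x y; g \<in> Hom C x' y'; h \<in> Hom C x' y'\<rbrakk>
        \<Longrightarrow> TensM C f (Add C g h) = Add C (TensM C f g) (TensM C f h)"
    and tensM_scl_left:
      "\<lbrakk>x \<in> Obj C; y \<in> Obj C; x' \<in> Obj C; y' \<in> Obj C; f \<in> Hom C x y; g \<in> Hom C x' y'\<rbrakk>
        \<Longrightarrow> TensM C (Scl C c f) g = Scl C c (TensM C f g)"
    and tensM_scl_right:
      "\<lbrakk>x \<in> Obj C; y \<in> Obj C; x' \<in> Obj C; y' \<in> Obj C; f \<in> Hom C x y; g \<in> Hom C x' y'\<rbrakk>
        \<Longrightarrow> TensM C f (Scl C c g) = Scl C c (TensM C f g)"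

definition strict_linear_monoidal_functor ::
  "('o, 'm, 'k) lmcat \<Rightarrow> ('p, 'n, 'k) lmcat \<Rightarrow> ('o \<Rightarrow> 'p) \<Rightarrow> ('m \<Rightarrow> 'n) \<Rightarrow> bool" where
  "strict_linear_monoidal_functor C D F\<^sub>o F\<^sub>m \<longleftrightarrow>
     (\<forall>x\<in>Obj C. F\<^sub>o x \<in> Obj D) \<and>
     (\<forall>x\<in>Obj C. \<forall>y\<in>Obj C. \<forall>f\<in>Hom C x y. F\<^sub>m f \<in> Hom D (F\<^sub>o x) (F\<^sub>o y)) \<and>
     (\<forall>x\<in>Obj C. F\<^sub>m (Idt C x) = Idt D (F\<^sub>o x)) \<and>
     (\<forall>x\<in>Obj C. \<forall>y\<in>Obj C. \<forall>z\<in>Obj C. \<forall>f\<in>Hom C x y. \<forall>g\<in>Hom C y z.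
        F\<^sub>m (Cmp C g f) = Cmp D (F\<^sub>m g) (F\<^sub>m f)) \<and>
     (\<forall>x\<in>Obj C. \<forall>y\<in>Obj C. \<forall>f\<in>Hom C x y. \<forall>g\<in>Hom C x y.
        F\<^sub>m (Add C f g) = Add D (F\<^sub>m f) (F\<^sub>m g)) \<and>
     (\<forall>c. \<forall>x\<in>Obj C. \<forall>y\<in>Obj C. \<forall>f\<in>Hom C x y. F\<^sub>m (Scl C c f) = Scl D c (F\<^sub>m f)) \<and>
     F\<^sub>o (UnitO C) = UnitO D \<and>
     (\<forall>x\<in>Obj C. \<forall>y\<in>Obj C. F\<^sub>o (TensO C x y) = TensO D (F\<^sub>o x) (F\<^sub>o y)) \<and>
     (\<forall>x\<in>Obj C. \<forall>y\<in>Obj C. \<forall>x'\<in>Obj C. \<forall>y'\<in>Obj C. \<forall>f\<in>Hom C x y. \<forall>g\<in>Hom C x' y'.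
        F\<^sub>m (TensM C f g) = TensM D (F\<^sub>m f) (F\<^sub>m g))"

definition strict_linear_monoidal_isomorphism ::
  "('o, 'm, 'k) lmcat \<Rightarrow> ('p, 'n, 'k) lmcat \<Rightarrow> ('o \<Rightarrow> 'p) \<Rightarrow> ('m \<Rightarrow> 'n) \<Rightarrow> bool" where
  "strict_linear_monoidal_isomorphism C D F\<^sub>o F\<^sub>m \<longleftrightarrow>
     strict_linear_monoidal_functor C D F\<^sub>o F\<^sub>m \<and>
     bij_betw F\<^sub>o (Obj C) (Obj D) \<and>
     (\<forall>x\<in>Obj C. \<forall>y\<in>Obj C. bij_betw F\<^sub>m (Hom C x y) (Hom D (F\<^sub>o x) (F\<^sub>o y)))"

text \<open>Formal morphism expressions over generating objects \<open>'o\<close> and generating morphisms \<open>'g\<close>. Objects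
  of the free strict monoidal category are words in the generating objects.\<close>

datatype ('o, 'g, 'k) mterm =
    TGen 'g
  | TId "'o list"
  | TZero "'o list" "'o list"
  | TComp "('o, 'g, 'k) mterm" "('o, 'g, 'k) mterm"  (infixl "\<circ>\<^sub>t" 65)
  | TTens "('o, 'g, 'k) mterm" "('o, 'g, 'k) mterm"  (infixl "\<otimes>\<^sub>t" 70)
  | TAdd "('o, 'g, 'k) mterm" "('o, 'g, 'k) mterm"
  | TScl 'k "('o, 'g, 'k) mterm"

record ('o, 'g, 'k) presentation =
  gdom :: "'g \<Rightarrow> 'o list"
  gcod :: "'g \<Rightarrow> 'o list"
  rels :: "(('o, 'g, 'k) mterm \<times> ('o, 'g, 'k) mterm) set"

text \<open>\<open>wt P t a b\<close>: the expression \<open>t\<close> is well formed, with source \<open>a\<close> and target \<open>b\<close>.\<close>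

inductive wt ::
  "('o, 'g, 'k) presentation \<Rightarrow> ('o, 'g, 'k) mterm \<Rightarrow> 'o list \<Rightarrow> 'o list \<Rightarrow> bool"
  for P where
  wt_gen: "wt P (TGen g) (gdom P g) (gcod P g)"
| wt_id: "wt P (TId a) a a"
| wt_zero: "wt P (TZero a b) a b"
| wt_comp: "wt P t b c \<Longrightarrow> wt P u a b \<Longrightarrow> wt P (t \<circ>\<^sub>t u) a c"
| wt_tens: "wt P t a b \<Longrightarrow> wt P u a' b' \<Longrightarrow> wt P (t \<otimes>\<^sub>t u) (a @ a') (b @ b')"
| wt_add: "wt P t a b \<Longrightarrow> wt P u a b \<Longrightarrow> wt P (TAdd t u) a b"
| wt_scl: "wt P t a b \<Longrightarrow> wt P (TScl c t) a b"

definition wf_presentation :: "('o, 'g, 'k) presentation \<Rightarrow> bool" where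
  "wf_presentation P \<longleftrightarrow> (\<forall>(l, r)\<in>rels P. \<exists>a b. wt P l a b \<and> wt P r a b)"

text \<open>The first rule imposes the relations of \<open>P\<close>, the next seven make \<open>pcong\<close> a congruence on
  well-formed expressions, and the others match the equations of
  \<^locale>\<open>strict_linear_monoidal_category\<close> one by one (those between objects hold for words).\<close>

inductive pcong ::
  "('o, 'g, 'k::field) presentation \<Rightarrow> ('o, 'g, 'k) mterm \<Rightarrow> ('o, 'g, 'k) mterm \<Rightarrow> bool"
    ("_ \<turnstile> _ \<approx> _" [51, 51, 51] 50)
  for P where
  relation: "(l, r) \<in> rels P \<Longrightarrow> wt P l a b \<Longrightarrow> wt P r a b \<Longrightarrow> P \<turnstile> l \<approx> r"
| refl: "wt P t a b \<Longrightarrow> P \<turnstile> t \<approx> t"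
| sym: "P \<turnstile> t \<approx> u \<Longrightarrow> P \<turnstile> u \<approx> t"
| trans: "P \<turnstile> t \<approx> u \<Longrightarrow> P \<turnstile> u \<approx> v \<Longrightarrow> P \<turnstile> t \<approx> v"
| cong_comp:
    "P \<turnstile> t \<approx> t' \<Longrightarrow> P \<turnstile> u \<approx> u' \<Longrightarrow> wt P (t \<circ>\<^sub>t u) a b \<Longrightarrow> P \<turnstile> t \<circ>\<^sub>t u \<approx> t' \<circ>\<^sub>t u'"
| cong_tens: "P \<turnstile> t \<approx> t' \<Longrightarrow> P \<turnstile> u \<approx> u' \<Longrightarrow> P \<turnstile> t \<otimes>\<^sub>t u \<approx> t' \<otimes>\<^sub>t u'"
| cong_add:
    "P \<turnstile> t \<approx> t' \<Longrightarrow> P \<turnstile> u \<approx> u' \<Longrightarrow> wt P (TAdd t u) a b \<Longrightarrow> P \<turnstile> TAdd t u \<approx> TAdd t' u'"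
| cong_scl: "P \<turnstile> t \<approx> t' \<Longrightarrow> P \<turnstile> TScl c t \<approx> TScl c t'"
| id_left: "wt P t a b \<Longrightarrow> P \<turnstile> TId b \<circ>\<^sub>t t \<approx> t"
| id_right: "wt P t a b \<Longrightarrow> P \<turnstile> t \<circ>\<^sub>t TId a \<approx> t"
| comp_assoc:
    "wt P t c d \<Longrightarrow> wt P u b c \<Longrightarrow> wt P v a b \<Longrightarrow> P \<turnstile> (t \<circ>\<^sub>t u) \<circ>\<^sub>t v \<approx> t \<circ>\<^sub>t (u \<circ>\<^sub>t v)"
| add_assoc:
    "wt P t a b \<Longrightarrow> wt P u a b \<Longrightarrow> wt P v a b \<Longrightarrow> P \<turnstile> TAdd (TAdd t u) v \<approx> TAdd t (TAdd u v)"
| add_commute: "wt P t a b \<Longrightarrow> wt P u a b \<Longrightarrow> P \<turnstile> TAdd t u \<approx> TAdd u t"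
| add_zero: "wt P t a b \<Longrightarrow> P \<turnstile> TAdd (TZero a b) t \<approx> t"
| scl_zero: "wt P t a b \<Longrightarrow> P \<turnstile> TScl 0 t \<approx> TZero a b"
| scl_one: "wt P t a b \<Longrightarrow> P \<turnstile> TScl 1 t \<approx> t"
| scl_scl: "wt P t a b \<Longrightarrow> P \<turnstile> TScl c (TScl d t) \<approx> TScl (c * d) t"
| scl_add_left: "wt P t a b \<Longrightarrow> P \<turnstile> TScl (c + d) t \<approx> TAdd (TScl c t) (TScl d t)"
| scl_add_right:
    "wt P t a b \<Longrightarrow> wt P u a b \<Longrightarrow> P \<turnstile> TScl c (TAdd t u) \<approx> TAdd (TScl c t) (TScl c u)"
| comp_add_left:
    "wt P t b c \<Longrightarrow> wt P u b c \<Longrightarrow> wt P v a b \<Longrightarrow> P \<turnstile> TAdd t u \<circ>\<^sub>t v \<approx> TAdd (t \<circ>\<^sub>t v) (u \<circ>\<^sub>t v)"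
| comp_add_right:
    "wt P t b c \<Longrightarrow> wt P u a b \<Longrightarrow> wt P v a b \<Longrightarrow> P \<turnstile> t \<circ>\<^sub>t TAdd u v \<approx> TAdd (t \<circ>\<^sub>t u) (t \<circ>\<^sub>t v)"
| comp_scl_left: "wt P t b c \<Longrightarrow> wt P u a b \<Longrightarrow> P \<turnstile> TScl x t \<circ>\<^sub>t u \<approx> TScl x (t \<circ>\<^sub>t u)"
| comp_scl_right: "wt P t b c \<Longrightarrow> wt P u a b \<Longrightarrow> P \<turnstile> t \<circ>\<^sub>t TScl x u \<approx> TScl x (t \<circ>\<^sub>t u)"
| tens_id: "P \<turnstile> TId a \<otimes>\<^sub>t TId b \<approx> TId (a @ b)"
| interchange:
    "wt P t b c \<Longrightarrow> wt P u b' c' \<Longrightarrow> wt P v a b \<Longrightarrow> wt P w a' b' \<Longrightarrow>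
      P \<turnstile> (t \<otimes>\<^sub>t u) \<circ>\<^sub>t (v \<otimes>\<^sub>t w) \<approx> (t \<circ>\<^sub>t v) \<otimes>\<^sub>t (u \<circ>\<^sub>t w)"
| tens_assoc:
    "wt P t a b \<Longrightarrow> wt P u a' b' \<Longrightarrow> wt P v a'' b'' \<Longrightarrow>
      P \<turnstile> (t \<otimes>\<^sub>t u) \<otimes>\<^sub>t v \<approx> t \<otimes>\<^sub>t (u \<otimes>\<^sub>t v)"
| tens_unit_left: "wt P t a b \<Longrightarrow> P \<turnstile> TId [] \<otimes>\<^sub>t t \<approx> t"
| tens_unit_right: "wt P t a b \<Longrightarrow> P \<turnstile> t \<otimes>\<^sub>t TId [] \<approx> t"
| tens_add_left:
    "wt P t a b \<Longrightarrow> wt P u a b \<Longrightarrow> wt P v a' b' \<Longrightarrow>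
      P \<turnstile> TAdd t u \<otimes>\<^sub>t v \<approx> TAdd (t \<otimes>\<^sub>t v) (u \<otimes>\<^sub>t v)"
| tens_add_right:
    "wt P t a b \<Longrightarrow> wt P u a' b' \<Longrightarrow> wt P v a' b' \<Longrightarrow>
      P \<turnstile> t \<otimes>\<^sub>t TAdd u v \<approx> TAdd (t \<otimes>\<^sub>t u) (t \<otimes>\<^sub>t v)"
| tens_scl_left: "wt P t a b \<Longrightarrow> wt P u a' b' \<Longrightarrow> P \<turnstile> TScl x t \<otimes>\<^sub>t u \<approx> TScl x (t \<otimes>\<^sub>t u)"
| tens_scl_right: "wt P t a b \<Longrightarrow> wt P u a' b' \<Longrightarrow> P \<turnstile> t \<otimes>\<^sub>t TScl x u \<approx> TScl x (t \<otimes>\<^sub>t u)"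

definition pclass ::
  "('o, 'g, 'k::field) presentation \<Rightarrow> ('o, 'g, 'k) mterm \<Rightarrow> ('o, 'g, 'k) mterm set" where
  "pclass P t = {u. P \<turnstile> t \<approx> u}"

text \<open>The free strict linear monoidal category on the generators of \<open>P\<close>, modulo the relations
  of \<open>P\<close>. In each operation the union is over equal classes.\<close>

definition presented_category ::
  "('o, 'g, 'k::field) presentation \<Rightarrow> ('o list, ('o, 'g, 'k) mterm set, 'k) lmcat" where
  "presented_category P = \<lparr>
     Obj = UNIV,
     Hom = (\<lambda>a b. {pclass P t | t. wt P t a b}),
     Idt = (\<lambda>a. pclass P (TId a)),
     Cmp = (\<lambda>S T. \<Union>t\<in>S. \<Union>u\<in>T. pclass P (t \<circ>\<^sub>t u)),
     Zer = (\<lambda>a b. pclass P (TZero a b)),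
     Add = (\<lambda>S T. \<Union>t\<in>S. \<Union>u\<in>T. pclass P (TAdd t u)),
     Scl = (\<lambda>c S. \<Union>t\<in>S. pclass P (TScl c t)),
     UnitO = [],
     TensO = (@),
     TensM = (\<lambda>S T. \<Union>t\<in>S. \<Union>u\<in>T. pclass P (t \<otimes>\<^sub>t u)) \<rparr>"

text \<open>\<open>v\<close> and \<open>w\<close> interpret the generating objects and morphisms in \<open>C\<close>. The functor is
  determined by them, so the condition says that the canonical functor from the presented category
  is an isomorphism.\<close>

definition is_presentation_of ::
  "('o, 'g, 'k::field) presentation \<Rightarrow> ('p, 'n, 'k) lmcat \<Rightarrow> ('o \<Rightarrow> 'p) \<Rightarrow> ('g \<Rightarrow> 'n) \<Rightarrow> bool" where
  "is_presentation_of P C v w \<longleftrightarrow>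
     wf_presentation P \<and>
     strict_linear_monoidal_category C \<and>
     (\<exists>F\<^sub>o F\<^sub>m. strict_linear_monoidal_isomorphism (presented_category P) C F\<^sub>o F\<^sub>m \<and>
        (\<forall>x. F\<^sub>o [x] = v x) \<and> (\<forall>g. F\<^sub>m (pclass P (TGen g)) = w g))"

text \<open>\<open>d i = Some (j, n)\<close>: the bottom vertex \<open>i\<close> is joined to the top vertex \<open>j\<close> by a strand of
  winding \<open>n\<close>. All other vertices are isolated.\<close>

type_synonym adiag = "nat \<rightharpoonup> nat \<times> int"

definition adiags :: "nat \<Rightarrow> nat \<Rightarrow> adiag set" where
  "adiags s t = {d. dom d \<subseteq> {1..s} \<and> fst ` ran d \<subseteq> {1..t} \<and> inj_on (\<lambda>i. fst (the (d i))) (dom d)}"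

definition diag_id :: "nat \<Rightarrow> adiag" where
  "diag_id s = (\<lambda>i. if i \<in> {1..s} then Some (i, 0) else None)"

definition diag_comp :: "adiag \<Rightarrow> adiag \<Rightarrow> adiag" where
  "diag_comp a b = (\<lambda>i. case b i of None \<Rightarrow> None | Some (j, m) \<Rightarrow>
     (case a j of None \<Rightarrow> None | Some (l, n) \<Rightarrow> Some (l, m + n)))"

definition closed_components :: "nat \<Rightarrow> adiag \<Rightarrow> adiag \<Rightarrow> nat" where
  "closed_components t a b = card {j \<in> {1..t}. j \<notin> dom a \<and> j \<notin> fst ` ran b}"

text \<open>Juxtaposition, with an \<open>(s, t)\<close>-diagram \<open>a\<close> on the left.\<close>

definition diag_tens :: "nat \<Rightarrow> nat \<Rightarrow> adiag \<Rightarrow> adiag \<Rightarrow> adiag" where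
  "diag_tens s t a b = (\<lambda>i. if i \<le> s then a i else map_option (\<lambda>(j, n). (t + j, n)) (b (i - s)))"

text \<open>A morphism records its source, its target, and a linear combination of diagrams.\<close>

type_synonym 'k aro_mor = "nat \<times> nat \<times> (adiag \<Rightarrow>\<^sub>0 'k)"

fun aro_comp :: "'k::field \<Rightarrow> 'k aro_mor \<Rightarrow> 'k aro_mor \<Rightarrow> 'k aro_mor" where
  "aro_comp \<beta> (t', u, g) (s, t, f) =
     (s, u, \<Sum>a\<in>Poly_Mapping.keys g. \<Sum>b\<in>Poly_Mapping.keys f.
        Poly_Mapping.single (diag_comp a b)
          (\<beta> ^ closed_components t a b * Poly_Mapping.lookup g a * Poly_Mapping.lookup f b))"

fun aro_add :: "'k::field aro_mor \<Rightarrow> 'k aro_mor \<Rightarrow> 'k aro_mor" where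
  "aro_add (s, t, f) (s', t', g) = (s, t, f + g)"

fun aro_scl :: "'k::field \<Rightarrow> 'k aro_mor \<Rightarrow> 'k aro_mor" where
  "aro_scl c (s, t, f) = (s, t, Poly_Mapping.map (\<lambda>x. c * x) f)"

fun aro_tens :: "'k::field aro_mor \<Rightarrow> 'k aro_mor \<Rightarrow> 'k aro_mor" where
  "aro_tens (s, t, f) (s', t', g) =
     (s + s', t + t', \<Sum>a\<in>Poly_Mapping.keys f. \<Sum>b\<in>Poly_Mapping.keys g.
        Poly_Mapping.single (diag_tens s t a b) (Poly_Mapping.lookup f a * Poly_Mapping.lookup g b))"

definition diag_mor :: "nat \<Rightarrow> nat \<Rightarrow> adiag \<Rightarrow> 'k::field aro_mor" where
  "diag_mor s t d = (s, t, Poly_Mapping.single d 1)"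

definition aRo :: "'k::field \<Rightarrow> (nat, 'k aro_mor, 'k) lmcat" where
  "aRo \<beta> = \<lparr>
     Obj = UNIV,
     Hom = (\<lambda>s t. {(s, t, f) | f. Poly_Mapping.keys f \<subseteq> adiags s t}),
     Idt = (\<lambda>s. diag_mor s s (diag_id s)),
     Cmp = aro_comp \<beta>,
     Zer = (\<lambda>s t. (s, t, 0)),
     Add = aro_add,
     Scl = aro_scl,
     UnitO = 0,
     TensO = (+),
     TensM = aro_tens \<rparr>"

text \<open>The single generating object is \<open>() :: unit\<close>, so the word \<open>replicate n ()\<close> stands for the
  object \<open>n\<close>.\<close>

datatype rook_gen = GX | GEta | GEps | GPhiPlus | GPhiMinus

fun rook_gen_dom :: "rook_gen \<Rightarrow> nat" where
  "rook_gen_dom GX = 2"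
| "rook_gen_dom GEta = 0"
| "rook_gen_dom GEps = 1"
| "rook_gen_dom GPhiPlus = 1"
| "rook_gen_dom GPhiMinus = 1"

fun rook_gen_cod :: "rook_gen \<Rightarrow> nat" where
  "rook_gen_cod GX = 2"
| "rook_gen_cod GEta = 1"
| "rook_gen_cod GEps = 0"
| "rook_gen_cod GPhiPlus = 1"
| "rook_gen_cod GPhiMinus = 1"

fun rook_gen_mor :: "rook_gen \<Rightarrow> 'k::field aro_mor" where
  "rook_gen_mor GX = diag_mor 2 2 [1 \<mapsto> (2, 0), 2 \<mapsto> (1, 0)]"
| "rook_gen_mor GEta = diag_mor 0 1 Map.empty"
| "rook_gen_mor GEps = diag_mor 1 0 Map.empty"
| "rook_gen_mor GPhiPlus = diag_mor 1 1 [1 \<mapsto> (1, 1)]"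
| "rook_gen_mor GPhiMinus = diag_mor 1 1 [1 \<mapsto> (1, - 1)]"

definition rook_rels ::
  "'k::field \<Rightarrow> ((unit, rook_gen, 'k) mterm \<times> (unit, rook_gen, 'k) mterm) set" where
  "rook_rels \<beta> =
    (let \<iota> = (\<lambda>n. TId (replicate n ())); I = \<iota> 1; X = TGen GX; \<eta> = TGen GEta; \<epsilon> = TGen GEps;
         \<phi>\<^sub>p = TGen GPhiPlus; \<phi>\<^sub>m = TGen GPhiMinus
     in
       {(X \<circ>\<^sub>t X, \<iota> 2),
        (\<epsilon> \<circ>\<^sub>t \<eta>, TScl \<beta> (\<iota> 0)),
        ((X \<otimes>\<^sub>t I) \<circ>\<^sub>t (I \<otimes>\<^sub>t X) \<circ>\<^sub>t (X \<otimes>\<^sub>t I), (I \<otimes>\<^sub>t X) \<circ>\<^sub>t (X \<otimes>\<^sub>t I) \<circ>\<^sub>t (I \<otimes>\<^sub>t X)),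
        ((I \<otimes>\<^sub>t \<epsilon>) \<circ>\<^sub>t X, \<epsilon> \<otimes>\<^sub>t I),
        (X \<circ>\<^sub>t (I \<otimes>\<^sub>t \<eta>), \<eta> \<otimes>\<^sub>t I),
        (\<phi>\<^sub>p \<circ>\<^sub>t \<phi>\<^sub>m, I),
        (I, \<phi>\<^sub>m \<circ>\<^sub>t \<phi>\<^sub>p)} \<union>
       (\<Union>\<phi>\<in>{\<phi>\<^sub>p, \<phi>\<^sub>m}.
         {((\<phi> \<otimes>\<^sub>t I) \<circ>\<^sub>t X, X \<circ>\<^sub>t (I \<otimes>\<^sub>t \<phi>)),
          ((I \<otimes>\<^sub>t \<phi>) \<circ>\<^sub>t X, X \<circ>\<^sub>t (\<phi> \<otimes>\<^sub>t I)),
          (\<phi> \<circ>\<^sub>t \<eta>, \<eta>),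
          (\<epsilon> \<circ>\<^sub>t \<phi>, \<epsilon>)}))"

definition rook_presentation :: "'k::field \<Rightarrow> (unit, rook_gen, 'k) presentation" where
  "rook_presentation \<beta> = \<lparr>
     gdom = (\<lambda>g. replicate (rook_gen_dom g) ()),
     gcod = (\<lambda>g. replicate (rook_gen_cod g) ()),
     rels = rook_rels \<beta> \<rparr>"

end

theory Submission
  imports Defs
begin

text \<open>
  The relations hold for diagrams, so evaluating expressions as linear combinations of diagrams
  gives a functor from the presented category to the affine rook category. For this the affine
  rook category must be known to be a strict linear monoidal category; the one delicate point is
  associativity, where closed components are counted at two different levels
  (\<open>closed_components_assoc\<close>). What has to be shown is that the functor is bijective on morphism
  spaces.

  Each diagram \<open>d\<close> is given a normal form \<open>N(d)\<close> by peeling off its last bottom vertex. If that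
  vertex is isolated, then \<open>N(d) = N(d') \<otimes> \<epsilon>\<close>. If it is joined, with label \<open>n\<close>, to the top vertex
  \<open>p + 1\<close> out of \<open>p + 1 + k\<close>, then \<open>N(d) = (I\<^sub>p \<otimes> c\<^sub>k) \<circ> (N(d') \<otimes> \<phi>\<^sup>n)\<close>, where \<open>c\<^sub>k\<close> is the
  product of crossings that carries the last strand leftwards past \<open>k\<close> others. A diagram without
  bottom vertices has the normal form \<open>\<eta> \<otimes> \<dots> \<otimes> \<eta>\<close>. In the affine rook category \<open>N(d)\<close> evaluates to
  the basis element \<open>d\<close> (\<open>diagram_ev_normal_form\<close>), which makes the functor full.

  For faithfulness, the relations say that \<open>c\<^sub>k\<close> is natural both in the \<open>k\<close> strands it passes
  (\<open>passes_gen\<close>, \<open>passes_tens\<close>) and in the strand it moves (\<open>phi_comp_cyc\<close>, \<open>eps_comp_cyc\<close>). A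
  generator with identities on both sides that is composed with \<open>N(d)\<close> can therefore be pushed
  below \<open>c\<^sub>k\<close>, onto \<open>N(d')\<close> or onto the label \<open>\<phi>\<^sup>n\<close>, unless it is a crossing that involves the
  moving strand, and then it lengthens or shortens \<open>c\<^sub>k\<close>. By induction the product is a scalar
  multiple of some normal form (\<open>whiskered_gen_comp_normal_form\<close>). It does not matter which one:
  it follows already that normal forms span all morphisms of the presented category (\<open>expansion\<close>),
  and since their images are linearly independent, the image of a morphism determines its
  coefficients.\<close>

section \<open>Strict linear monoidal categories\<close>

text \<open>Typing is expressed by \<open>src\<close> and \<open>tgt\<close> rather than by membership in hom-sets. The side
  conditions of the axioms become equations between objects, which the simplifier can compute, so
  that associativity and the interchange law can be used as rewrite rules.\<close>

context strict_linear_monoidal_category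
begin

definition arr :: "'m \<Rightarrow> bool" where
  "arr f \<longleftrightarrow> (\<exists>x\<in>Obj C. \<exists>y\<in>Obj C. f \<in> Hom C x y)"

definition src :: "'m \<Rightarrow> 'o" where
  "src f = (THE x. x \<in> Obj C \<and> (\<exists>y\<in>Obj C. f \<in> Hom C x y))"

definition tgt :: "'m \<Rightarrow> 'o" where
  "tgt f = (THE y. y \<in> Obj C \<and> (\<exists>x\<in>Obj C. f \<in> Hom C x y))"

abbreviation comp_arr (infixr "\<cdot>" 65) where "g \<cdot> f \<equiv> Cmp C g f"
abbreviation tens_arr (infixr "\<odot>" 70) where "f \<odot> g \<equiv> TensM C f g"

lemma arrI:
  assumes "f \<in> Hom C x y" "x \<in> Obj C" "y \<in> Obj C"
  shows "arr f" "src f = x" "tgt f = y"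
proof -
  show "arr f"
    using assms unfolding arr_def by blast
  show "src f = x"
    unfolding src_def
  proof (rule the_equality)
    show "x' = x" if "x' \<in> Obj C \<and> (\<exists>y\<in>Obj C. f \<in> Hom C x' y)" for x'
      using that hom_disjoint[OF _ _ assms(2,3) _ assms(1)] by blast
  qed (use assms in blast)
  show "tgt f = y"
    unfolding tgt_def
  proof (rule the_equality)
    show "y' = y" if "y' \<in> Obj C \<and> (\<exists>x\<in>Obj C. f \<in> Hom C x y')" for y'
      using that hom_disjoint[OF _ _ assms(2,3) _ assms(1)] by blast
  qed (use assms in blast)
qed

lemma arr_hom:
  assumes "arr f"
  shows "src f \<in> Obj C" "tgt f \<in> Obj C" "f \<in> Hom C (src f) (tgt f)"
proof -
  obtain x y where "x \<in> Obj C" "y \<in> Obj C" "f \<in> Hom C x y"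
    using assms unfolding arr_def by blast
  then show "src f \<in> Obj C" "tgt f \<in> Obj C" "f \<in> Hom C (src f) (tgt f)"
    using arrI[of f x y] by auto
qed

lemma hom_tgt: "arr f \<Longrightarrow> tgt f = y \<Longrightarrow> f \<in> Hom C (src f) y"
  using arr_hom(3) by blast

lemma arr_idt [simp]:
  assumes "x \<in> Obj C"
  shows "arr (Idt C x)" "src (Idt C x) = x" "tgt (Idt C x) = x"
  using arrI[OF idt_closed[OF assms] assms assms] by auto

lemma arr_cmp [simp]:
  assumes "arr f" "arr g" "tgt f = src g"
  shows "arr (g \<cdot> f)" "src (g \<cdot> f) = src f" "tgt (g \<cdot> f) = tgt g"
  using arrI[OF cmp_closed[OF arr_hom(1)[OF assms(1)] arr_hom(1,2)[OF assms(2)]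
        hom_tgt[OF assms(1,3)] arr_hom(3)[OF assms(2)]] arr_hom(1)[OF assms(1)]
            arr_hom(2)[OF assms(2)]]
  by auto

lemma arr_tens [simp]:
  assumes "arr f" "arr g"
  shows "arr (f \<odot> g)" "src (f \<odot> g) = TensO C (src f) (src g)"
    "tgt (f \<odot> g) = TensO C (tgt f) (tgt g)"
proof -
  note f = arr_hom[OF assms(1)] and g = arr_hom[OF assms(2)]
  show "arr (f \<odot> g)" "src (f \<odot> g) = TensO C (src f) (src g)"
      "tgt (f \<odot> g) = TensO C (tgt f) (tgt g)"
    using arrI[OF tensM_closed[OF f(1,2) g(1,2) f(3) g(3)]] f g tensO_closed by auto
qed

lemma arr_scl [simp]:
  assumes "arr f"
  shows "arr (Scl C c f)" "src (Scl C c f) = src f" "tgt (Scl C c f) = tgt f"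
  using arrI[OF scl_closed[OF arr_hom(1,2,3)[OF assms]] arr_hom(1,2)[OF assms]] by auto

lemma arr_add [simp]:
  assumes "arr f" "arr g" "src g = src f" "tgt g = tgt f"
  shows "arr (Add C f g)" "src (Add C f g) = src f" "tgt (Add C f g) = tgt f"
proof -
  note f = arr_hom[OF assms(1)] and g = arr_hom[OF assms(2), unfolded assms(3,4)]
  show "arr (Add C f g)" "src (Add C f g) = src f" "tgt (Add C f g) = tgt f"
    using arrI[OF add_closed[OF f(1,2) f(3) g(3)] f(1,2)] by auto
qed

lemma arr_zer [simp]:
  assumes "x \<in> Obj C" "y \<in> Obj C"
  shows "arr (Zer C x y)" "src (Zer C x y) = x" "tgt (Zer C x y) = y"
  using arrI[OF zer_closed[OF assms] assms] by auto

lemma comp_idt_left: "arr f \<Longrightarrow> tgt f = x \<Longrightarrow> Idt C x \<cdot> f = f"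
  using idt_left arr_hom by blast

lemma comp_idt_right: "arr f \<Longrightarrow> src f = x \<Longrightarrow> f \<cdot> Idt C x = f"
  using idt_right arr_hom by blast

lemma comp_assoc:
  "arr f \<Longrightarrow> arr g \<Longrightarrow> arr h \<Longrightarrow> tgt f = src g \<Longrightarrow> tgt g = src h \<Longrightarrow> (h \<cdot> g) \<cdot> f = h \<cdot> g \<cdot> f"
  using cmp_assoc[of "src f" "tgt f" "tgt g" "tgt h" f g h] arr_hom hom_tgt by simp

lemma tens_assoc: "arr f \<Longrightarrow> arr g \<Longrightarrow> arr h \<Longrightarrow> (f \<odot> g) \<odot> h = f \<odot> g \<odot> h"
  using tensM_assoc arr_hom by meson

lemma tens_unit:
  assumes "arr f"
  shows "Idt C (UnitO C) \<odot> f = f" "f \<odot> Idt C (UnitO C) = f"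
  using assms tensM_unit_left tensM_unit_right arr_hom by meson+

lemma tens_comp:
  "arr f \<Longrightarrow> arr g \<Longrightarrow> arr f' \<Longrightarrow> arr g' \<Longrightarrow> tgt f = src g \<Longrightarrow> tgt f' = src g'
    \<Longrightarrow> (g \<odot> g') \<cdot> (f \<odot> f') = (g \<cdot> f) \<odot> (g' \<cdot> f')"
  using interchange[of "src f" "tgt f" "tgt g" "src f'" "tgt f'"
      "tgt g'" f g f' g'] arr_hom hom_tgt by simp

lemma comp_scl:
  assumes "arr f" "arr g" "tgt f = src g"
  shows "Scl C c g \<cdot> f = Scl C c (g \<cdot> f)" "g \<cdot> Scl C c f = Scl C c (g \<cdot> f)"
  using assms cmp_scl_left[of "src f" "src g" "tgt g" f g] cmp_scl_right[of "src f" "src g"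
      "tgt g" f g]
    arr_hom(1,2)[of f] arr_hom(1,2)[of g] arr_hom(3)[of f] arr_hom(3)[of g] by simp_all

lemma tens_scl:
  assumes "arr f" "arr g"
  shows "Scl C c f \<odot> g = Scl C c (f \<odot> g)" "f \<odot> Scl C c g = Scl C c (f \<odot> g)"
  using assms tensM_scl_left tensM_scl_right arr_hom by meson+

lemma scl_scl': "arr f \<Longrightarrow> Scl C c (Scl C d f) = Scl C (c * d) f"
  using scl_scl arr_hom by meson

lemma scl_one': "arr f \<Longrightarrow> Scl C 1 f = f"
  using scl_one arr_hom by meson

lemma comp_add:
  assumes "arr f" "arr g" "arr h" "src f = src g" "tgt f = tgt g"
  shows "tgt f = src h \<Longrightarrow> h \<cdot> Add C f g = Add C (h \<cdot> f) (h \<cdot> g)"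
    and "tgt h = src f \<Longrightarrow> Add C f g \<cdot> h = Add C (f \<cdot> h) (g \<cdot> h)"
  using assms cmp_add_right[of "src f" "tgt f" "tgt h" f g h]
    cmp_add_left[of "src h" "tgt h" "tgt f" h f g] arr_hom[of f] arr_hom[of g] arr_hom[of h]
  by simp_all

lemma zer_eq: "arr f \<Longrightarrow> src f = x \<Longrightarrow> tgt f = y \<Longrightarrow> Zer C x y = Scl C 0 f"
  using scl_zero arr_hom by metis

lemma tens_add:
  assumes "arr f" "arr g" "arr h" "src f = src g" "tgt f = tgt g"
  shows "Add C f g \<odot> h = Add C (f \<odot> h) (g \<odot> h)" "h \<odot> Add C f g = Add C (h \<odot> f) (h \<odot> g)"
  using assms tensM_add_left[of "src g" "tgt g" "src h" "tgt h" f g h]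
    tensM_add_right[of "src h" "tgt h" "src g" "tgt g" h f g]
    arr_hom[of g] arr_hom[of h] arr_hom(3)[of f] by simp_all

lemma scl_add:
  assumes "arr f" "arr g" "src f = src g" "tgt f = tgt g"
  shows "Scl C c (Add C f g) = Add C (Scl C c f) (Scl C c g)"
  using assms scl_add_right[of "src g" "tgt g" f g c] arr_hom[of g] arr_hom(3)[of f] by simp

lemma scl_plus: "arr f \<Longrightarrow> Scl C (c + d) f = Add C (Scl C c f) (Scl C d f)"
  using scl_add_left arr_hom by blast

lemma add_zer: "arr f \<Longrightarrow> src f = x \<Longrightarrow> tgt f = y \<Longrightarrow> Add C (Zer C x y) f = f"
  using add_zero arr_hom by blast

lemma add_zer_right: "arr f \<Longrightarrow> src f = x \<Longrightarrow> tgt f = y \<Longrightarrow> Add C f (Zer C x y) = f"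
  using add_commute[OF arr_hom(1,2,3)[of f] zer_closed[OF arr_hom(1,2)[of f]]] add_zer by auto

lemma scl_zer: "x \<in> Obj C \<Longrightarrow> y \<in> Obj C \<Longrightarrow> Scl C c (Zer C x y) = Zer C x y"
  using zer_eq[of "Zer C x y" x y] scl_scl'[of "Zer C x y" c 0] by simp

lemma comp_zer:
  assumes h: "arr h" and x: "x \<in> Obj C" and y: "y \<in> Obj C"
  shows "src h = y \<Longrightarrow> h \<cdot> Zer C x y = Zer C x (tgt h)"
    and "tgt h = x \<Longrightarrow> Zer C x y \<cdot> h = Zer C (src h) y"
proof -
  note Z = arr_zer[OF x y]
  show "h \<cdot> Zer C x y = Zer C x (tgt h)" if "src h = y"
    using comp_scl(2)[OF Z(1) h, of 0] zer_eq[OF arr_cmp[OF Z(1) h]] h that Z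
    unfolding scl_zer[OF x y] by simp
  show "Zer C x y \<cdot> h = Zer C (src h) y" if "tgt h = x"
    using comp_scl(1)[OF h Z(1), of 0] zer_eq[OF arr_cmp[OF h Z(1)]] h that Z
    unfolding scl_zer[OF x y] by simp
qed

lemma tens_zer:
  assumes h: "arr h" and x: "x \<in> Obj C" and y: "y \<in> Obj C"
  shows "h \<odot> Zer C x y = Zer C (TensO C (src h) x) (TensO C (tgt h) y)"
    and "Zer C x y \<odot> h = Zer C (TensO C x (src h)) (TensO C y (tgt h))"
proof -
  note Z = arr_zer[OF x y]
  show "h \<odot> Zer C x y = Zer C (TensO C (src h) x) (TensO C (tgt h) y)"
    using tens_scl(2)[OF h Z(1), of 0] zer_eq[OF arr_tens(1)[OF h Z(1)] arr_tens(2,3)[OF h Z(1)]]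
    unfolding scl_zer[OF x y] Z by simp
  show "Zer C x y \<odot> h = Zer C (TensO C x (src h)) (TensO C y (tgt h))"
    using tens_scl(1)[OF Z(1) h, of 0] zer_eq[OF arr_tens(1)[OF Z(1) h] arr_tens(2,3)[OF Z(1) h]]
    unfolding scl_zer[OF x y] Z by simp
qed

lemma add_swap:
  assumes "arr f" "arr g" "arr h" "arr k" "src g = src f" "src h = src f" "src k = src f"
    "tgt g = tgt f" "tgt h = tgt f" "tgt k = tgt f"
  shows "Add C (Add C f g) (Add C h k) = Add C (Add C f h) (Add C g k)"
proof -
  note ob = arr_hom(1,2)[OF assms(1)]
  have f: "f \<in> Hom C (src f) (tgt f)" and g: "g \<in> Hom C (src f) (tgt f)"
    and h: "h \<in> Hom C (src f) (tgt f)" and k: "k \<in> Hom C (src f) (tgt f)"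
    using assms by (metis arr_hom(3))+
  have "Add C (Add C f g) (Add C h k) = Add C f (Add C (Add C g h) k)"
    using add_assoc[OF ob f g add_closed[OF ob h k]] add_assoc[OF ob g h k] by simp
  also have "\<dots> = Add C f (Add C h (Add C g k))"
    using add_commute[OF ob g h] add_assoc[OF ob h g k] by simp
  finally show ?thesis
    using add_assoc[OF ob f h add_closed[OF ob g k]] by simp
qed

end

section \<open>Models of a presentation\<close>

text \<open>The source and the target of an expression can be read off without knowing that it is well
  typed. Well-typedness is then a computation, which replaces the search for the intermediate word
  in a composite.\<close>

primrec term_src :: "('o, 'g, 'k) presentation \<Rightarrow> ('o, 'g, 'k) mterm \<Rightarrow> 'o list" where
  "term_src P (TGen g) = gdom P g"
| "term_src P (TId a) = a"
| "term_src P (TZero a b) = a"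
| "term_src P (t \<circ>\<^sub>t u) = term_src P u"
| "term_src P (t \<otimes>\<^sub>t u) = term_src P t @ term_src P u"
| "term_src P (TAdd t u) = term_src P t"
| "term_src P (TScl c t) = term_src P t"

primrec term_tgt :: "('o, 'g, 'k) presentation \<Rightarrow> ('o, 'g, 'k) mterm \<Rightarrow> 'o list" where
  "term_tgt P (TGen g) = gcod P g"
| "term_tgt P (TId a) = a"
| "term_tgt P (TZero a b) = b"
| "term_tgt P (t \<circ>\<^sub>t u) = term_tgt P t"
| "term_tgt P (t \<otimes>\<^sub>t u) = term_tgt P t @ term_tgt P u"
| "term_tgt P (TAdd t u) = term_tgt P t"
| "term_tgt P (TScl c t) = term_tgt P t"

primrec well_typed :: "('o, 'g, 'k) presentation \<Rightarrow> ('o, 'g, 'k) mterm \<Rightarrow> bool" where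
  "well_typed P (TGen g) \<longleftrightarrow> True"
| "well_typed P (TId a) \<longleftrightarrow> True"
| "well_typed P (TZero a b) \<longleftrightarrow> True"
| "well_typed P (t \<circ>\<^sub>t u) \<longleftrightarrow> well_typed P t \<and> well_typed P u \<and> term_src P t = term_tgt P u"
| "well_typed P (t \<otimes>\<^sub>t u) \<longleftrightarrow> well_typed P t \<and> well_typed P u"
| "well_typed P (TAdd t u) \<longleftrightarrow> well_typed P t \<and> well_typed P u
     \<and> term_src P u = term_src P t \<and> term_tgt P u = term_tgt P t"
| "well_typed P (TScl c t) \<longleftrightarrow> well_typed P t"

lemma wt_iff: "wt P t a b \<longleftrightarrow> well_typed P t \<and> a = term_src P t \<and> b = term_tgt P t"
proof
  show "well_typed P t \<and> a = term_src P t \<and> b = term_tgt P t" if "wt P t a b"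
    using that by induction simp_all
  have "well_typed P t \<Longrightarrow> wt P t (term_src P t) (term_tgt P t)"
  proof (induction t)
    case (TComp t u)
    then show ?case using wt_comp[of P t "term_src P t" "term_tgt P t" u "term_src P u"] by simp
  next
    case (TAdd t u)
    then show ?case using wt_add[of P t "term_src P t" "term_tgt P t" u] by simp
  qed (simp_all add: wt.intros)
  then show "wt P t a b" if "well_typed P t \<and> a = term_src P t \<and> b = term_tgt P t"
    using that by simp
qed

lemma pcong_type:
  "P \<turnstile> t \<approx> u \<Longrightarrow> well_typed P t \<and> well_typed P u \<and> term_src P u = term_src P t
     \<and> term_tgt P u = term_tgt P t"
  by (induction rule: pcong.induct) (simp_all add: wt_iff)

lemma pclass_eq: "P \<turnstile> t \<approx> u \<Longrightarrow> pclass P t = pclass P u"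
  unfolding pclass_def by (blast intro: pcong.sym pcong.trans)

lemma pclass_eq_iff: "well_typed P t \<Longrightarrow> pclass P t = pclass P u \<longleftrightarrow> P \<turnstile> u \<approx> t"
  using pclass_eq[of P u t] pcong.refl[of P t "term_src P t" "term_tgt P t"]
  by (auto simp: wt_iff pclass_def)

text \<open>An operation that respects congruence can be computed on representatives.\<close>

lemma pclass_UN:
  assumes "well_typed P t" and "\<And>t'. P \<turnstile> t \<approx> t' \<Longrightarrow> P \<turnstile> f t \<approx> f t'"
  shows "(\<Union>t'\<in>pclass P t. pclass P (f t')) = pclass P (f t)"
proof -
  have "pclass P (f t') = pclass P (f t)" if "t' \<in> pclass P t" for t'
    using assms(2) that pclass_eq unfolding pclass_def by blast
  moreover have "t \<in> pclass P t"
    using pcong.refl assms(1) unfolding pclass_def wt_iff by blast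
  ultimately show ?thesis by blast
qed

lemma pclass_UN2:
  assumes "well_typed P t" "well_typed P u"
    and "\<And>t' u'. P \<turnstile> t \<approx> t' \<Longrightarrow> P \<turnstile> u \<approx> u' \<Longrightarrow> P \<turnstile> f t u \<approx> f t' u'"
  shows "(\<Union>t'\<in>pclass P t. \<Union>u'\<in>pclass P u. pclass P (f t' u')) = pclass P (f t u)"
proof -
  have "pclass P (f t' u') = pclass P (f t u)" if "t' \<in> pclass P t" "u' \<in> pclass P u" for t' u'
    using assms(3) that pclass_eq unfolding pclass_def by blast
  moreover have "t \<in> pclass P t" "u \<in> pclass P u"
    using pcong.refl assms(1,2) unfolding pclass_def wt_iff by blast+
  ultimately show ?thesis by blast
qed

lemma presented_simps:
  "Obj (presented_category P) = UNIV"
  "f \<in> Hom (presented_category P) a b \<longleftrightarrow>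
     (\<exists>t. f = pclass P t \<and> well_typed P t \<and> a = term_src P t \<and> b = term_tgt P t)"
  "Idt (presented_category P) a = pclass P (TId a)"
  "Zer (presented_category P) a b = pclass P (TZero a b)"
  "UnitO (presented_category P) = []"
  "TensO (presented_category P) a b = a @ b"
  by (auto simp: presented_category_def wt_iff)

lemma presented_ops:
  shows "well_typed P (t \<circ>\<^sub>t u) \<Longrightarrow>
      Cmp (presented_category P) (pclass P t) (pclass P u) = pclass P (t \<circ>\<^sub>t u)"
    and "well_typed P t \<Longrightarrow> well_typed P u \<Longrightarrow>
      TensM (presented_category P) (pclass P t) (pclass P u) = pclass P (t \<otimes>\<^sub>t u)"
    and "well_typed P (TAdd t u) \<Longrightarrow>
      Add (presented_category P) (pclass P t) (pclass P u) = pclass P (TAdd t u)"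
    and "well_typed P t \<Longrightarrow> Scl (presented_category P) c (pclass P t) = pclass P (TScl c t)"
proof -
  show "Cmp (presented_category P) (pclass P t) (pclass P u) = pclass P (t \<circ>\<^sub>t u)"
    if "well_typed P (t \<circ>\<^sub>t u)"
    using that pclass_UN2[of P t u "(\<circ>\<^sub>t)", OF _ _ cong_comp[of P t _ u _ "term_src P u"
        "term_tgt P t"]]
    by (simp add: presented_category_def wt_iff)
  show "TensM (presented_category P) (pclass P t) (pclass P u) = pclass P (t \<otimes>\<^sub>t u)"
    if "well_typed P t" "well_typed P u"
    using that pclass_UN2[of P t u "(\<otimes>\<^sub>t)", OF _ _ cong_tens] by (simp add: presented_category_def)
  show "Add (presented_category P) (pclass P t) (pclass P u) = pclass P (TAdd t u)"
    if "well_typed P (TAdd t u)"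
    using that pclass_UN2[of P t u TAdd, OF _ _ cong_add[of P t _ u _ "term_src P t"
        "term_tgt P t"]]
    by (simp add: presented_category_def wt_iff)
  show "Scl (presented_category P) c (pclass P t) = pclass P (TScl c t)" if "well_typed P t"
    using that pclass_UN[of P t "TScl c", OF _ cong_scl] by (simp add: presented_category_def)
qed

text \<open>Each axiom can be checked on representatives, where it is an instance of one rule of the
  congruence. Disjointness of hom-sets holds because congruent expressions have the same type.\<close>

lemma strict_linear_monoidal_presented_category:
  "strict_linear_monoidal_category (presented_category P)"
proof (unfold_locales, goal_cases)
  case (1 x y x' y' f)
  then show ?case
    by (auto simp: presented_simps pclass_eq_iff dest!: pcong_type)
qed (clarsimp simp: presented_simps presented_ops intro!: pclass_eq;
  (rule exI, rule conjI, rule HOL.refl, simp; fail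
   | (rule pcong.intros; (simp add: wt_iff; fail))))+

text \<open>The value in \<open>C\<close> of a word and of an expression, given values \<open>v\<close> and \<open>w\<close> of the
  generators.\<close>

primrec ob :: "('p, 'n, 'k) lmcat \<Rightarrow> ('o \<Rightarrow> 'p) \<Rightarrow> 'o list \<Rightarrow> 'p" where
  "ob C v [] = UnitO C"
| "ob C v (x # a) = TensO C (v x) (ob C v a)"

primrec ev ::
  "('p, 'n, 'k) lmcat \<Rightarrow> ('o \<Rightarrow> 'p) \<Rightarrow> ('g \<Rightarrow> 'n) \<Rightarrow> ('o, 'g, 'k) mterm \<Rightarrow> 'n" where
  "ev C v w (TGen g) = w g"
| "ev C v w (TId a) = Idt C (ob C v a)"
| "ev C v w (TZero a b) = Zer C (ob C v a) (ob C v b)"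
| "ev C v w (t \<circ>\<^sub>t u) = Cmp C (ev C v w t) (ev C v w u)"
| "ev C v w (t \<otimes>\<^sub>t u) = TensM C (ev C v w t) (ev C v w u)"
| "ev C v w (TAdd t u) = Add C (ev C v w t) (ev C v w u)"
| "ev C v w (TScl c t) = Scl C c (ev C v w t)"

text \<open>Data for a functor out of the presented category: values of the generators that satisfy the
  relations of \<open>P\<close>.\<close>

locale model = strict_linear_monoidal_category C
  for C :: "('p, 'n, 'k::field) lmcat" +
  fixes P :: "('o, 'g, 'k) presentation" and v :: "'o \<Rightarrow> 'p" and w :: "'g \<Rightarrow> 'n"
  assumes gen_obj: "v x \<in> Obj C"
    and gen_hom: "w g \<in> Hom C (ob C v (gdom P g)) (ob C v (gcod P g))"
    and relations_hold: "(l, r) \<in> rels P \<Longrightarrow> ev C v w l = ev C v w r"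
begin

lemma ob_closed [simp]: "ob C v a \<in> Obj C"
  by (induction a) (simp_all add: unit_closed tensO_closed gen_obj)

lemma ob_append: "ob C v (a @ b) = TensO C (ob C v a) (ob C v b)"
  by (induction a) (simp_all add: tensO_unit_left tensO_assoc gen_obj)

lemma ev_hom: "wt P t a b \<Longrightarrow> ev C v w t \<in> Hom C (ob C v a) (ob C v b)"
proof (induction rule: wt.induct)
  case (wt_comp t b c u a)
  then show ?case by (simp add: cmp_closed[OF ob_closed[of a] ob_closed[of b] ob_closed[of c]])
qed (simp_all add: ob_append gen_hom idt_closed zer_closed tensM_closed add_closed scl_closed)

lemma ev_arr:
  assumes "wt P t a b"
  shows "arr (ev C v w t)" "src (ev C v w t) = ob C v a" "tgt (ev C v w t) = ob C v b"
  using arrI[OF ev_hom[OF assms] ob_closed ob_closed] by auto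

text \<open>Every rule of the congruence is a relation of \<open>P\<close>, a closure property of equality, or an
  axiom satisfied by \<open>C\<close>.\<close>

lemma soundness: "P \<turnstile> t \<approx> u \<Longrightarrow> ev C v w t = ev C v w u"
proof (induction rule: pcong.induct)
  case (relation l r a b)
  from relation(1) show ?case by (rule relations_hold)
next
  case (add_commute t a b u)
  from add_commute[THEN ev_hom] show ?case
    by (simp add: strict_linear_monoidal_category.add_commute
        [OF strict_linear_monoidal_category_axioms ob_closed ob_closed])
next
  case (tens_id a b)
  show ?case by (simp add: tensM_idt ob_append)
next
  case (tens_unit_left t a b)
  then show ?case by (simp add: tens_unit ev_arr)
next
  case (tens_unit_right t a b)
  then show ?case by (simp add: tens_unit ev_arr)
qed (simp; fail |
    (unfold ev.simps ob_append;
      (rule idt_left[OF ob_closed ob_closed ev_hom]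
      | rule idt_right[OF ob_closed ob_closed ev_hom]
      | rule add_zero[OF ob_closed ob_closed ev_hom]
      | rule scl_zero[OF ob_closed ob_closed ev_hom]
      | rule scl_one[OF ob_closed ob_closed ev_hom]
      | rule scl_scl[OF ob_closed ob_closed ev_hom]
      | rule scl_add_left[OF ob_closed ob_closed ev_hom]
      | rule scl_add_right[OF ob_closed ob_closed ev_hom ev_hom]
      | rule add_assoc[OF ob_closed ob_closed ev_hom ev_hom ev_hom]
      | rule cmp_assoc[OF ob_closed ob_closed ob_closed ob_closed ev_hom ev_hom ev_hom]
      | rule cmp_add_left[OF ob_closed ob_closed ob_closed ev_hom ev_hom ev_hom]
      | rule cmp_add_right[OF ob_closed ob_closed ob_closed ev_hom ev_hom ev_hom]
      | rule cmp_scl_left[OF ob_closed ob_closed ob_closed ev_hom ev_hom]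
      | rule cmp_scl_right[OF ob_closed ob_closed ob_closed ev_hom ev_hom]
      | rule interchange[OF ob_closed ob_closed ob_closed ob_closed ob_closed ob_closed
          ev_hom ev_hom ev_hom ev_hom]
      | rule tensM_assoc[OF ob_closed ob_closed ob_closed ob_closed ob_closed ob_closed
          ev_hom ev_hom ev_hom]
      | rule tensM_add_left[OF ob_closed ob_closed ob_closed ob_closed ev_hom ev_hom ev_hom]
      | rule tensM_add_right[OF ob_closed ob_closed ob_closed ob_closed ev_hom ev_hom ev_hom]
      | rule tensM_scl_left[OF ob_closed ob_closed ob_closed ob_closed ev_hom ev_hom]
      | rule tensM_scl_right[OF ob_closed ob_closed ob_closed ob_closed ev_hom ev_hom]);
      assumption))+

end

lemma ob_presented_category: "ob (presented_category P) (\<lambda>x. [x]) a = a"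
  by (induction a) (simp_all add: presented_simps)

text \<open>The presented category is itself a model, in which the value of an expression is its class.
  Equations proved in an arbitrary model are therefore congruences of expressions.\<close>

lemma ev_presented_category:
  "well_typed P t \<Longrightarrow> ev (presented_category P) (\<lambda>x. [x]) (\<lambda>g. pclass P (TGen g)) t = pclass P t"
  by (induction t) (simp_all add: presented_simps presented_ops ob_presented_category)

lemma model_presented_category:
  assumes "wf_presentation P"
  shows "model (presented_category P) P (\<lambda>x. [x]) (\<lambda>g. pclass P (TGen g))"
proof (intro model.intro model_axioms.intro strict_linear_monoidal_presented_category)
  fix l r assume rel: "(l, r) \<in> rels P"
  then have "P \<turnstile> l \<approx> r"
    using assms pcong.relation unfolding wf_presentation_def by fast
  then show "ev (presented_category P) (\<lambda>x. [x]) (\<lambda>g. pclass P (TGen g)) l =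
      ev (presented_category P) (\<lambda>x. [x]) (\<lambda>g. pclass P (TGen g)) r"
    using pcong_type[of P l r] by (simp add: ev_presented_category pclass_eq)
next
  fix g
  show "pclass P (TGen g) \<in> Hom (presented_category P)
      (ob (presented_category P) (\<lambda>x. [x]) (gdom P g))
          (ob (presented_category P) (\<lambda>x. [x]) (gcod P g))"
    by (auto simp: ob_presented_category presented_simps intro!: exI[of _ "TGen g"])
qed (simp add: presented_simps)

text \<open>By soundness, evaluation is constant on congruence classes and induces a functor \<open>F\<close>. The
  hypotheses \<open>full\<close> and \<open>faithful\<close> say that \<open>F\<close> is bijective on hom-sets.\<close>

lemma (in model) presentation_criterion:
  assumes wf: "wf_presentation P"
    and objects: "bij (ob C v)" "Obj C = UNIV"
    and full: "\<And>a b f. f \<in> Hom C (ob C v a) (ob C v b) \<Longrightarrow> \<exists>t. wt P t a b \<and> ev C v w t = f"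
    and faithful: "\<And>t u a b. wt P t a b \<Longrightarrow> wt P u a b \<Longrightarrow> ev C v w t = ev C v w u \<Longrightarrow> P \<turnstile> t \<approx> u"
  shows "is_presentation_of P C v w"
proof -
  \<comment> \<open>The choice of a representative is immaterial, since all of them have the same value.\<close>
  define F where "F S = ev C v w (SOME t. t \<in> S)" for S
  have F: "F (pclass P t) = ev C v w t" if "well_typed P t" for t
  proof -
    have "t \<in> pclass P t"
      using that pcong.refl[of P t] by (simp add: pclass_def wt_iff)
    then have "(SOME u. u \<in> pclass P t) \<in> pclass P t"
      by (rule someI)
    then show ?thesis
      using soundness[of t] unfolding F_def by (simp add: pclass_def)
  qed
  have F_bij: "bij_betw F (Hom (presented_category P) a b) (Hom C (ob C v a) (ob C v b))" for a b
  proof (rule bij_betwI')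
    fix S T assume "S \<in> Hom (presented_category P) a b" "T \<in> Hom (presented_category P) a b"
    then obtain t u where S: "S = pclass P t" "wt P t a b" and T: "T = pclass P u" "wt P u a b"
      by (auto simp: presented_simps wt_iff)
    then have "F S = F T \<longleftrightarrow> ev C v w t = ev C v w u"
      by (simp add: F wt_iff)
    also have "\<dots> \<longleftrightarrow> S = T"
      using faithful[of t a b u] S T F by (metis pclass_eq wt_iff)
    finally show "F S = F T \<longleftrightarrow> S = T" .
  next
    fix S assume "S \<in> Hom (presented_category P) a b"
    then show "F S \<in> Hom C (ob C v a) (ob C v b)"
      using ev_hom by (auto simp: presented_simps wt_iff F)
  next
    fix f assume "f \<in> Hom C (ob C v a) (ob C v b)"
    then obtain t where t: "wt P t a b" "ev C v w t = f"
      using full by blast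
    then show "\<exists>S\<in>Hom (presented_category P) a b. f = F S"
      by (intro bexI[of _ "pclass P t"]) (auto simp: F wt_iff presented_simps)
  qed
  have "strict_linear_monoidal_functor (presented_category P) C (ob C v) F"
    unfolding strict_linear_monoidal_functor_def
    using ev_hom by (auto simp: presented_simps presented_ops F ob_append wt_iff)
  then have "strict_linear_monoidal_isomorphism (presented_category P) C (ob C v) F"
    unfolding strict_linear_monoidal_isomorphism_def
    using objects F_bij by (simp add: presented_simps)
  moreover have "ob C v [x] = v x" for x
    by (simp add: tensO_unit_right gen_obj)
  ultimately show ?thesis
    unfolding is_presentation_of_def
    using wf strict_linear_monoidal_category_axioms F[of "TGen _"]
    by (intro conjI exI[of _ "ob C v"] exI[of _ F]) auto
qed

section \<open>Bilinear extension of products of basis elements\<close>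

text \<open>Composition and juxtaposition of linear combinations of diagrams both have the form
  \<open>\<Sum> c(a, b) g(a) f(b) \<cdot> p(a, b)\<close>, for a product \<open>p\<close> of basis elements with coefficients \<open>c\<close>. The
  laws of such a bilinear extension follow from identities between the products and the
  coefficients of basis elements.\<close>

definition pm_scale :: "'k::field \<Rightarrow> ('d \<Rightarrow>\<^sub>0 'k) \<Rightarrow> ('d \<Rightarrow>\<^sub>0 'k)" where
  "pm_scale c f = Poly_Mapping.map (\<lambda>x. c * x) f"

lemma lookup_pm_scale: "Poly_Mapping.lookup (pm_scale c f) d = c * Poly_Mapping.lookup f d"
  by (simp add: pm_scale_def Poly_Mapping.map.rep_eq when_def)

lemma pm_scale_single: "pm_scale c (Poly_Mapping.single d x) = Poly_Mapping.single d (c * x)"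
  by (rule poly_mapping_eqI) (simp add: lookup_pm_scale lookup_single when_def)

lemma keys_pm_scale: "Poly_Mapping.keys (pm_scale c f) \<subseteq> Poly_Mapping.keys f"
  by (auto simp: in_keys_iff lookup_pm_scale)

lemma pm_scale_add: "pm_scale c (f + g) = pm_scale c f + pm_scale c g"
  by (rule poly_mapping_eqI) (simp add: lookup_pm_scale lookup_add distrib_left)

lemma pm_scale_sum: "pm_scale c (sum F A) = (\<Sum>a\<in>A. pm_scale c (F a))"
  by (rule poly_mapping_eqI) (simp add: lookup_pm_scale lookup_sum sum_distrib_left)

lemma poly_mapping_linear_induct [consumes 1, case_names zero single add]:
  fixes f :: "'d \<Rightarrow>\<^sub>0 'k::field"
  assumes "Poly_Mapping.keys f \<subseteq> A"
    and "Q 0"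
    and "\<And>d c. d \<in> A \<Longrightarrow> Q (Poly_Mapping.single d c)"
    and "\<And>f g. Q f \<Longrightarrow> Q g \<Longrightarrow> Q (f + g)"
  shows "Q f"
proof -
  have "f = (\<Sum>d\<in>Poly_Mapping.keys f. Poly_Mapping.single d (Poly_Mapping.lookup f d))"
    by (rule poly_mapping_eqI)
      (simp add: lookup_sum lookup_single when_def in_keys_iff)
  also have "Q (\<Sum>d\<in>B. Poly_Mapping.single d (Poly_Mapping.lookup f d))" if "finite B" "B \<subseteq> A" for B
    using that by (induction B) (simp_all add: assms)
  then have "Q (\<Sum>d\<in>Poly_Mapping.keys f. Poly_Mapping.single d (Poly_Mapping.lookup f d))"
    using assms(1) by simp
  finally show ?thesis .
qed

definition bilinear_ext ::
  "('d \<Rightarrow> 'e \<Rightarrow> 'h) \<Rightarrow> ('d \<Rightarrow> 'e \<Rightarrow> 'k::field) \<Rightarrow> ('d \<Rightarrow>\<^sub>0 'k) \<Rightarrow> ('e \<Rightarrow>\<^sub>0 'k) \<Rightarrow> ('h \<Rightarrow>\<^sub>0 'k)" where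
  "bilinear_ext p c g f = (\<Sum>a\<in>Poly_Mapping.keys g. \<Sum>b\<in>Poly_Mapping.keys f.
     Poly_Mapping.single (p a b) (c a b * Poly_Mapping.lookup g a * Poly_Mapping.lookup f b))"

text \<open>Enlarging the index sets by elements with coefficient \<open>0\<close> lets two summands share an index
  set, from which additivity follows.\<close>

lemma bilinear_ext_superset:
  assumes "finite A" "Poly_Mapping.keys g \<subseteq> A" "finite B" "Poly_Mapping.keys f \<subseteq> B"
  shows "bilinear_ext p c g f = (\<Sum>a\<in>A. \<Sum>b\<in>B.
    Poly_Mapping.single (p a b) (c a b * Poly_Mapping.lookup g a * Poly_Mapping.lookup f b))"
proof -
  have "bilinear_ext p c g f = (\<Sum>a\<in>Poly_Mapping.keys g. \<Sum>b\<in>B.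
      Poly_Mapping.single (p a b) (c a b * Poly_Mapping.lookup g a * Poly_Mapping.lookup f b))"
    unfolding bilinear_ext_def
    by (intro sum.cong sum.mono_neutral_left) (use assms in \<open>auto simp: in_keys_iff\<close>)
  also have "\<dots> = (\<Sum>a\<in>A. \<Sum>b\<in>B.
      Poly_Mapping.single (p a b) (c a b * Poly_Mapping.lookup g a * Poly_Mapping.lookup f b))"
    by (intro sum.mono_neutral_left) (use assms in \<open>auto simp: in_keys_iff\<close>)
  finally show ?thesis .
qed

lemma bilinear_ext_zero [simp]: "bilinear_ext p c 0 f = 0" "bilinear_ext p c g 0 = 0"
  by (simp_all add: bilinear_ext_def)

lemma bilinear_ext_single [simp]:
  "bilinear_ext p c (Poly_Mapping.single a x) (Poly_Mapping.single b y)
     = Poly_Mapping.single (p a b) (c a b * x * y)"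
  using bilinear_ext_superset[of "{a}" "Poly_Mapping.single a x" "{b}"
      "Poly_Mapping.single b y" p c]
  by simp

lemma bilinear_ext_add:
  shows "bilinear_ext p c (g + g') f = bilinear_ext p c g f + bilinear_ext p c g' f"
    and "bilinear_ext p c g (f + f') = bilinear_ext p c g f + bilinear_ext p c g f'"
proof -
  show "bilinear_ext p c (g + g') f = bilinear_ext p c g f + bilinear_ext p c g' f"
    using bilinear_ext_superset[of "Poly_Mapping.keys g \<union> Poly_Mapping.keys g'" _
        "Poly_Mapping.keys f" f p c]
      keys_add[of g g']
    by (simp add: lookup_add distrib_left distrib_right single_add sum.distrib)
  show "bilinear_ext p c g (f + f') = bilinear_ext p c g f + bilinear_ext p c g f'"
    using bilinear_ext_superset[of "Poly_Mapping.keys g" g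
        "Poly_Mapping.keys f \<union> Poly_Mapping.keys f'" _ p c]
      keys_add[of f f']
    by (simp add: lookup_add distrib_left distrib_right single_add sum.distrib)
qed

lemma bilinear_ext_scale:
  shows "bilinear_ext p c (pm_scale x g) f = pm_scale x (bilinear_ext p c g f)"
    and "bilinear_ext p c g (pm_scale x f) = pm_scale x (bilinear_ext p c g f)"
proof -
  show "bilinear_ext p c (pm_scale x g) f = pm_scale x (bilinear_ext p c g f)"
    using bilinear_ext_superset[of "Poly_Mapping.keys g" "pm_scale x g" "Poly_Mapping.keys f" f p c]
      keys_pm_scale[of x g] bilinear_ext_def[of p c g f]
    by (simp add: pm_scale_sum pm_scale_single lookup_pm_scale mult_ac)
  show "bilinear_ext p c g (pm_scale x f) = pm_scale x (bilinear_ext p c g f)"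
    using bilinear_ext_superset[of "Poly_Mapping.keys g" g "Poly_Mapping.keys f" "pm_scale x f" p c]
      keys_pm_scale[of x f] bilinear_ext_def[of p c g f]
    by (simp add: pm_scale_sum pm_scale_single lookup_pm_scale mult_ac)
qed

lemma keys_bilinear_ext:
  assumes "Poly_Mapping.keys g \<subseteq> A" "Poly_Mapping.keys f \<subseteq> B"
    and "\<And>a b. a \<in> A \<Longrightarrow> b \<in> B \<Longrightarrow> p a b \<in> D"
  shows "Poly_Mapping.keys (bilinear_ext p c g f) \<subseteq> D"
  using assms(1)
proof (induction rule: poly_mapping_linear_induct)
  case (single a x)
  from assms(2) show ?case
  proof (induction rule: poly_mapping_linear_induct)
    case (single b y)
    then show ?case using \<open>a \<in> A\<close> assms(3) by simp
  next
    case (add f f')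
    then show ?case using keys_add by (fastforce simp: bilinear_ext_add)
  qed simp
next
  case (add f f')
  then show ?case using keys_add by (fastforce simp: bilinear_ext_add)
qed simp

lemma bilinear_ext_unit:
  fixes f :: "'d \<Rightarrow>\<^sub>0 'k::field"
  assumes "Poly_Mapping.keys f \<subseteq> A"
  shows "(\<And>a. a \<in> A \<Longrightarrow> p e a = a \<and> c e a = 1)
      \<Longrightarrow> bilinear_ext p c (Poly_Mapping.single e 1) f = f"
    and "(\<And>a. a \<in> A \<Longrightarrow> p' a e' = a \<and> c' a e' = 1)
      \<Longrightarrow> bilinear_ext p' c' f (Poly_Mapping.single e' 1) = f"
  using assms by (induction rule: poly_mapping_linear_induct) (simp_all add: bilinear_ext_add)

lemma bilinear_ext_assoc:
  assumes "Poly_Mapping.keys f \<subseteq> A" "Poly_Mapping.keys g \<subseteq> B" "Poly_Mapping.keys h \<subseteq> D"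
    and assoc: "\<And>a b d. a \<in> A \<Longrightarrow> b \<in> B \<Longrightarrow> d \<in> D \<Longrightarrow> p (q a b) d = p' a (q' b d)
      \<and> x a b * w (q a b) d = y b d * z a (q' b d)"
  shows "bilinear_ext p w (bilinear_ext q x f g) h = bilinear_ext p' z f (bilinear_ext q' y g h)"
  using assms(1)
proof (induction rule: poly_mapping_linear_induct)
  case (single a r)
  from assms(2) show ?case
  proof (induction rule: poly_mapping_linear_induct)
    case (single b s)
    from assms(3) show ?case
    proof (induction rule: poly_mapping_linear_induct)
      case (single d t)
      note abd = assoc[OF \<open>a \<in> A\<close> \<open>b \<in> B\<close> \<open>d \<in> D\<close>]
      have "w (q a b) d * (x a b * r * s) * t = (x a b * w (q a b) d) * (r * s * t)"
        by (simp only: mult_ac)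
      also have "\<dots> = z a (q' b d) * r * (y b d * s * t)"
        unfolding conjunct2[OF abd] by (simp only: mult_ac)
      finally show ?case
        by (simp only: bilinear_ext_single conjunct1[OF abd])
    qed (simp_all add: bilinear_ext_add)
  qed (simp_all add: bilinear_ext_add)
qed (simp_all add: bilinear_ext_add)

text \<open>The products \<open>q\<close>, \<open>r\<close> and \<open>q'\<close> play the part of tensor products, whose coefficients are \<open>1\<close>;
  \<open>p\<close>, \<open>p'\<close> and \<open>p''\<close> are compositions.\<close>

lemma bilinear_ext_interchange:
  assumes "Poly_Mapping.keys g \<subseteq> A" "Poly_Mapping.keys g' \<subseteq> A'"
      "Poly_Mapping.keys f \<subseteq> B" "Poly_Mapping.keys f' \<subseteq> B'"
    and interchange: "\<And>a a' b b'. a \<in> A \<Longrightarrow> a' \<in> A' \<Longrightarrow> b \<in> B \<Longrightarrow> b' \<in> B' \<Longrightarrow>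
      p (q a a') (r b b') = q' (p' a b) (p'' a' b')
      \<and> w (q a a') (r b b') = w' a b * w'' a' b'"
  shows "bilinear_ext p w (bilinear_ext q (\<lambda>_ _. 1) g g') (bilinear_ext r (\<lambda>_ _. 1) f f')
    = bilinear_ext q' (\<lambda>_ _. 1) (bilinear_ext p' w' g f) (bilinear_ext p'' w'' g' f')"
  using assms(1)
proof (induction rule: poly_mapping_linear_induct)
  case (single a x)
  from assms(2) show ?case
  proof (induction rule: poly_mapping_linear_induct)
    case (single a' x')
    from assms(3) show ?case
    proof (induction rule: poly_mapping_linear_induct)
      case (single b y)
      from assms(4) show ?case
      proof (induction rule: poly_mapping_linear_induct)
        case (single b' y')
        show ?case
          using interchange[OF \<open>a \<in> A\<close> \<open>a' \<in> A'\<close> \<open>b \<in> B\<close> \<open>b' \<in> B'\<close>] by (simp add: mult_ac)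
      qed (simp_all add: bilinear_ext_add)
    qed (simp_all add: bilinear_ext_add)
  qed (simp_all add: bilinear_ext_add)
qed (simp_all add: bilinear_ext_add)

section \<open>Labelled partial injections\<close>

lemma adiags_iff:
  "d \<in> adiags s t \<longleftrightarrow> (\<forall>i j n. d i = Some (j, n) \<longrightarrow> i \<in> {1..s} \<and> j \<in> {1..t}) \<and>
     (\<forall>i i' j n n'. d i = Some (j, n) \<longrightarrow> d i' = Some (j, n') \<longrightarrow> i = i')"
proof -
  have "inj_on (\<lambda>i. fst (the (d i))) (dom d) \<longleftrightarrow>
      (\<forall>i i' j n n'. d i = Some (j, n) \<longrightarrow> d i' = Some (j, n') \<longrightarrow> i = i')"
  proof
    assume inj: "inj_on (\<lambda>i. fst (the (d i))) (dom d)"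
    show "\<forall>i i' j n n'. d i = Some (j, n) \<longrightarrow> d i' = Some (j, n') \<longrightarrow> i = i'"
      by (intro allI impI, rule inj_onD[OF inj]) auto
  next
    assume *: "\<forall>i i' j n n'. d i = Some (j, n) \<longrightarrow> d i' = Some (j, n') \<longrightarrow> i = i'"
    show "inj_on (\<lambda>i. fst (the (d i))) (dom d)"
    proof (rule inj_onI)
      fix i i' assume "i \<in> dom d" "i' \<in> dom d" and eq: "fst (the (d i)) = fst (the (d i'))"
      then obtain j n j' n' where "d i = Some (j, n)" "d i' = Some (j', n')"
        by (metis domD surj_pair)
      then show "i = i'"
        using * eq by fastforce
    qed
  qed
  moreover have "dom d \<subseteq> {1..s} \<longleftrightarrow> (\<forall>i j n. d i = Some (j, n) \<longrightarrow> i \<in> {1..s})"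
    by (simp add: subset_iff dom_def del: atLeastAtMost_iff)
  moreover have "fst ` ran d \<subseteq> {1..t} \<longleftrightarrow> (\<forall>i j n. d i = Some (j, n) \<longrightarrow> j \<in> {1..t})"
    by (auto simp: image_subset_iff ran_def simp del: atLeastAtMost_iff)
  ultimately show ?thesis
    by (simp only: adiags_def mem_Collect_eq imp_conjR all_conj_distrib conj_assoc)
qed

lemma adiags_range:
  "d \<in> adiags s t \<Longrightarrow> d i = Some (j, n) \<Longrightarrow> 1 \<le> i \<and> i \<le> s \<and> 1 \<le> j \<and> j \<le> t"
  unfolding adiags_iff by force

lemma adiags_inj: "d \<in> adiags s t \<Longrightarrow> d i = Some (j, n) \<Longrightarrow> d i' = Some (j, n') \<Longrightarrow> i = i'"
  unfolding adiags_iff by blast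

lemma adiagsI:
  assumes "\<And>i j n. d i = Some (j, n) \<Longrightarrow> 1 \<le> i \<and> i \<le> s \<and> 1 \<le> j \<and> j \<le> t"
    and "\<And>i i' j n n'. d i = Some (j, n) \<Longrightarrow> d i' = Some (j, n') \<Longrightarrow> i = i'"
  shows "d \<in> adiags s t"
  unfolding adiags_iff atLeastAtMost_iff using assms by blast

lemma adiags_None: "d \<in> adiags s t \<Longrightarrow> i = 0 \<or> s < i \<Longrightarrow> d i = None"
  by (metis adiags_range linorder_not_less not_None_eq not_one_le_zero surj_pair)

lemma in_top_iff: "j \<in> fst ` ran d \<longleftrightarrow> (\<exists>i n. d i = Some (j, n))"
  by (force simp: ran_def)

lemma diag_comp_eq_Some:
  "diag_comp a b i = Some (l, k) \<longleftrightarrow>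
     (\<exists>j m n. b i = Some (j, m) \<and> a j = Some (l, n) \<and> k = m + n)"
  by (auto simp: diag_comp_def split: option.splits)

lemma diag_comp_eq_None:
  "diag_comp a b i = None \<longleftrightarrow> (\<forall>j m. b i = Some (j, m) \<longrightarrow> a j = None)"
  by (auto simp: diag_comp_def split: option.splits)

lemma diag_tens_eq_Some:
  "diag_tens s t a b i = Some (l, k) \<longleftrightarrow>
     (if i \<le> s then a i = Some (l, k) else t \<le> l \<and> b (i - s) = Some (l - t, k))"
  by (auto simp: diag_tens_def)

lemma diag_tens_eq_None:
  "diag_tens s t a b i = None \<longleftrightarrow> (if i \<le> s then a i = None else b (i - s) = None)"
  by (simp add: diag_tens_def)

lemma diag_eqI: "(\<And>i j n. a i = Some (j, n) \<longleftrightarrow> b i = Some (j, n)) \<Longrightarrow> (a::adiag) = b"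
  by (rule ext) (metis option.exhaust surj_pair)

lemma diag_id_adiags: "diag_id s \<in> adiags s s"
  by (auto simp: adiags_iff diag_id_def split: if_splits)

lemma diag_comp_adiags:
  assumes "a \<in> adiags t u" "b \<in> adiags s t"
  shows "diag_comp a b \<in> adiags s u"
proof (rule adiagsI)
  fix i l k assume "diag_comp a b i = Some (l, k)"
  then show "1 \<le> i \<and> i \<le> s \<and> 1 \<le> l \<and> l \<le> u"
    using adiags_range[OF assms(1)] adiags_range[OF assms(2)] unfolding diag_comp_eq_Some by blast
next
  fix i i' l k k' assume "diag_comp a b i = Some (l, k)" "diag_comp a b i' = Some (l, k')"
  then show "i = i'"
    unfolding diag_comp_eq_Some using adiags_inj[OF assms(1)] adiags_inj[OF assms(2)] by metis
qed

lemma diag_tens_adiags: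
  assumes a: "a \<in> adiags s t" and b: "b \<in> adiags s' t'"
  shows "diag_tens s t a b \<in> adiags (s + s') (t + t')"
proof (rule adiagsI)
  fix i j n assume "diag_tens s t a b i = Some (j, n)"
  then show "1 \<le> i \<and> i \<le> s + s' \<and> 1 \<le> j \<and> j \<le> t + t'"
    using adiags_range[OF a, of i j n] adiags_range[OF b, of "i - s" "j - t" n]
    by (auto simp: diag_tens_eq_Some split: if_splits)
next
  fix i i' j n n' assume *: "diag_tens s t a b i = Some (j, n)"
      "diag_tens s t a b i' = Some (j, n')"
  have "i \<le> s \<longleftrightarrow> i' \<le> s"
    using * adiags_range[OF a, of i j n] adiags_range[OF b, of "i - s" "j - t" n]
      adiags_range[OF a, of i' j n'] adiags_range[OF b, of "i' - s" "j - t" n']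
    by (auto simp: diag_tens_eq_Some split: if_splits)
  then show "i = i'"
    using * adiags_inj[OF a, of i j n i' n'] adiags_inj[OF b, of "i - s" "j - t" n "i' - s" n']
    by (cases "i \<le> s") (auto simp: diag_tens_eq_Some)
qed

lemma diag_comp_assoc: "diag_comp (diag_comp c b) a = diag_comp c (diag_comp b a)"
  by (rule diag_eqI) (fastforce simp: diag_comp_eq_Some add.assoc)

lemma diag_comp_id:
  assumes "d \<in> adiags s t"
  shows "diag_comp (diag_id t) d = d" "diag_comp d (diag_id s) = d"
  using adiags_range[OF assms]
  by (auto intro!: diag_eqI simp: diag_comp_eq_Some diag_id_def split: if_splits)

lemma diag_tens_assoc:
  "diag_tens (s + s') (t + t') (diag_tens s t a b) c = diag_tens s t a (diag_tens s' t' b c)"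
  by (rule ext) (auto simp: diag_tens_def option.map_comp comp_def case_prod_unfold add.assoc)

lemma diag_id_0: "diag_id 0 = Map.empty"
  by (rule ext) (simp add: diag_id_def)

lemma diag_tens_unit:
  assumes "d \<in> adiags s t"
  shows "diag_tens 0 0 (diag_id 0) d = d" "diag_tens s t d (diag_id 0) = d"
proof -
  have "diag_tens 0 0 (diag_id 0) d i = Some (j, n) \<longleftrightarrow> d i = Some (j, n)"
      "diag_tens s t d (diag_id 0) i = Some (j, n) \<longleftrightarrow> d i = Some (j, n)" for i j n
    using adiags_range[OF assms, of i j n]
    by (cases "d i = Some (j, n)"; auto simp: diag_tens_eq_Some diag_id_0)+
  then show "diag_tens 0 0 (diag_id 0) d = d" "diag_tens s t d (diag_id 0) = d"
    by (auto intro: diag_eqI)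
qed

lemma diag_tens_id: "diag_tens s s (diag_id s) (diag_id t) = diag_id (s + t)"
  by (rule ext) (auto simp: diag_tens_def diag_id_def)

lemma diag_interchange:
  assumes b: "b \<in> adiags s t" and b': "b' \<in> adiags s' t'"
  shows "diag_comp (diag_tens t u a a') (diag_tens s t b b')
      = diag_tens s u (diag_comp a b) (diag_comp a' b')"
proof (rule ext)
  fix i
  show "diag_comp (diag_tens t u a a') (diag_tens s t b b') i =
      diag_tens s u (diag_comp a b) (diag_comp a' b') i"
  proof (cases "i \<le> s")
    case True
    then show ?thesis
      using adiags_range[OF b, of i]
      by (auto simp: diag_comp_def diag_tens_def split: option.splits)
  next
    case False
    then show ?thesis
      using adiags_range[OF b', of "i - s"]
      by (cases "b' (i - s)") (auto simp: diag_comp_def diag_tens_def split: option.splits)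
  qed
qed

lemma closed_components_id [simp]:
  "closed_components t (diag_id t) d = 0" "closed_components t d (diag_id t) = 0"
proof -
  have "{j \<in> {1..t}. j \<notin> dom (diag_id t) \<and> j \<notin> fst ` ran d} = {}"
    by (auto simp: diag_id_def)
  moreover have "{j \<in> {1..t}. j \<notin> dom d \<and> j \<notin> fst ` ran (diag_id t)} = {}"
    unfolding in_top_iff by (auto simp: diag_id_def)
  ultimately show "closed_components t (diag_id t) d = 0" "closed_components t d (diag_id t) = 0"
    unfolding closed_components_def by simp_all
qed

text \<open>Both sides count the closed components of a triple composite. The vertices isolated between
  \<open>g\<close> and \<open>f\<close> and those isolated between \<open>h\<close> and \<open>g\<close> appear on both sides. The remaining
  components consist of one strand of \<open>g\<close> which no strand of \<open>f\<close> enters and no strand of \<open>h\<close>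
  leaves. On the left such a strand is counted at its lower end, an element of \<open>E\<close>, and on the
  right at its upper end; the injectivity of \<open>g\<close> matches the two counts.\<close>

lemma closed_components_assoc:
  assumes f: "f \<in> adiags w x" and g: "g \<in> adiags x y" and h: "h \<in> adiags y z"
  shows "closed_components y h g + closed_components x (diag_comp h g) f =
    closed_components x g f + closed_components y h (diag_comp g f)"
proof -
  define E where "E = {i \<in> {1..x}. (\<exists>j n. g i = Some (j, n) \<and> h j = None)
      \<and> (\<forall>k n. f k \<noteq> Some (i, n))}"
  define A where "A = {j \<in> {1..y}. h j = None \<and> (\<forall>i n. g i \<noteq> Some (j, n))}"
  define B where "B = {i \<in> {1..x}. g i = None \<and> (\<forall>k n. f k \<noteq> Some (i, n))}"
  have g_inj: "i = i'" if "g i = Some (j, n)" "g i' = Some (j, n')" for i i' j n n'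
    using adiags_inj[OF g] that by blast
  have g_range: "i \<in> {1..x} \<and> j \<in> {1..y}" if "g i = Some (j, n)" for i j n
    using adiags_range[OF g that] by simp
  have "{i \<in> {1..x}. i \<notin> dom (diag_comp h g) \<and> i \<notin> fst ` ran f} = B \<union> E"
  proof (rule set_eqI)
    fix i
    show "i \<in> {i \<in> {1..x}. i \<notin> dom (diag_comp h g) \<and> i \<notin> fst ` ran f} \<longleftrightarrow> i \<in> B \<union> E"
      unfolding in_top_iff B_def E_def by (cases "g i"; cases "h (fst (the (g i)))")
          (auto simp: domIff diag_comp_eq_None)
  qed
  moreover have "card (B \<union> E) = card B + card E"
    by (rule card_Un_disjoint) (auto simp: B_def E_def)
  moreover have "{j \<in> {1..y}. j \<notin> dom h \<and> j \<notin> fst ` ran (diag_comp g f)}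
      = A \<union> (\<lambda>i. fst (the (g i))) ` E"
  proof (intro subset_antisym subsetI)
    fix j assume "j \<in> {j \<in> {1..y}. j \<notin> dom h \<and> j \<notin> fst ` ran (diag_comp g f)}"
    then have j: "j \<in> {1..y}" "h j = None" "\<And>k n. diag_comp g f k \<noteq> Some (j, n)"
      unfolding in_top_iff by auto
    show "j \<in> A \<union> (\<lambda>i. fst (the (g i))) ` E"
    proof (cases "\<exists>i n. g i = Some (j, n)")
      case True
      then obtain i n where i: "g i = Some (j, n)"
        by blast
      then have "i \<in> E"
        using j g_range[OF i] unfolding E_def diag_comp_eq_Some by fastforce
      then show ?thesis
        using i by (force intro: rev_image_eqI)
    qed (use j in \<open>auto simp: A_def\<close>)
  next
    fix j assume "j \<in> A \<union> (\<lambda>i. fst (the (g i))) ` E"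
    then show "j \<in> {j \<in> {1..y}. j \<notin> dom h \<and> j \<notin> fst ` ran (diag_comp g f)}"
      unfolding in_top_iff using g_inj g_range
      by (fastforce simp: A_def E_def diag_comp_eq_Some domIff)
  qed
  moreover have "card (A \<union> (\<lambda>i. fst (the (g i))) ` E) = card A + card ((\<lambda>i. fst (the (g i))) ` E)"
    by (rule card_Un_disjoint) (fastforce simp: A_def E_def)+
  moreover have "card ((\<lambda>i. fst (the (g i))) ` E) = card E"
    by (rule card_image, rule inj_onI) (use g_inj in \<open>fastforce simp: E_def\<close>)
  moreover have "closed_components y h g = card A"
    unfolding closed_components_def in_top_iff A_def by (simp only: domIff not_not not_ex)
  moreover have "closed_components x g f = card B"
    unfolding closed_components_def in_top_iff B_def by (simp only: domIff not_not not_ex)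
  ultimately show ?thesis
    unfolding closed_components_def by simp
qed

lemma closed_components_tens:
  assumes a: "a \<in> adiags t u" and b: "b \<in> adiags s t" and b': "b' \<in> adiags s' t'"
  shows "closed_components (t + t') (diag_tens t u a a') (diag_tens s t b b') =
    closed_components t a b + closed_components t' a' b'"
proof -
  define A where "A = {j \<in> {1..t}. a j = None \<and> (\<forall>i n. b i \<noteq> Some (j, n))}"
  define A' where "A' = {j \<in> {1..t'}. a' j = None \<and> (\<forall>i n. b' i \<noteq> Some (j, n))}"
  have b_range: "i \<in> {1..s} \<and> j \<in> {1..t}" if "b i = Some (j, n)" for i j n
    using adiags_range[OF b that] by simp
  have b'_range: "i \<in> {1..s'} \<and> j \<in> {1..t'}" if "b' i = Some (j, n)" for i j n
    using adiags_range[OF b' that] by simp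
  have "(\<exists>i n. diag_tens s t b b' i = Some (j, n)) \<longleftrightarrow>
      (if j \<le> t then \<exists>i n. b i = Some (j, n) else \<exists>i n. b' i = Some
          (j - t, n))" (is "?l \<longleftrightarrow> ?r") for j
  proof
    assume ?l
    then obtain i n where i: "diag_tens s t b b' i = Some (j, n)"
      by blast
    then show ?r
      using b_range[of i j n] b'_range[of "i - s" "j - t" n]
      by (auto simp: diag_tens_eq_Some split: if_splits)
  next
    assume r: ?r
    show ?l
    proof (cases "j \<le> t")
      case True
      then obtain i n where "b i = Some (j, n)"
        using r by auto
      then have "diag_tens s t b b' i = Some (j, n)"
        using b_range[of i j n] by (simp add: diag_tens_eq_Some)
      then show ?thesis by blast
    next
      case False
      then obtain i n where "b' i = Some (j - t, n)"
        using r by auto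
      then have "diag_tens s t b b' (s + i) = Some (j, n)"
        using b'_range[of i "j - t" n] False by (simp add: diag_tens_eq_Some)
      then show ?thesis by blast
    qed
  qed
  then have "{j \<in> {1..t + t'}. j \<notin> dom (diag_tens t u a a') \<and> j \<notin> fst ` ran (diag_tens s t b b')} =
      {j \<in> {1..t + t'}. if j \<le> t then j \<in> A else j - t \<in> A'}"
    unfolding in_top_iff A_def A'_def by (auto simp: domIff diag_tens_eq_None)
  also have "\<dots> = A \<union> (+) t ` A'"
  proof (intro subset_antisym subsetI)
    fix j assume "j \<in> {j \<in> {1..t + t'}. if j \<le> t then j \<in> A else j - t \<in> A'}"
    then show "j \<in> A \<union> (+) t ` A'"
      by (cases "j \<le> t") (auto intro!: rev_image_eqI[of "j - t"])
  qed (auto simp: A_def A'_def)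
  finally have "closed_components (t + t') (diag_tens t u a a') (diag_tens s t b b')
      = card (A \<union> (+) t ` A')"
    unfolding closed_components_def by simp
  also have "\<dots> = card A + card ((+) t ` A')"
    by (rule card_Un_disjoint) (auto simp: A_def A'_def)
  also have "card ((+) t ` A') = card A'"
    by (rule card_image) simp
  finally show ?thesis
    unfolding closed_components_def in_top_iff A_def A'_def by (simp only: domIff not_not not_ex)
qed

section \<open>The affine rook category\<close>

lemma aro_comp_eq:
  "aro_comp \<beta> (t', u, g) (s, t, f) =
     (s, u, bilinear_ext diag_comp (\<lambda>a b. \<beta> ^ closed_components t a b) g f)"
  by (simp add: bilinear_ext_def)

lemma aro_tens_eq:
  "aro_tens (s, t, f) (s', t', g) = (s + s', t + t', bilinear_ext (diag_tens s t) (\<lambda>_ _. 1) f g)"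
  by (simp add: bilinear_ext_def)

declare aro_comp.simps [simp del] aro_tens.simps [simp del]

lemma aRo_simps:
  "Obj (aRo \<beta>) = UNIV"
  "m \<in> Hom (aRo \<beta>) s t \<longleftrightarrow> (\<exists>f. m = (s, t, f) \<and> Poly_Mapping.keys f \<subseteq> adiags s t)"
  "Idt (aRo \<beta>) s = (s, s, Poly_Mapping.single (diag_id s) 1)"
  "Cmp (aRo \<beta>) = aro_comp \<beta>"
  "Zer (aRo \<beta>) s t = (s, t, 0)"
  "Add (aRo \<beta>) (s, t, f) (s', t', g) = (s, t, f + g)"
  "Scl (aRo \<beta>) c (s, t, f) = (s, t, pm_scale c f)"
  "UnitO (aRo \<beta>) = 0"
  "TensO (aRo \<beta>) s t = s + t"
  "TensM (aRo \<beta>) = aro_tens"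
  by (auto simp: aRo_def diag_mor_def pm_scale_def)

lemma keys_diag_comp:
  "Poly_Mapping.keys g \<subseteq> adiags t u \<Longrightarrow> Poly_Mapping.keys f \<subseteq> adiags s t \<Longrightarrow>
    Poly_Mapping.keys (bilinear_ext diag_comp c g f) \<subseteq> adiags s u"
  by (erule keys_bilinear_ext, assumption) (rule diag_comp_adiags)

lemma keys_diag_tens:
  "Poly_Mapping.keys f \<subseteq> adiags s t \<Longrightarrow> Poly_Mapping.keys g \<subseteq> adiags s' t' \<Longrightarrow>
    Poly_Mapping.keys (bilinear_ext (diag_tens s t) c f g) \<subseteq> adiags (s + s') (t + t')"
  by (erule keys_bilinear_ext, assumption) (rule diag_tens_adiags)

text \<open>Associativity and the interchange law come from the corresponding laws for diagrams together
  with the counts of closed components, which add up in the exponents of \<open>\<beta>\<close>. The other axioms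
  follow from bilinearity or from the unit laws for diagrams.\<close>

lemma strict_linear_monoidal_aRo: "strict_linear_monoidal_category (aRo \<beta>)"
\<comment> \<open>The cases are numbered in the order of the axioms: 6 is associativity of composition, 29 the
  interchange law, 30 associativity of the tensor product, 3, 8, 9 and 27 are closure properties,
  4, 5, 31 and 32 unit laws, and 15 and 16 laws of scalars.\<close>
proof (unfold_locales, goal_cases)
  case (3 x y z f g)
  then show ?case
    by (auto simp: aRo_simps aro_comp_eq dest: keys_diag_comp)
next
  case (4 x y f)
  then show ?case
    by (auto simp: aRo_simps aro_comp_eq diag_comp_id
        intro!: bilinear_ext_unit(1)[of _ "adiags x y"])
next
  case (5 x y f)
  then show ?case
    by (auto simp: aRo_simps aro_comp_eq diag_comp_id
        intro!: bilinear_ext_unit(2)[of _ "adiags x y"])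
next
  case (6 w x y z f g h)
  then obtain f' g' h' where f: "f = (w, x, f')" "Poly_Mapping.keys f' \<subseteq> adiags w x"
    and g: "g = (x, y, g')" "Poly_Mapping.keys g' \<subseteq> adiags x y"
    and h: "h = (y, z, h')" "Poly_Mapping.keys h' \<subseteq> adiags y z"
    by (auto simp: aRo_simps)
  show ?case
    unfolding f g h aRo_simps aro_comp_eq
    by (intro arg_cong[of _ _ "\<lambda>m. (w, z, m)"] bilinear_ext_assoc[OF h(2) g(2) f(2)])
      (simp add: diag_comp_assoc closed_components_assoc flip: power_add)
next
  case (8 x y f g)
  then show ?case
    using keys_add by (fastforce simp: aRo_simps)
next
  case (9 x y f c)
  then show ?case
    using keys_pm_scale by (fastforce simp: aRo_simps)
next
  case (27 x y x' y' f g)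
  then show ?case
    by (auto simp: aRo_simps aro_tens_eq dest: keys_diag_tens)
next
  case (29 x y z x' y' z' f g f' g')
  then obtain f1 g1 f2 g2 where f: "f = (x, y, f1)" "Poly_Mapping.keys f1 \<subseteq> adiags x y"
    and g: "g = (y, z, g1)" "Poly_Mapping.keys g1 \<subseteq> adiags y z"
    and f': "f' = (x', y', f2)" "Poly_Mapping.keys f2 \<subseteq> adiags x' y'"
    and g': "g' = (y', z', g2)" "Poly_Mapping.keys g2 \<subseteq> adiags y' z'"
    by (auto simp: aRo_simps)
  show ?case
    unfolding f g f' g' aRo_simps aro_comp_eq aro_tens_eq
    by (intro arg_cong[of _ _ "\<lambda>m. (x + x', z + z', m)"]
        bilinear_ext_interchange[OF g(2) g'(2) f(2) f'(2)])
      (simp add: diag_interchange closed_components_tens power_add)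
next
  case (30 x y x' y' x'' y'' f g h)
  then obtain f' g' h' where f: "f = (x, y, f')" "Poly_Mapping.keys f' \<subseteq> adiags x y"
    and g: "g = (x', y', g')" "Poly_Mapping.keys g' \<subseteq> adiags x' y'"
    and h: "h = (x'', y'', h')" "Poly_Mapping.keys h' \<subseteq> adiags x'' y''"
    by (auto simp: aRo_simps)
  show ?case
    unfolding f g h aRo_simps aro_tens_eq
    by (simp add: bilinear_ext_assoc[OF f(2) g(2) h(2)] diag_tens_assoc add.assoc)
next
  case (31 x y f)
  then show ?case
    by (auto simp: aRo_simps aro_tens_eq diag_tens_unit
        intro!: bilinear_ext_unit(1)[of _ "adiags x y"])
next
  case (32 x y f)
  then show ?case
    by (auto simp: aRo_simps aro_tens_eq diag_tens_unit
        intro!: bilinear_ext_unit(2)[of _ "adiags x y"])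
next
  case (15 x y f c d)
  then show ?case
    by (auto simp: aRo_simps lookup_pm_scale mult.assoc intro!: poly_mapping_eqI)
next
  case (16 x y f c d)
  then show ?case
    by (auto simp: aRo_simps lookup_pm_scale lookup_add distrib_right intro!: poly_mapping_eqI)
qed (auto simp: aRo_simps aro_comp_eq aro_tens_eq diag_id_adiags diag_tens_id
    bilinear_ext_add bilinear_ext_scale pm_scale_add lookup_pm_scale add.assoc add.commute
    intro!: poly_mapping_eqI[of "pm_scale _ _"])

section \<open>Consequences of the relations\<close>

definition word :: "nat \<Rightarrow> unit list" where
  "word n = replicate n ()"

text \<open>The cycle that carries the last of \<open>k + 1\<close> strands to the first place, past the \<open>k\<close> others.
  It moves the strand to the second place by induction and then applies a crossing.\<close>

primrec cycle_term :: "nat \<Rightarrow> (unit, rook_gen, 'k) mterm" where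
  "cycle_term 0 = TId (word (Suc 0))"
| "cycle_term (Suc k) = (TGen GX \<otimes>\<^sub>t TId (word k)) \<circ>\<^sub>t (TId (word (Suc 0)) \<otimes>\<^sub>t cycle_term k)"

primrec iterate_term :: "rook_gen \<Rightarrow> nat \<Rightarrow> (unit, rook_gen, 'k) mterm" where
  "iterate_term g 0 = TId (word (Suc 0))"
| "iterate_term g (Suc n) = TGen g \<circ>\<^sub>t iterate_term g n"

definition phi_term :: "int \<Rightarrow> (unit, rook_gen, 'k) mterm" where
  "phi_term n = (if 0 \<le> n then iterate_term GPhiPlus (nat n)
      else iterate_term GPhiMinus (nat (- n)))"

primrec etas_term :: "nat \<Rightarrow> (unit, rook_gen, 'k) mterm" where
  "etas_term 0 = TId (word 0)"
| "etas_term (Suc n) = TGen GEta \<otimes>\<^sub>t etas_term n"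

lemma unit_list_eq_iff: "(a :: unit list) = b \<longleftrightarrow> length a = length b"
  by (auto intro: nth_equalityI)

lemma length_word [simp]: "length (word n) = n"
  by (simp add: word_def)

lemma word_length [simp]: "word (length a) = a"
  by (simp add: unit_list_eq_iff)

lemma rook_presentation_simps:
  "gdom (rook_presentation \<beta>) g = word (rook_gen_dom g)"
  "gcod (rook_presentation \<beta>) g = word (rook_gen_cod g)"
  "rels (rook_presentation \<beta>) = rook_rels \<beta>"
  by (simp_all add: rook_presentation_def word_def)

lemma wt_word_iff:
  "wt (rook_presentation \<beta>) t (word m) (word n) \<longleftrightarrow> well_typed (rook_presentation \<beta>) t
     \<and> length (term_src (rook_presentation \<beta>) t) = m \<and> length
         (term_tgt (rook_presentation \<beta>) t) = n"
  by (auto simp: wt_iff unit_list_eq_iff)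

text \<open>Words in one letter are determined by their lengths, so the typing of expressions becomes
  arithmetic. Proofs with these rules must exclude \<open>length_0_conv\<close>, which would turn lengths back
  into words.\<close>

lemmas wt_rook_simps = wt_word_iff unit_list_eq_iff rook_presentation_simps

lemma wt_cycle_term: "wt (rook_presentation \<beta>) (cycle_term k) (word (Suc k)) (word (Suc k))"
  by (induction k) (simp_all add: wt_rook_simps del: length_0_conv)

lemma wt_iterate_term:
  "g \<in> {GPhiPlus, GPhiMinus} \<Longrightarrow>
    wt (rook_presentation \<beta>) (iterate_term g m) (word (Suc 0)) (word (Suc 0))"
  by (induction m) (auto simp: wt_rook_simps simp del: length_0_conv)

lemma wt_phi_term: "wt (rook_presentation \<beta>) (phi_term n) (word (Suc 0)) (word (Suc 0))"
  by (simp add: phi_term_def wt_iterate_term)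

lemma wt_etas_term: "wt (rook_presentation \<beta>) (etas_term n) (word 0) (word n)"
  by (induction n) (simp_all add: wt_rook_simps del: length_0_conv)

text \<open>The powers \<open>pw n\<close> of the generating object stand for the words \<open>word n\<close>. All calculations up
  to the expansion into normal forms are made in an arbitrary model.\<close>

locale rook_model = model C "rook_presentation \<beta>" v w
  for C :: "('p, 'n, 'k::field) lmcat" and \<beta> v w
begin

definition pw :: "nat \<Rightarrow> 'p" where "pw n = ob C v (word n)"
abbreviation idn :: "nat \<Rightarrow> 'n" where "idn n \<equiv> Idt C (pw n)"
abbreviation eval :: "(unit, rook_gen, 'k) mterm \<Rightarrow> 'n" where "eval \<equiv> ev C v w"
abbreviation cyc :: "nat \<Rightarrow> 'n" where "cyc k \<equiv> eval (cycle_term k)"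
abbreviation phi :: "int \<Rightarrow> 'n" where "phi n \<equiv> eval (phi_term n)"
abbreviation etas :: "nat \<Rightarrow> 'n" where "etas n \<equiv> eval (etas_term n)"

lemma pw_closed [simp]: "pw n \<in> Obj C"
  by (simp add: pw_def)

lemma ob_word [simp]: "ob C v (word n) = pw n"
  by (simp add: pw_def)

lemma pw_add [simp]: "TensO C (pw m) (pw n) = pw (m + n)"
  by (simp add: pw_def word_def replicate_add ob_append)

lemma unit_pw: "UnitO C = pw 0"
  by (simp add: pw_def word_def)

text \<open>As a rewrite rule this leaves the comparison of powers, on which composability depends, to
  arithmetic in the exponents.\<close>

lemma pw_eq [simp]: "m = n \<Longrightarrow> (pw m = pw n) = True"
  by simp

lemma arr_gen [simp]:
  "arr (w g)" "src (w g) = pw (rook_gen_dom g)" "tgt (w g) = pw (rook_gen_cod g)"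
  using arrI[OF gen_hom[of g]] by (simp_all add: rook_presentation_def flip: word_def)

lemma idn_tens [simp]: "idn m \<odot> idn n = idn (m + n)"
  by (simp add: tensM_idt)

lemma idn_tens_tens [simp]: "arr f \<Longrightarrow> idn m \<odot> idn n \<odot> f = idn (m + n) \<odot> f"
  by (simp flip: tens_assoc)

lemma tens_idn_0 [simp]: "arr f \<Longrightarrow> idn 0 \<odot> f = f" "arr f \<Longrightarrow> f \<odot> idn 0 = f"
  using tens_unit unfolding unit_pw by auto

lemma comp_idn [simp]:
  "arr f \<Longrightarrow> tgt f = pw n \<Longrightarrow> idn n \<cdot> f = f"
  "arr f \<Longrightarrow> src f = pw n \<Longrightarrow> f \<cdot> idn n = f"
  by (simp_all add: comp_idt_left comp_idt_right)

lemma whisker_left: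
  "arr f \<Longrightarrow> arr g \<Longrightarrow> tgt f = src g \<Longrightarrow> idn a \<odot> (g \<cdot> f) = (idn a \<odot> g) \<cdot> (idn a \<odot> f)"
  by (simp add: tens_comp)

lemma whisker_right:
  "arr f \<Longrightarrow> arr g \<Longrightarrow> tgt f = src g \<Longrightarrow> (g \<cdot> f) \<odot> idn a = (g \<odot> idn a) \<cdot> (f \<odot> idn a)"
  by (simp add: tens_comp)

lemma slide:
  assumes "arr f" "arr g" "src f = pw m" "tgt f = pw m'" "src g = pw n" "tgt g = pw n'"
  shows "(f \<odot> idn n') \<cdot> (idn m \<odot> g) = f \<odot> g" "(idn m' \<odot> g) \<cdot> (f \<odot> idn n) = f \<odot> g"
  using assms by (simp_all add: tens_comp)

lemma relation_eval: "(l, r) \<in> rook_rels \<beta> \<Longrightarrow> eval l = eval r"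
  using relations_hold by (simp add: rook_presentation_def)

lemma rook_relations:
  "w GX \<cdot> w GX = idn (Suc (Suc 0))"
  "w GEps \<cdot> w GEta = Scl C \<beta> (idn 0)"
  "(w GX \<odot> idn (Suc 0)) \<cdot> (idn (Suc 0) \<odot> w GX) \<cdot> (w GX \<odot> idn (Suc 0)) = (idn (Suc 0) \<odot> w GX)
      \<cdot> (w GX \<odot> idn (Suc 0)) \<cdot> (idn (Suc 0) \<odot> w GX)"
  "(idn (Suc 0) \<odot> w GEps) \<cdot> w GX = w GEps \<odot> idn (Suc 0)"
  "w GX \<cdot> (idn (Suc 0) \<odot> w GEta) = w GEta \<odot> idn (Suc 0)"
  "w GPhiPlus \<cdot> w GPhiMinus = idn (Suc 0)"
  "w GPhiMinus \<cdot> w GPhiPlus = idn (Suc 0)"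
  "g \<in> {GPhiPlus, GPhiMinus} \<Longrightarrow> (w g \<odot> idn (Suc 0)) \<cdot> w GX = w GX \<cdot> (idn (Suc 0) \<odot> w g)"
  "g \<in> {GPhiPlus, GPhiMinus} \<Longrightarrow> (idn (Suc 0) \<odot> w g) \<cdot> w GX = w GX \<cdot> (w g \<odot> idn (Suc 0))"
  "g \<in> {GPhiPlus, GPhiMinus} \<Longrightarrow> w g \<cdot> w GEta = w GEta"
  "g \<in> {GPhiPlus, GPhiMinus} \<Longrightarrow> w GEps \<cdot> w g = w GEps"
proof -
  have *: "(l, r) \<in> rook_rels \<beta> \<Longrightarrow> eval l = x \<Longrightarrow> eval r = y \<Longrightarrow> x = y" for l r x y
    using relation_eval by simp
  note rr = rook_rels_def Let_def word_def[symmetric]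
  show "w GX \<cdot> w GX = idn (Suc (Suc 0))"
    by (rule *[of "TGen GX \<circ>\<^sub>t TGen GX" "TId (word (Suc (Suc 0)))"])
        (simp_all add: rr numeral_2_eq_2)
  show "w GEps \<cdot> w GEta = Scl C \<beta> (idn 0)"
    by (rule *[of "TGen GEps \<circ>\<^sub>t TGen GEta" "TScl \<beta> (TId (word 0))"]) (simp_all add: rr)
  have "((w GX \<odot> idn (Suc 0)) \<cdot> (idn (Suc 0) \<odot> w GX)) \<cdot> (w GX \<odot> idn (Suc 0))
      = ((idn (Suc 0) \<odot> w GX) \<cdot> (w GX \<odot> idn (Suc 0))) \<cdot> (idn (Suc 0) \<odot> w GX)"
    by (rule *[of "(TGen GX \<otimes>\<^sub>t TId (word (Suc 0))) \<circ>\<^sub>t (TId (word (Suc 0)) \<otimes>\<^sub>t TGen GX) \<circ>\<^sub>t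
        (TGen GX \<otimes>\<^sub>t TId (word (Suc 0)))"
      "(TId (word (Suc 0)) \<otimes>\<^sub>t TGen GX) \<circ>\<^sub>t (TGen GX \<otimes>\<^sub>t TId (word (Suc 0))) \<circ>\<^sub>t
          (TId (word (Suc 0)) \<otimes>\<^sub>t TGen GX)"])
      (simp_all add: rr)
  then show "(w GX \<odot> idn (Suc 0)) \<cdot> (idn (Suc 0) \<odot> w GX) \<cdot> (w GX \<odot> idn (Suc 0))
      = (idn (Suc 0) \<odot> w GX) \<cdot> (w GX \<odot> idn (Suc 0)) \<cdot> (idn (Suc 0) \<odot> w GX)"
    by (simp add: comp_assoc)
  show "(idn (Suc 0) \<odot> w GEps) \<cdot> w GX = w GEps \<odot> idn (Suc 0)"
    by (rule *[of "(TId (word (Suc 0)) \<otimes>\<^sub>t TGen GEps) \<circ>\<^sub>t TGen GX"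
        "TGen GEps \<otimes>\<^sub>t TId (word (Suc 0))"]) (simp_all add: rr)
  show "w GX \<cdot> (idn (Suc 0) \<odot> w GEta) = w GEta \<odot> idn (Suc 0)"
    by (rule *[of "TGen GX \<circ>\<^sub>t (TId (word (Suc 0)) \<otimes>\<^sub>t TGen GEta)"
        "TGen GEta \<otimes>\<^sub>t TId (word (Suc 0))"]) (simp_all add: rr)
  show "w GPhiPlus \<cdot> w GPhiMinus = idn (Suc 0)"
    by (rule *[of "TGen GPhiPlus \<circ>\<^sub>t TGen GPhiMinus" "TId (word (Suc 0))"]) (simp_all add: rr)
  show "w GPhiMinus \<cdot> w GPhiPlus = idn (Suc 0)"
    by (rule *[of "TId (word (Suc 0))" "TGen GPhiMinus \<circ>\<^sub>t TGen GPhiPlus", symmetric])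
        (simp_all add: rr)
  assume g: "g \<in> {GPhiPlus, GPhiMinus}"
  show "(w g \<odot> idn (Suc 0)) \<cdot> w GX = w GX \<cdot> (idn (Suc 0) \<odot> w g)"
    by (rule *[of "(TGen g \<otimes>\<^sub>t TId (word (Suc 0))) \<circ>\<^sub>t TGen GX"
        "TGen GX \<circ>\<^sub>t (TId (word (Suc 0)) \<otimes>\<^sub>t TGen g)"]) (use g in \<open>auto simp: rr\<close>)
  show "(idn (Suc 0) \<odot> w g) \<cdot> w GX = w GX \<cdot> (w g \<odot> idn (Suc 0))"
    by (rule *[of "(TId (word (Suc 0)) \<otimes>\<^sub>t TGen g) \<circ>\<^sub>t TGen GX"
        "TGen GX \<circ>\<^sub>t (TGen g \<otimes>\<^sub>t TId (word (Suc 0)))"]) (use g in \<open>auto simp: rr\<close>)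
  show "w g \<cdot> w GEta = w GEta"
    by (rule *[of "TGen g \<circ>\<^sub>t TGen GEta" "TGen GEta"]) (use g in \<open>auto simp: rr\<close>)
  show "w GEps \<cdot> w g = w GEps"
    by (rule *[of "TGen GEps \<circ>\<^sub>t TGen g" "TGen GEps"]) (use g in \<open>auto simp: rr\<close>)
qed

lemma eval_arr:
  assumes "wt (rook_presentation \<beta>) t (word m) (word n)"
  shows "arr (eval t)" "src (eval t) = pw m" "tgt (eval t) = pw n"
  using ev_arr[OF assms] by simp_all

lemmas arr_cyc [simp] = eval_arr[OF wt_cycle_term]
  and arr_iterate = eval_arr[OF wt_iterate_term]
  and arr_phi [simp] = eval_arr[OF wt_phi_term]
  and arr_etas [simp] = eval_arr[OF wt_etas_term]

text \<open>A strand can be carried past \<open>m + n\<close> strands in two steps.\<close>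

lemma cyc_add: "cyc (m + n) = (cyc m \<odot> idn n) \<cdot> (idn m \<odot> cyc n)"
proof (induction m)
  case 0
  then show ?case by simp
next
  case (Suc m)
  have "cyc (Suc m + n) = (w GX \<odot> idn (m + n))
      \<cdot> (idn (Suc 0) \<odot> ((cyc m \<odot> idn n) \<cdot> (idn m \<odot> cyc n)))"
    by (simp add: Suc)
  also have "\<dots> = ((w GX \<odot> idn m) \<odot> idn n) \<cdot> (idn (Suc 0) \<odot> cyc m \<odot> idn n) \<cdot> (idn (Suc m) \<odot> cyc n)"
    by (simp add: whisker_left tens_assoc)
  also have "\<dots> = (cyc (Suc m) \<odot> idn n) \<cdot> (idn (Suc m) \<odot> cyc n)"
    by (simp add: whisker_right tens_assoc comp_assoc)
  finally show ?case .
qed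

text \<open>Naturality of the cycle with respect to a morphism on the strands that are passed. It is
  stable under tensor products, and for a generator it is one of the relations or, for \<open>\<eta>\<close>, an
  immediate consequence.\<close>

definition passes :: "nat \<Rightarrow> nat \<Rightarrow> 'n \<Rightarrow> bool" where
  "passes m n h \<longleftrightarrow> arr h \<and> src h = pw m \<and> tgt h = pw n
     \<and> (idn (Suc 0) \<odot> h) \<cdot> cyc m = cyc n \<cdot> (h \<odot> idn (Suc 0))"

lemma passes_idn: "passes m m (idn m)"
  by (simp add: passes_def)

lemma passes_tens:
  assumes "passes m n f" "passes m' n' g"
  shows "passes (m + m') (n + n') (f \<odot> g)"
proof -
  have f [simp]: "arr f" "src f = pw m" "tgt f = pw n" and g [simp]: "arr g" "src g = pw m'"
      "tgt g = pw n'"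
    and cf: "(idn (Suc 0) \<odot> f) \<cdot> cyc m = cyc n \<cdot> (f \<odot> idn (Suc 0))"
    and cg: "(idn (Suc 0) \<odot> g) \<cdot> cyc m' = cyc n' \<cdot> (g \<odot> idn (Suc 0))"
    using assms by (auto simp: passes_def)
  have "(idn (Suc 0) \<odot> f \<odot> g) \<cdot> cyc (m + m') = ((idn (Suc 0) \<odot> f) \<odot> g) \<cdot> (cyc m \<odot> idn m')
      \<cdot> (idn m \<odot> cyc m')"
    by (simp add: cyc_add tens_assoc)
  also have "\<dots> = (((idn (Suc 0) \<odot> f) \<odot> g) \<cdot> (cyc m \<odot> idn m')) \<cdot> (idn m \<odot> cyc m')"
    by (simp add: comp_assoc)
  also have "((idn (Suc 0) \<odot> f) \<odot> g) \<cdot> (cyc m \<odot> idn m')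
      = ((idn (Suc 0) \<odot> f) \<cdot> cyc m) \<odot> (g \<cdot> idn m')"
    by (rule tens_comp) simp_all
  also have "\<dots> = (cyc n \<odot> idn n') \<cdot> (f \<odot> idn (Suc 0) \<odot> g)"
    unfolding cf by (simp add: tens_comp flip: tens_assoc)
  also have "((cyc n \<odot> idn n') \<cdot> (f \<odot> idn (Suc 0) \<odot> g)) \<cdot> (idn m \<odot> cyc m')
      = (cyc n \<odot> idn n') \<cdot> (f \<odot> ((idn (Suc 0) \<odot> g) \<cdot> cyc m'))"
    by (simp add: comp_assoc tens_comp)
  also have "\<dots> = (cyc n \<odot> idn n') \<cdot> (idn n \<odot> cyc n') \<cdot> (f \<odot> g \<odot> idn (Suc 0))"
    unfolding cg by (simp add: tens_comp)
  also have "\<dots> = cyc (n + n') \<cdot> ((f \<odot> g) \<odot> idn (Suc 0))"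
    by (simp add: cyc_add comp_assoc tens_assoc)
  finally show ?thesis
    by (simp add: passes_def)
qed

text \<open>The relations state only one of the two ways in which \<open>\<eta>\<close> and \<open>\<epsilon>\<close> interact with a crossing.
  The other one follows because the crossing is an involution.\<close>

lemma X_comp_eta_left: "w GX \<cdot> (w GEta \<odot> idn (Suc 0)) = idn (Suc 0) \<odot> w GEta"
proof -
  have "w GX \<cdot> (w GEta \<odot> idn (Suc 0)) = (w GX \<cdot> w GX) \<cdot> (idn (Suc 0) \<odot> w GEta)"
    by (simp add: comp_assoc flip: rook_relations(5))
  then show ?thesis
    by (simp add: rook_relations(1))
qed

lemma eps_left_comp_X: "(w GEps \<odot> idn (Suc 0)) \<cdot> w GX = idn (Suc 0) \<odot> w GEps"
proof -
  have "(w GEps \<odot> idn (Suc 0)) \<cdot> w GX = (idn (Suc 0) \<odot> w GEps) \<cdot> (w GX \<cdot> w GX)"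
    by (simp add: comp_assoc flip: rook_relations(4))
  then show ?thesis
    by (simp add: rook_relations(1))
qed

lemma passes_gen: "passes (rook_gen_dom g) (rook_gen_cod g) (w g)"
proof -
  have cyc2: "cyc 2 = (w GX \<odot> idn (Suc 0)) \<cdot> (idn (Suc 0) \<odot> w GX)"
    by (simp add: numeral_2_eq_2)
  show ?thesis
    unfolding passes_def
  proof (cases g)
    case GX
    then show "arr (w g) \<and> src (w g) = pw (rook_gen_dom g) \<and> tgt (w g) = pw (rook_gen_cod g) \<and>
      (idn (Suc 0) \<odot> w g) \<cdot> cyc (rook_gen_dom g) = cyc (rook_gen_cod g) \<cdot> (w g \<odot> idn (Suc 0))"
      using rook_relations(3) by (simp add: cyc2 comp_assoc)
  qed (use rook_relations(4,5,9) X_comp_eta_left in \<open>simp_all\<close>)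
qed

text \<open>Naturality of the cycle with respect to a morphism on the moving strand.\<close>

lemma phi_comp_cyc:
  assumes g: "g \<in> {GPhiPlus, GPhiMinus}"
  shows "(w g \<odot> idn k) \<cdot> cyc k = cyc k \<cdot> (idn k \<odot> w g)"
proof (induction k)
  case 0
  from g show ?case by auto
next
  case (Suc k)
  have g1 [simp]: "rook_gen_dom g = 1" "rook_gen_cod g = 1"
    using g by auto
  have "(w g \<odot> idn (Suc k)) \<cdot> cyc (Suc k) = (((w g \<odot> idn (Suc 0)) \<odot> idn k) \<cdot> (w GX \<odot> idn k))
      \<cdot> (idn (Suc 0) \<odot> cyc k)"
    by (simp add: comp_assoc tens_assoc)
  also have "((w g \<odot> idn (Suc 0)) \<odot> idn k) \<cdot> (w GX \<odot> idn k) = (w GX \<cdot> (idn (Suc 0) \<odot> w g)) \<odot> idn k"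
    unfolding rook_relations(8)[OF g, symmetric] by (simp add: whisker_right)
  also have "\<dots> = (w GX \<odot> idn k) \<cdot> (idn (Suc 0) \<odot> w g \<odot> idn k)"
    by (simp add: whisker_right tens_assoc)
  also have "((w GX \<odot> idn k) \<cdot> (idn (Suc 0) \<odot> w g \<odot> idn k)) \<cdot> (idn (Suc 0) \<odot> cyc k)
      = (w GX \<odot> idn k) \<cdot> (idn (Suc 0) \<odot> ((w g \<odot> idn k) \<cdot> cyc k))"
    by (simp add: comp_assoc whisker_left)
  also have "\<dots> = cyc (Suc k) \<cdot> (idn (Suc k) \<odot> w g)"
    unfolding Suc by (simp add: comp_assoc whisker_left)
  finally show ?case .
qed

lemma eps_comp_cyc: "(w GEps \<odot> idn k) \<cdot> cyc k = idn k \<odot> w GEps"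
proof (induction k)
  case 0
  then show ?case by simp
next
  case (Suc k)
  have "(w GEps \<odot> idn (Suc k)) \<cdot> cyc (Suc k) = (((w GEps \<odot> idn (Suc 0)) \<odot> idn k) \<cdot> (w GX \<odot> idn k))
      \<cdot> (idn (Suc 0) \<odot> cyc k)"
    by (simp add: comp_assoc tens_assoc)
  also have "((w GEps \<odot> idn (Suc 0)) \<odot> idn k) \<cdot> (w GX \<odot> idn k) = (idn (Suc 0) \<odot> w GEps) \<odot> idn k"
    unfolding eps_left_comp_X[symmetric] by (simp add: whisker_right)
  also have "((idn (Suc 0) \<odot> w GEps) \<odot> idn k) \<cdot> (idn (Suc 0) \<odot> cyc k)
      = idn (Suc 0) \<odot> ((w GEps \<odot> idn k) \<cdot> cyc k)"
    by (simp add: whisker_left tens_assoc)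
  also have "\<dots> = idn (Suc k) \<odot> w GEps"
    unfolding Suc by simp
  finally show ?case .
qed

end

section \<open>Normal forms\<close>

text \<open>A new last bottom vertex is joined, with label \<open>n\<close>, to a new top vertex in position \<open>p + 1\<close>.
  The top vertices from that position on move one place to the right.\<close>

definition insert_strand :: "nat \<Rightarrow> nat \<Rightarrow> int \<Rightarrow> adiag \<Rightarrow> adiag" where
  "insert_strand s p n d = (\<lambda>i. if i = Suc s then Some (Suc p, n)
     else map_option (\<lambda>(j, m). (if j \<le> p then j else Suc j, m)) (d i))"

definition delete_strand :: "nat \<Rightarrow> nat \<Rightarrow> adiag \<Rightarrow> adiag" where
  "delete_strand s p d = (\<lambda>i. if i = Suc s then None
     else map_option (\<lambda>(j, m). (if j \<le> p then j else j - 1, m)) (d i))"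

lemma insert_strand_eq_Some:
  "insert_strand s p n d i = Some (j, m) \<longleftrightarrow>
     (if i = Suc s then j = Suc p \<and> m = n
      else \<exists>l. d i = Some (l, m) \<and> j = (if l \<le> p then l else Suc l))"
  by (cases "d i") (auto simp: insert_strand_def)

lemma insert_strand_adiags:
  assumes d: "d \<in> adiags s (p + k)"
  shows "insert_strand s p n d \<in> adiags (Suc s) (Suc (p + k))"
proof (rule adiagsI)
  fix i j m assume ij: "insert_strand s p n d i = Some (j, m)"
  show "1 \<le> i \<and> i \<le> Suc s \<and> 1 \<le> j \<and> j \<le> Suc (p + k)"
  proof (cases "i = Suc s")
    case True
    then show ?thesis using ij by (simp add: insert_strand_eq_Some)
  next
    case False
    then obtain l where "d i = Some (l, m)" "j = (if l \<le> p then l else Suc l)"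
      using ij by (auto simp: insert_strand_eq_Some)
    then show ?thesis using adiags_range[OF d, of i l m] by simp
  qed
next
  fix i i' j m m'
  assume ij: "insert_strand s p n d i = Some (j, m)" and ij':
      "insert_strand s p n d i' = Some (j, m')"
  consider "i = Suc s" "i' = Suc s" | l l' where "d i = Some (l, m)"
      "j = (if l \<le> p then l else Suc l)"
      "d i' = Some (l', m')" "j = (if l' \<le> p then l' else Suc l')"
    using ij ij' unfolding insert_strand_eq_Some
    by (cases "i = Suc s"; cases "i' = Suc s") (auto split: if_splits)
  then show "i = i'"
  proof cases
    case (2 l l')
    then have "l = l'"
      by (auto split: if_splits)
    then show ?thesis
      using adiags_inj[OF d 2(1)] 2(3) by simp
  qed simp
qed

lemma delete_insert_strand:
  assumes "d \<in> adiags s t"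
  shows "delete_strand s p (insert_strand s p n d) = d"
proof (rule ext)
  fix i
  show "delete_strand s p (insert_strand s p n d) i = d i"
    using adiags_None[OF assms, of "Suc s"]
    by (cases "d i") (auto simp: delete_strand_def insert_strand_def)
qed

lemma adiags_Suc_None:
  "d \<in> adiags s t \<Longrightarrow> d \<in> adiags (Suc s) t"
  unfolding adiags_def by auto

lemma adiags_Suc_cases:
  assumes d: "d \<in> adiags (Suc s) t"
  obtains (isolated) "d \<in> adiags s t"
    | (matched) p k n e where "t = Suc (p + k)" "e \<in> adiags s (p + k)" "d = insert_strand s p n e"
proof (cases "d (Suc s)")
  case None
  have "d \<in> adiags s t"
  proof (rule adiagsI)
    fix i j n assume i: "d i = Some (j, n)"
    then have "i \<noteq> Suc s"
      using None by auto
    then show "1 \<le> i \<and> i \<le> s \<and> 1 \<le> j \<and> j \<le> t"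
      using adiags_range[OF d i] by simp
  qed (rule adiags_inj[OF d])
  then show ?thesis by (rule isolated)
next
  case (Some jn)
  then obtain j n where jn: "d (Suc s) = Some (j, n)"
    by (cases jn) auto
  have range: "1 \<le> j" "j \<le> t"
    using adiags_range[OF d jn] by auto
  define p where "p = j - 1"
  define k where "k = t - j"
  have t: "t = Suc (p + k)" and j: "j = Suc p"
    using range by (simp_all add: p_def k_def)
  define e where "e = delete_strand s p d"
  have e: "e i = Some (l, m) \<longleftrightarrow> i \<noteq> Suc s \<and> l \<noteq> 0 \<and> d i = Some (if l \<le> p then l else Suc l, m)"
      for i l m
  proof (cases "d i")
    case None
    then show ?thesis by (simp add: e_def delete_strand_def)
  next
    case (Some lm)
    then obtain l' m' where lm: "d i = Some (l', m')"
      by (cases lm) auto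
    have "i \<noteq> Suc s \<Longrightarrow> l' \<noteq> Suc p" "l' \<noteq> 0"
      using adiags_inj[OF d, of i "Suc p" m' "Suc s" n] adiags_range[OF d lm] lm jn j by auto
    then show ?thesis
      using lm by (auto simp: e_def delete_strand_def)
  qed
  have "e \<in> adiags s (p + k)"
  proof (rule adiagsI)
    fix i l m assume "e i = Some (l, m)"
    then have "i \<noteq> Suc s" "l \<noteq> 0" and i: "d i = Some (if l \<le> p then l else Suc l, m)"
      by (simp_all add: e)
    then show "1 \<le> i \<and> i \<le> s \<and> 1 \<le> l \<and> l \<le> p + k"
      using adiags_range[OF d i] t by (auto split: if_splits)
  next
    fix i i' l m m' assume "e i = Some (l, m)" "e i' = Some (l, m')"
    then show "i = i'"
      using adiags_inj[OF d, of i "if l \<le> p then l else Suc l" m i' m'] by (simp add: e)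
  qed
  moreover have "d = insert_strand s p n e"
  proof (rule diag_eqI)
    fix i l m
    show "d i = Some (l, m) \<longleftrightarrow> insert_strand s p n e i = Some (l, m)"
    proof (cases "i = Suc s")
      case True
      then show ?thesis
        using jn j by (auto simp: insert_strand_eq_Some)
    next
      case False
      show ?thesis
      proof
        assume il: "d i = Some (l, m)"
        then have "l \<noteq> Suc p" "l \<noteq> 0"
          using adiags_inj[OF d il, of "Suc s" n] adiags_range[OF d il] jn j False by auto
        then have *: "\<not> l \<le> p \<Longrightarrow> \<not> l - Suc 0 \<le> p"
          by linarith
        then have "e i = Some (if l \<le> p then l else l - 1, m)"
          using il False \<open>l \<noteq> 0\<close> by (simp add: e)
        then show "insert_strand s p n e i = Some (l, m)"
          using False * by (simp add: insert_strand_eq_Some)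
      next
        assume "insert_strand s p n e i = Some (l, m)"
        then show "d i = Some (l, m)"
          using False by (auto simp: insert_strand_eq_Some e)
      qed
    qed
  qed
  ultimately show ?thesis
    using t by (intro matched)
qed

text \<open>Every diagram arises by adding bottom vertices one at a time on the right, isolated or
  matched. An isolated new vertex changes only the number of bottom vertices, not the partial
  map.\<close>

lemma adiags_induct [consumes 1, case_names empty isolated matched]:
  assumes "d \<in> adiags s t"
    and "\<And>t. Q 0 t Map.empty"
    and "\<And>s t d. d \<in> adiags s t \<Longrightarrow> Q s t d \<Longrightarrow> Q (Suc s) t d"
    and "\<And>s p k n d. d \<in> adiags s (p + k) \<Longrightarrow> Q s (p + k) d \<Longrightarrow>
      Q (Suc s) (Suc (p + k)) (insert_strand s p n d)"
  shows "Q s t d"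
  using assms(1)
proof (induction s arbitrary: t d)
  case 0
  then have "d = Map.empty"
    by (auto simp: adiags_def)
  then show ?case using assms(2) by simp
next
  case (Suc s)
  from Suc.prems show ?case
    by (cases rule: adiags_Suc_cases) (use Suc.IH assms(3,4) in auto)
qed

text \<open>The last bottom vertex is split off. If it is matched with the top vertex \<open>j\<close>, its strand is
  first drawn on the far right, with its label, and then carried to position \<open>j\<close> past the \<open>t - j\<close>
  strands above which it must come to lie.\<close>

primrec normal_form :: "nat \<Rightarrow> nat \<Rightarrow> adiag \<Rightarrow> (unit, rook_gen, 'k) mterm" where
  "normal_form 0 t d = etas_term t"
| "normal_form (Suc s) t d = (case d (Suc s) of
     None \<Rightarrow> normal_form s t d \<otimes>\<^sub>t TGen GEps
   | Some (j, n) \<Rightarrow> (TId (word (j - 1)) \<otimes>\<^sub>t cycle_term (t - j)) \<circ>\<^sub>t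
       (normal_form s (t - 1) (delete_strand s (j - 1) d) \<otimes>\<^sub>t phi_term n))"

lemma normal_form_isolated:
  "d \<in> adiags s t \<Longrightarrow> normal_form (Suc s) t d = normal_form s t d \<otimes>\<^sub>t TGen GEps"
  using adiags_None[of d s t "Suc s"] by simp

lemma normal_form_matched:
  assumes "d \<in> adiags s (p + k)"
  shows "normal_form (Suc s) (Suc (p + k)) (insert_strand s p n d) =
    (TId (word p) \<otimes>\<^sub>t cycle_term k) \<circ>\<^sub>t (normal_form s (p + k) d \<otimes>\<^sub>t phi_term n)"
proof -
  have "insert_strand s p n d (Suc s) = Some (Suc p, n)"
    by (simp add: insert_strand_def)
  then show ?thesis
    by (simp add: delete_insert_strand[OF assms])
qed

text \<open>The defining equations take a diagram apart by its value at \<open>Suc s\<close>. The rules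
  \<open>normal_form_isolated\<close> and \<open>normal_form_matched\<close> follow the way in which it was built up.\<close>

declare normal_form.simps [simp del]

lemma wt_normal_form:
  assumes "d \<in> adiags s t"
  shows "wt (rook_presentation \<beta>) (normal_form s t d) (word s) (word t)"
  using assms
proof (induction rule: adiags_induct)
  case (empty t)
  show ?case by (simp add: normal_form.simps wt_etas_term)
next
  case (isolated s t d)
  then show ?case
    by (simp add: normal_form_isolated wt_rook_simps del: length_0_conv)
next
  case (matched s p k n d)
  then show ?case
    using wt_cycle_term[of \<beta> k] wt_phi_term[of \<beta> n]
    by (simp add: normal_form_matched wt_rook_simps del: length_0_conv)
qed

text \<open>Hom-sets only have a binary addition, so linear combinations are folded over a list of
  diagrams.\<close>

primrec lincomb_term ::
  "nat \<Rightarrow> nat \<Rightarrow> adiag list \<Rightarrow> (adiag \<Rightarrow> 'k::field) \<Rightarrow> (unit, rook_gen, 'k) mterm" where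
  "lincomb_term s t [] c = TZero (word s) (word t)"
| "lincomb_term s t (d # ds) c = TAdd (TScl (c d) (normal_form s t d)) (lincomb_term s t ds c)"

lemma wt_lincomb_term:
  "set ds \<subseteq> adiags s t \<Longrightarrow> wt (rook_presentation \<beta>) (lincomb_term s t ds c) (word s) (word t)"
  by (induction ds) (auto intro: wt_zero wt_add wt_scl wt_normal_form)

section \<open>Products of generators with normal forms\<close>

context rook_model
begin

lemma phi_0: "phi 0 = idn (Suc 0)"
  by (simp add: phi_term_def)

text \<open>The label on a strand is an arbitrary power of \<open>\<phi>\<close>; multiplying by \<open>\<phi>\<^sup>\<plusminus>\<close> lengthens the power
  or cancels a factor.\<close>

lemma phi_comp_phi:
  assumes "g \<in> {GPhiPlus, GPhiMinus}"
  shows "\<exists>m. w g \<cdot> phi n = phi m"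
proof -
  have inverse: "w g \<cdot> w h \<cdot> eval (iterate_term h m) = eval (iterate_term h m)"
    if "g \<in> {GPhiPlus, GPhiMinus}" "h \<in> {GPhiPlus, GPhiMinus}" "g \<noteq> h" for g h m
  proof -
    note a = arr_iterate[OF that(2), of m]
    have "w g \<cdot> w h \<cdot> eval (iterate_term h m) = (w g \<cdot> w h) \<cdot> eval (iterate_term h m)"
      using that a by (subst comp_assoc) auto
    also have "w g \<cdot> w h = idn (Suc 0)"
      using that rook_relations(6,7) by auto
    finally show ?thesis using a by simp
  qed
  have pos: "phi (int m) = eval (iterate_term GPhiPlus m)" for m
    by (simp add: phi_term_def)
  have neg: "phi (- int m) = eval (iterate_term GPhiMinus m)" for m
    by (cases m) (simp_all add: phi_term_def del: of_nat_Suc)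
  have up: "\<exists>l. w g \<cdot> phi (int m) = phi l" for m
  proof (cases "g = GPhiPlus")
    case True
    then have "w g \<cdot> phi (int m) = phi (int (Suc m))"
      unfolding pos by simp
    then show ?thesis ..
  next
    case False
    show ?thesis
    proof (cases m)
      case 0
      then have "w g \<cdot> phi (int m) = phi (- int (Suc 0))"
        using assms False unfolding pos neg by simp
      then show ?thesis ..
    next
      case (Suc m')
      then have "w g \<cdot> phi (int m) = phi (int m')"
        using assms False inverse[of GPhiMinus GPhiPlus m'] unfolding pos by simp
      then show ?thesis ..
    qed
  qed
  have down: "\<exists>l. w g \<cdot> phi (- int (Suc m)) = phi l" for m
  proof (cases "g = GPhiMinus")
    case True
    then have "w g \<cdot> phi (- int (Suc m)) = phi (- int (Suc (Suc m)))"
      unfolding neg by simp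
    then show ?thesis ..
  next
    case False
    then have "w g \<cdot> phi (- int (Suc m)) = phi (- int m)"
      using assms inverse[of GPhiPlus GPhiMinus m] unfolding neg by simp
    then show ?thesis ..
  qed
  show ?thesis
    using up down by (cases n rule: int_cases) auto
qed

lemma eps_comp_phi: "w GEps \<cdot> phi n = w GEps"
proof -
  have "w GEps \<cdot> eval (iterate_term g m) = w GEps" if g: "g \<in> {GPhiPlus, GPhiMinus}" for g m
  proof (induction m)
    case (Suc m)
    have "w GEps \<cdot> eval (iterate_term g (Suc m)) = (w GEps \<cdot> w g) \<cdot> eval (iterate_term g m)"
      using g arr_iterate[OF g, of m] by (subst comp_assoc) auto
    then show ?case
      using Suc rook_relations(11)[OF g] by simp
  qed simp
  then show ?thesis by (simp add: phi_term_def)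
qed

lemma etas_add: "etas (m + n) = etas m \<odot> etas n"
  by (induction m) (simp_all add: tens_assoc)

text \<open>The action of a generator on a diagram without bottom vertices. A scalar other than \<open>1\<close>
  arises only from \<open>\<epsilon> \<circ> \<eta> = \<beta>\<close>.\<close>

lemma gen_comp_etas: "\<exists>c. w g \<cdot> etas (rook_gen_dom g) = Scl C c (etas (rook_gen_cod g))"
proof (cases "g = GEps")
  case True
  then show ?thesis
    using rook_relations(2) by auto
next
  case False
  have etas2: "etas 2 = (idn (Suc 0) \<odot> w GEta) \<cdot> w GEta"
    "etas 2 = (w GEta \<odot> idn (Suc 0)) \<cdot> w GEta"
    using slide[of "w GEta" "w GEta" 0 1 0 1] by (simp_all add: numeral_2_eq_2)
  have "w GX \<cdot> etas 2 = (w GX \<cdot> (idn (Suc 0) \<odot> w GEta)) \<cdot> w GEta"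
    unfolding etas2(1) by (simp add: comp_assoc)
  then have "w GX \<cdot> etas 2 = etas 2"
    unfolding etas2(2) rook_relations(5) .
  with False have "w g \<cdot> etas (rook_gen_dom g) = etas (rook_gen_cod g)"
    using rook_relations(10)[of g] by (cases g) simp_all
  then show ?thesis
    by (intro exI[of _ 1]) (simp add: scl_one')
qed

lemmas arr_normal_form [simp] = eval_arr[OF wt_normal_form]

text \<open>Neither the scalar nor the diagram is recorded: once normal forms are known to span, the
  coefficients can be recovered by evaluation in the affine rook category.\<close>

definition monomial :: "nat \<Rightarrow> nat \<Rightarrow> 'n \<Rightarrow> bool" where
  "monomial s t f \<longleftrightarrow> (\<exists>c. \<exists>d\<in>adiags s t. f = Scl C c (eval (normal_form s t d)))"

lemma monomial_normal_form: "d \<in> adiags s t \<Longrightarrow> monomial s t (eval (normal_form s t d))"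
  unfolding monomial_def by (metis arr_normal_form(1) scl_one')

lemma monomialE:
  assumes "monomial s t f"
  obtains c d where "d \<in> adiags s t" "f = Scl C c (eval (normal_form s t d))"
  using assms unfolding monomial_def by blast

lemma monomialI: "d \<in> adiags s t \<Longrightarrow> monomial s t (Scl C c (eval (normal_form s t d)))"
  unfolding monomial_def by blast

lemma monomial_isolated: "monomial s t f \<Longrightarrow> monomial (Suc s) t (f \<odot> w GEps)"
proof (erule monomialE)
  fix c d assume d: "d \<in> adiags s t" and f: "f = Scl C c (eval (normal_form s t d))"
  have "f \<odot> w GEps = Scl C c (eval (normal_form (Suc s) t d))"
    using d by (simp add: f tens_scl normal_form_isolated)
  then show ?thesis
    using monomialI[OF adiags_Suc_None[OF d]] by simp
qed

lemma monomial_matched: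
  "monomial s (p + k) f \<Longrightarrow> monomial (Suc s) (Suc (p + k)) ((idn p \<odot> cyc k) \<cdot> (f \<odot> phi n))"
proof (erule monomialE)
  fix c d assume d: "d \<in> adiags s (p + k)" and f: "f = Scl C c (eval (normal_form s (p + k) d))"
  have "(idn p \<odot> cyc k) \<cdot> (f \<odot> phi n)
      = Scl C c (eval (normal_form (Suc s) (Suc (p + k)) (insert_strand s p n d)))"
    using d by (simp add: f tens_scl comp_scl normal_form_matched)
  then show ?thesis
    using monomialI[OF insert_strand_adiags[OF d]] by simp
qed

text \<open>The core of the argument. The induction splits off the last strand of the diagram, which
  \<open>cyc k\<close> carries to the top vertex \<open>p + 1\<close>, and compares this position with the places
  \<open>a + 1, \<dots>, a + rook_gen_dom g\<close> of the inputs of the generator.\<close>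

lemma whiskered_gen_comp_normal_form:
  assumes "d \<in> adiags s t" "t = a + rook_gen_dom g + b"
  shows "monomial s (a + rook_gen_cod g + b)
    ((idn a \<odot> w g \<odot> idn b) \<cdot> eval (normal_form s t d))"
  using assms
proof (induction arbitrary: a b rule: adiags_induct)
  case (empty t)
  obtain c where c: "w g \<cdot> etas (rook_gen_dom g) = Scl C c (etas (rook_gen_cod g))"
    using gen_comp_etas by blast
  have "(idn a \<odot> w g \<odot> idn b) \<cdot> etas t = etas a \<odot> (w g \<cdot> etas (rook_gen_dom g)) \<odot> etas b"
    by (simp add: empty normal_form.simps etas_add tens_comp tens_assoc)
  also have "\<dots> = Scl C c (etas (a + rook_gen_cod g + b))"
    unfolding c by (simp add: tens_scl etas_add tens_assoc)
  finally show ?case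
    unfolding monomial_def by (auto intro!: exI[of _ c] bexI[of _ Map.empty]
        simp: adiags_def normal_form.simps)
next
  case (isolated s t d)
  let ?N = "eval (normal_form s t d)"
  have "(idn a \<odot> w g \<odot> idn b) \<cdot> (?N \<odot> w GEps) = ((idn a \<odot> w g \<odot> idn b) \<cdot> ?N) \<odot> w GEps"
    using isolated.hyps isolated.prems
      tens_comp[of ?N "idn a \<odot> w g \<odot> idn b" "w GEps" "idn 0"] by (simp add: add.assoc)
  then show ?case
    using monomial_isolated isolated by (simp add: normal_form_isolated)
next
  case (matched s p k n d)
  let ?N = "eval (normal_form s (p + k) d)"
  note N [simp] = arr_normal_form[OF matched.hyps]
  have nf: "eval (normal_form (Suc s) (Suc (p + k)) (insert_strand s p n d))
      = (idn p \<odot> cyc k) \<cdot> (?N \<odot> phi n)"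
    by (simp add: normal_form_matched[OF matched.hyps])
  have pk: "Suc (p + k) = a + rook_gen_dom g + b"
    by (rule matched.prems)
  let ?A = "idn a \<odot> w g \<odot> idn b"
  have A [simp]: "arr ?A" "src ?A = pw (Suc (p + k))" "tgt ?A = pw (a + rook_gen_cod g + b)"
    using pk by (simp_all add: add.assoc)
  have push: "?A \<cdot> (idn p \<odot> cyc k) \<cdot> (?N \<odot> phi n) = (?A \<cdot> (idn p \<odot> cyc k)) \<cdot> (?N \<odot> phi n)"
    by (simp add: comp_assoc)
  have reduce: "?A \<cdot> eval (normal_form (Suc s) (Suc (p + k)) (insert_strand s p n d))
      = (?A \<cdot> (idn p \<odot> cyc k)) \<cdot> (?N \<odot> phi n)"
    unfolding nf push ..
  have absorb: "((idn p' \<odot> cyc k') \<cdot> (M \<odot> idn (Suc 0))) \<cdot> (?N \<odot> phi n)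
      = (idn p' \<odot> cyc k') \<cdot> ((M \<cdot> ?N) \<odot> phi n)"
    if "arr M" "src M = pw (p + k)" "tgt M = pw (p' + k')" for M p' k'
    using that by (simp add: comp_assoc tens_comp)
  consider (below) b' where "p = a + rook_gen_dom g + b'" | (above) a' where "a = Suc p + a'"
    | (hit) "a \<le> p" "p < a + rook_gen_dom g"
    by (meson le_Suc_ex not_less not_less_eq_eq)
  then show ?case
  proof cases
    case (below b')
    \<comment> \<open>The generator lies to the left of the moving strand and of everything that it passes, so it
      slides below the cycle.\<close>
    let ?h = "idn a \<odot> w g \<odot> idn b'" and ?p = "a + rook_gen_cod g + b'"
    have b: "b = b' + Suc k"
      using pk below by simp
    have h [simp]: "arr ?h" "src ?h = pw p" "tgt ?h = pw ?p"
      using below by (simp_all add: add.assoc)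
    have "?A \<cdot> (idn p \<odot> cyc k) = (?h \<odot> idn (Suc k)) \<cdot> (idn p \<odot> cyc k)"
      by (simp add: b tens_assoc)
    also have "\<dots> = (idn ?p \<odot> cyc k) \<cdot> (?h \<odot> idn (Suc k))"
      using slide[OF h(1) arr_cyc(1) h(2,3) arr_cyc(2,3)] by simp
    also have "?h \<odot> idn (Suc k) = (idn a \<odot> w g \<odot> idn (b' + k)) \<odot> idn (Suc 0)"
      by (simp add: tens_assoc)
    finally have "(?A \<cdot> (idn p \<odot> cyc k)) \<cdot> (?N \<odot> phi n)
        = (idn ?p \<odot> cyc k) \<cdot> (((idn a \<odot> w g \<odot> idn (b' + k)) \<cdot> ?N) \<odot> phi n)"
      by (simp only:) (rule absorb; simp add: below ac_simps)
    then have eq: "?A \<cdot> eval (normal_form (Suc s) (Suc (p + k)) (insert_strand s p n d))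
        = (idn ?p \<odot> cyc k) \<cdot> (((idn a \<odot> w g \<odot> idn (b' + k)) \<cdot> ?N) \<odot> phi n)"
      unfolding reduce .
    have "monomial s (?p + k) ((idn a \<odot> w g \<odot> idn (b' + k)) \<cdot> ?N)"
      using matched.IH[of a "b' + k"] below by (simp add: ac_simps)
    from monomial_matched[OF this, of n] show ?thesis
      unfolding eq by (simp add: b add.assoc)
  next
    case (above a')
    \<comment> \<open>The generator acts on strands that the moving strand passes, and naturality of the cycle
      applies.\<close>
    let ?h = "idn a' \<odot> w g \<odot> idn b" and ?k = "a' + rook_gen_cod g + b"
    have k: "k = a' + rook_gen_dom g + b"
      using pk above by simp
    have h [simp]: "arr ?h" "src ?h = pw k" "tgt ?h = pw ?k"
      using k by (simp_all add: add.assoc)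
    have "passes k ?k ?h"
      using passes_tens[OF passes_idn[of a'] passes_tens[OF passes_gen[of g] passes_idn[of b]]]
      by (simp add: k add.assoc)
    then have pass: "(idn (Suc 0) \<odot> ?h) \<cdot> cyc k = cyc ?k \<cdot> (?h \<odot> idn (Suc 0))"
      by (simp add: passes_def)
    have "?A \<cdot> (idn p \<odot> cyc k) = idn p \<odot> ((idn (Suc 0) \<odot> ?h) \<cdot> cyc k)"
      by (simp add: above k whisker_left add.assoc)
    also have "\<dots> = (idn p \<odot> cyc ?k) \<cdot> ((idn p \<odot> ?h) \<odot> idn (Suc 0))"
      unfolding pass by (simp add: whisker_left tens_assoc)
    also have "idn p \<odot> ?h = idn (p + a') \<odot> w g \<odot> idn b"
      by simp
    finally have "(?A \<cdot> (idn p \<odot> cyc k)) \<cdot> (?N \<odot> phi n)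
        = (idn p \<odot> cyc ?k) \<cdot> (((idn (p + a') \<odot> w g \<odot> idn b) \<cdot> ?N) \<odot> phi n)"
      by (simp only:) (rule absorb; simp add: k ac_simps)
    then have eq: "?A \<cdot> eval (normal_form (Suc s) (Suc (p + k)) (insert_strand s p n d))
        = (idn p \<odot> cyc ?k) \<cdot> (((idn (p + a') \<odot> w g \<odot> idn b) \<cdot> ?N) \<odot> phi n)"
      unfolding reduce .
    have "monomial s (p + ?k) ((idn (p + a') \<odot> w g \<odot> idn b) \<cdot> ?N)"
      using matched.IH[of "p + a'" b] k by (simp add: ac_simps)
    from monomial_matched[OF this, of n] show ?thesis
      unfolding eq by (simp add: above add.assoc)
  next
    case hit
    \<comment> \<open>The generator acts on the moving strand itself.\<close>
    note N_monomial = monomial_normal_form[OF matched.hyps]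
    show ?thesis
    proof (cases "g \<in> {GPhiPlus, GPhiMinus}")
      case True
      then have eq: "p = a" "k = b" and g1 [simp]: "rook_gen_dom g = 1" "rook_gen_cod g = 1"
        using hit pk by auto
      obtain m where m: "w g \<cdot> phi n = phi m"
        using phi_comp_phi[OF True] by blast
      have "?A \<cdot> (idn p \<odot> cyc k) = idn p \<odot> ((w g \<odot> idn k) \<cdot> cyc k)"
        by (simp add: eq whisker_left)
      also have "\<dots> = (idn p \<odot> cyc k) \<cdot> (idn (p + k) \<odot> w g)"
        unfolding phi_comp_cyc[OF True] by (simp add: whisker_left)
      finally have "(?A \<cdot> (idn p \<odot> cyc k)) \<cdot> (?N \<odot> phi n) = (idn p \<odot> cyc k) \<cdot> (?N \<odot> phi m)"
        by (simp add: comp_assoc tens_comp m)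
      then show ?thesis
        unfolding reduce using monomial_matched[OF N_monomial, of m] by (simp add: eq)
    next
      case False
      show ?thesis
      proof (cases g)
        case GX
        \<comment> \<open>The crossing either undoes the last step of the cycle or adds one more step to it.\<close>
        then consider (first) "p = a" "k = Suc b" | (second) "p = Suc a" "k = b"
          using hit pk by fastforce
        then show ?thesis
        proof cases
          case first
          have "?A \<cdot> (idn p \<odot> cyc k)
              = idn a \<odot> ((w GX \<odot> idn b) \<cdot> (w GX \<odot> idn b) \<cdot> (idn (Suc 0) \<odot> cyc b))"
            by (simp add: GX first whisker_left)
          also have "(w GX \<odot> idn b) \<cdot> (w GX \<odot> idn b) \<cdot> (idn (Suc 0) \<odot> cyc b)
              = ((w GX \<cdot> w GX) \<odot> idn b) \<cdot> (idn (Suc 0) \<odot> cyc b)"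
            by (simp add: whisker_right comp_assoc)
          also have "\<dots> = idn (Suc 0) \<odot> cyc b"
            unfolding rook_relations(1) by simp
          finally have "?A \<cdot> (idn p \<odot> cyc k) = idn (Suc p) \<odot> cyc b"
            by (simp add: first)
          then show ?thesis
            unfolding reduce using monomial_matched[of s "Suc p" b ?N n] N_monomial
            by (simp add: first GX)
        next
          case second
          have "?A \<cdot> (idn p \<odot> cyc k) = idn a \<odot> cyc (Suc k)"
            by (simp add: GX second whisker_left)
          then show ?thesis
            unfolding reduce using monomial_matched[of s a "Suc k" ?N n] N_monomial
            by (simp add: second GX del: cycle_term.simps)
        qed
      next
        case GEps
        then have eq: "p = a" "k = b"
          using hit pk by auto
        have "?A \<cdot> (idn p \<odot> cyc k) = idn p \<odot> ((w GEps \<odot> idn k) \<cdot> cyc k)"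
          by (simp add: GEps eq whisker_left)
        also have "\<dots> = idn (p + k) \<odot> w GEps"
          unfolding eps_comp_cyc by simp
        finally have "(?A \<cdot> (idn p \<odot> cyc k)) \<cdot> (?N \<odot> phi n) = ?N \<odot> w GEps"
          by (simp add: tens_comp eps_comp_phi)
        then show ?thesis
          unfolding reduce using monomial_isolated[OF N_monomial] by (simp add: eq GEps)
      next
        case GEta
        then show ?thesis
          using hit by simp
      qed (use False in auto)
    qed
  qed
qed

end

section \<open>Expansion into normal forms\<close>

context rook_model
begin

lemmas arr_lincomb = eval_arr[OF wt_lincomb_term]

lemma lincomb_add:
  assumes "set ds \<subseteq> adiags s t"
  shows "eval (lincomb_term s t ds (\<lambda>d. c d + c' d)) =
    Add C (eval (lincomb_term s t ds c)) (eval (lincomb_term s t ds c'))"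
  using assms
  by (induction ds) (simp_all add: add_zer scl_plus add_swap arr_lincomb)

lemma lincomb_scl:
  assumes "set ds \<subseteq> adiags s t"
  shows "eval (lincomb_term s t ds (\<lambda>d. x * c d)) = Scl C x (eval (lincomb_term s t ds c))"
  using assms
  by (induction ds) (simp_all add: scl_zer scl_add scl_scl' arr_lincomb)

lemma lincomb_zero:
  assumes "set ds \<subseteq> adiags s t" "\<And>d. d \<in> set ds \<Longrightarrow> c d = 0"
  shows "eval (lincomb_term s t ds c) = Zer C (pw s) (pw t)"
  using assms
proof (induction ds)
  case (Cons d ds)
  then show ?case
    using zer_eq[of "eval (normal_form s t d)" "pw s" "pw t"] by (simp add: add_zer flip: zer_eq)
qed simp

lemma lincomb_single:
  assumes "set ds \<subseteq> adiags s t" "distinct ds" "d \<in> set ds"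
  shows "eval (lincomb_term s t ds (Poly_Mapping.lookup (Poly_Mapping.single d 1)))
      = eval (normal_form s t d)"
  using assms
proof (induction ds)
  case (Cons e ds)
  show ?case
  proof (cases "e = d")
    case True
    then have "eval (lincomb_term s t ds (Poly_Mapping.lookup (Poly_Mapping.single d 1)))
        = Zer C (pw s) (pw t)"
      using Cons.prems by (intro lincomb_zero) (auto simp: lookup_single when_def)
    moreover have "Add C (eval (normal_form s t d)) (Zer C (pw s) (pw t))
        = eval (normal_form s t d)"
      using Cons.prems by (intro add_zer_right) auto
    ultimately show ?thesis
      using True Cons.prems by (simp add: scl_one')
  next
    case False
    then have "eval (lincomb_term s t ds (Poly_Mapping.lookup (Poly_Mapping.single d 1)))
        = eval (normal_form s t d)"
      using Cons by auto
    moreover have "Scl C 0 (eval (normal_form s t e)) = Zer C (pw s) (pw t)"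
      using Cons.prems zer_eq[of "eval (normal_form s t e)"] by simp
    moreover have "Poly_Mapping.lookup (Poly_Mapping.single d (1::'k)) e = 0"
      using False by (simp add: lookup_single_not_eq)
    moreover have "d \<in> adiags s t"
      using Cons.prems by auto
    ultimately show ?thesis
      by (simp add: add_zer)
  qed
qed simp

text \<open>The morphism \<open>f\<close> is the combination of normal forms with coefficients \<open>q\<close>, summed over any
  list of diagrams that contains \<open>S\<close>. Since \<open>S\<close> may exceed the support of \<open>q\<close>, the notion survives
  the cancellation of coefficients in sums, and since every such list is allowed, two expansions
  can be compared over a common list.\<close>

definition expands :: "nat \<Rightarrow> nat \<Rightarrow> 'n \<Rightarrow> (adiag \<Rightarrow>\<^sub>0 'k) \<Rightarrow> bool" where
  "expands s t f q \<longleftrightarrow> (\<exists>S. finite S \<and> Poly_Mapping.keys q \<subseteq> S \<and> S \<subseteq> adiags s t \<and>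
     (\<forall>ds. distinct ds \<longrightarrow> S \<subseteq> set ds \<longrightarrow> set ds \<subseteq> adiags s t \<longrightarrow>
        f = eval (lincomb_term s t ds (Poly_Mapping.lookup q))))"

lemma expands_zero: "expands s t (Zer C (pw s) (pw t)) 0"
  unfolding expands_def by (intro exI[of _ "{}"]) (simp add: lincomb_zero)

lemma expands_normal_form:
  "d \<in> adiags s t \<Longrightarrow> expands s t (eval (normal_form s t d)) (Poly_Mapping.single d 1)"
  unfolding expands_def by (intro exI[of _ "{d}"]) (simp add: lincomb_single)

lemma expands_scl:
  assumes "expands s t f q"
  shows "expands s t (Scl C x f) (pm_scale x q)"
proof -
  obtain S where S: "finite S" "Poly_Mapping.keys q \<subseteq> S" "S \<subseteq> adiags s t"
      "\<And>ds. distinct ds \<Longrightarrow> S \<subseteq> set ds \<Longrightarrow> set ds \<subseteq> adiags s t \<Longrightarrow>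
         f = eval (lincomb_term s t ds (Poly_Mapping.lookup q))"
    using assms unfolding expands_def by metis
  have lookup: "Poly_Mapping.lookup (pm_scale x q) = (\<lambda>d. x * Poly_Mapping.lookup q d)"
    by (rule ext) (rule lookup_pm_scale)
  show ?thesis
    unfolding expands_def
  proof (intro exI[of _ S] conjI allI impI)
    fix ds assume "distinct ds" "S \<subseteq> set ds" "set ds \<subseteq> adiags s t"
    then show "Scl C x f = eval (lincomb_term s t ds (Poly_Mapping.lookup (pm_scale x q)))"
      using S(4)[of ds] by (simp add: lookup lincomb_scl)
  qed (use S keys_pm_scale[of x q] in auto)
qed

lemma expands_add:
  assumes "expands s t f q" "expands s t f' q'"
  shows "expands s t (Add C f f') (q + q')"
proof -
  obtain S S' where S: "finite S" "Poly_Mapping.keys q \<subseteq> S" "S \<subseteq> adiags s t"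
      "\<And>ds. distinct ds \<Longrightarrow> S \<subseteq> set ds \<Longrightarrow> set ds \<subseteq> adiags s t \<Longrightarrow>
         f = eval (lincomb_term s t ds (Poly_Mapping.lookup q))"
    and S': "finite S'" "Poly_Mapping.keys q' \<subseteq> S'" "S' \<subseteq> adiags s t"
      "\<And>ds. distinct ds \<Longrightarrow> S' \<subseteq> set ds \<Longrightarrow> set ds \<subseteq> adiags s t \<Longrightarrow>
         f' = eval (lincomb_term s t ds (Poly_Mapping.lookup q'))"
    using assms unfolding expands_def by metis
  have lookup: "Poly_Mapping.lookup (q + q')
      = (\<lambda>d. Poly_Mapping.lookup q d + Poly_Mapping.lookup q' d)"
    by (rule ext) (rule lookup_add)
  show ?thesis
    unfolding expands_def
  proof (intro exI[of _ "S \<union> S'"] conjI allI impI)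
    fix ds assume "distinct ds" "S \<union> S' \<subseteq> set ds" "set ds \<subseteq> adiags s t"
    then show "Add C f f' = eval (lincomb_term s t ds (Poly_Mapping.lookup (q + q')))"
      using S(4)[of ds] S'(4)[of ds] by (simp add: lookup lincomb_add)
  qed (use S S' keys_add[of q q'] in auto)
qed

lemma expands_list:
  assumes "expands s t f q"
  obtains ds where "distinct ds" "Poly_Mapping.keys q \<subseteq> set ds" "set ds \<subseteq> adiags s t"
    "f = eval (lincomb_term s t ds (Poly_Mapping.lookup q))"
proof -
  obtain S where S: "finite S" "Poly_Mapping.keys q \<subseteq> S" "S \<subseteq> adiags s t"
      "\<And>ds. distinct ds \<Longrightarrow> S \<subseteq> set ds \<Longrightarrow> set ds \<subseteq> adiags s t \<Longrightarrow>
         f = eval (lincomb_term s t ds (Poly_Mapping.lookup q))"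
    using assms unfolding expands_def by metis
  obtain ds where "set ds = S" "distinct ds"
    using finite_distinct_list[OF S(1)] by blast
  then show ?thesis
    using S that by auto
qed

lemma expands_unique:
  assumes "expands s t f q" "expands s t g q"
  shows "f = g"
proof -
  obtain S S' where S: "finite S" "S \<subseteq> adiags s t"
      "\<And>ds. distinct ds \<Longrightarrow> S \<subseteq> set ds \<Longrightarrow> set ds \<subseteq> adiags s t \<Longrightarrow>
         f = eval (lincomb_term s t ds (Poly_Mapping.lookup q))"
    and S': "finite S'" "S' \<subseteq> adiags s t"
      "\<And>ds. distinct ds \<Longrightarrow> S' \<subseteq> set ds \<Longrightarrow> set ds \<subseteq> adiags s t \<Longrightarrow>
         g = eval (lincomb_term s t ds (Poly_Mapping.lookup q))"
    using assms unfolding expands_def by metis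
  obtain ds where "set ds = S \<union> S'" "distinct ds"
    using finite_distinct_list[of "S \<union> S'"] S(1) S'(1) by blast
  then show ?thesis
    using S(2) S(3)[of ds] S'(2) S'(3)[of ds] by simp
qed

definition spanned :: "nat \<Rightarrow> nat \<Rightarrow> 'n \<Rightarrow> bool" where
  "spanned s t f \<longleftrightarrow> (\<exists>q. expands s t f q)"

lemma spanned_arr:
  assumes "spanned s t f"
  shows "arr f" "src f = pw s" "tgt f = pw t"
  using assms arr_lincomb unfolding spanned_def by (metis expands_list)+

lemma spanned_zero: "spanned s t (Zer C (pw s) (pw t))"
  unfolding spanned_def using expands_zero by blast

lemma spanned_add: "spanned s t f \<Longrightarrow> spanned s t g \<Longrightarrow> spanned s t (Add C f g)"
  unfolding spanned_def using expands_add by blast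

lemma spanned_scl: "spanned s t f \<Longrightarrow> spanned s t (Scl C x f)"
  unfolding spanned_def using expands_scl by blast

lemma spanned_monomial: "monomial s t f \<Longrightarrow> spanned s t f"
  using expands_scl[OF expands_normal_form] unfolding monomial_def spanned_def by blast

lemma spanned_comp:
  assumes f: "spanned s t f" and h: "arr h" "src h = pw t" "tgt h = pw t'"
    and nf: "\<And>d. d \<in> adiags s t \<Longrightarrow> spanned s t' (h \<cdot> eval (normal_form s t d))"
  shows "spanned s t' (h \<cdot> f)"
proof -
  obtain q ds where "set ds \<subseteq> adiags s t" "f = eval (lincomb_term s t ds (Poly_Mapping.lookup q))"
    using f expands_list unfolding spanned_def by metis
  moreover have "spanned s t' (h \<cdot> eval (lincomb_term s t ds c))" if "set ds \<subseteq> adiags s t" for c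
    using that
  proof (induction ds)
    case Nil
    show ?case
      using h by (simp add: comp_zer spanned_zero)
  next
    case (Cons d ds)
    then show ?case
      using h by (simp add: comp_add comp_scl arr_lincomb spanned_add spanned_scl nf)
  qed
  ultimately show ?thesis by simp
qed

lemma ob_eq_pw: "ob C v a = pw (length a)"
  by (simp add: pw_def word_def replicate_length_same)

text \<open>By linearity in \<open>f\<close> the case of a generator is \<open>whiskered_gen_comp_normal_form\<close>. Whiskering
  with arbitrary identities makes the induction pass through tensor products, because \<open>t \<otimes> u\<close> is
  \<open>t\<close> and \<open>u\<close> one after the other, each with an identity beside it.\<close>

lemma spanned_eval_comp:
  assumes "wt (rook_presentation \<beta>) t x y" "spanned s (a + length x + b) f"
  shows "spanned s (a + length y + b) ((idn a \<odot> eval t \<odot> idn b) \<cdot> f)"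
  using assms
proof (induction arbitrary: a b f rule: wt.induct)
  case (wt_gen g)
  then have "spanned s (a + rook_gen_dom g + b) f"
    by (simp add: rook_presentation_def)
  then have "spanned s (a + rook_gen_cod g + b) ((idn a \<odot> w g \<odot> idn b) \<cdot> f)"
  proof (rule spanned_comp)
    fix d assume "d \<in> adiags s (a + rook_gen_dom g + b)"
    then show "spanned s (a + rook_gen_cod g + b)
        ((idn a \<odot> w g \<odot> idn b) \<cdot> eval (normal_form s (a + rook_gen_dom g + b) d))"
      by (intro spanned_monomial whiskered_gen_comp_normal_form) simp_all
  qed (simp_all add: add.assoc)
  then show ?case
    by (simp add: rook_presentation_def)
next
  case (wt_id z)
  then show ?case
    using spanned_arr[of s _ f] by (simp add: ob_eq_pw add.assoc)
next
  case (wt_zero z z')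
  show ?case
    using spanned_arr[OF wt_zero] by (simp add: ob_eq_pw comp_zer tens_zer spanned_zero add.assoc)
next
  case (wt_comp t y z u x)
  note t = ev_arr[OF wt_comp.hyps(1), unfolded ob_eq_pw]
      and u = ev_arr[OF wt_comp.hyps(2), unfolded ob_eq_pw]
  have "(idn a \<odot> eval (t \<circ>\<^sub>t u) \<odot> idn b) \<cdot> f
      = (idn a \<odot> eval t \<odot> idn b) \<cdot> (idn a \<odot> eval u \<odot> idn b) \<cdot> f"
    using t u spanned_arr[OF wt_comp.prems]
    by (simp add: whisker_left whisker_right comp_assoc add.assoc)
  then show ?case
    using wt_comp.IH(1)[OF wt_comp.IH(2)[OF wt_comp.prems]] by simp
next
  case (wt_tens t x y u x' y')
  note t = ev_arr[OF wt_tens.hyps(1), unfolded ob_eq_pw]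
      and u = ev_arr[OF wt_tens.hyps(2), unfolded ob_eq_pw]
  have f: "spanned s ((a + length x) + length x' + b) f"
    using wt_tens.prems by (simp add: add.assoc)
  have "idn a \<odot> eval (t \<otimes>\<^sub>t u) \<odot> idn b
      = (idn a \<odot> eval t \<odot> idn (length y' + b)) \<cdot> (idn (a + length x) \<odot> eval u \<odot> idn b)"
    using slide(1)[of "idn a \<odot> eval t" "eval u \<odot> idn b" "a + length x" "a + length y"
        "length x' + b" "length y' + b"]
      t u by (simp add: tens_assoc)
  then have "(idn a \<odot> eval (t \<otimes>\<^sub>t u) \<odot> idn b) \<cdot> f
      = (idn a \<odot> eval t \<odot> idn (length y' + b)) \<cdot> (idn (a + length x) \<odot> eval u \<odot> idn b) \<cdot> f"
    using t u spanned_arr[OF f] by (simp add: comp_assoc add.assoc)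
  then show ?case
    using wt_tens.IH(1)[of a "length y' + b"] wt_tens.IH(2)[OF f] by (simp add: add.assoc)
next
  case (wt_add t x y u)
  note t = ev_arr[OF wt_add.hyps(1), unfolded ob_eq_pw]
      and u = ev_arr[OF wt_add.hyps(2), unfolded ob_eq_pw]
  show ?case
    using t u spanned_arr[OF wt_add.prems] spanned_add[OF wt_add.IH(1,2)[OF wt_add.prems]]
    by (simp add: tens_add comp_add add.assoc)
next
  case (wt_scl t x y c)
  note t = ev_arr[OF wt_scl.hyps(1), unfolded ob_eq_pw]
  show ?case
    using t spanned_arr[OF wt_scl.prems] spanned_scl[OF wt_scl.IH[OF wt_scl.prems]]
    by (simp add: tens_scl comp_scl add.assoc)
qed

text \<open>An identity is its own normal form: each strand goes straight up with label \<open>0\<close>.\<close>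

lemma monomial_idn: "monomial n n (idn n)"
proof (induction n)
  case 0
  have "Map.empty \<in> adiags 0 0"
    by (simp add: adiags_def)
  from monomial_normal_form[OF this] show ?case
    by (simp add: normal_form.simps)
next
  case (Suc n)
  then show ?case
    using monomial_matched[of n n 0 "idn n" 0] by (simp add: phi_0)
qed

text \<open>An expression is its product with an identity, and identities are normal forms.\<close>

lemma expansion:
  assumes "wt (rook_presentation \<beta>) t x y"
  obtains q where "expands (length x) (length y) (eval t) q"
proof -
  have "spanned (length x) (length y) ((idn 0 \<odot> eval t \<odot> idn 0) \<cdot> idn (length x))"
    using spanned_eval_comp[OF assms, of _ 0 0] spanned_monomial[OF monomial_idn] by simp
  then show ?thesis
    using that ev_arr[OF assms] by (auto simp: ob_eq_pw spanned_def)
qed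

end

section \<open>Evaluation of expressions as diagrams\<close>

lemma wf_rook_presentation: "wf_presentation (rook_presentation \<beta>)"
  unfolding wf_presentation_def wt_iff
  by (auto simp: rook_presentation_def rook_rels_def Let_def numeral_2_eq_2)

text \<open>No middle vertex is isolated in both factors if one of them has a strand at each of these
  vertices.\<close>

lemma closed_components_eq_0:
  assumes "{1..t} \<subseteq> dom a \<or> {1..t} \<subseteq> fst ` ran b"
  shows "closed_components t a b = 0"
proof -
  have "{j \<in> {1..t}. j \<notin> dom a \<and> j \<notin> fst ` ran b} = {}"
    using assms by blast
  then show ?thesis
    unfolding closed_components_def by (simp only: card.empty)
qed

lemma aro_comp_diag_mor:
  "aro_comp \<beta> (diag_mor t u a) (diag_mor s t b) =
     aro_scl (\<beta> ^ closed_components t a b) (diag_mor s u (diag_comp a b))"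
  by (simp add: diag_mor_def aro_comp_eq pm_scale_single flip: pm_scale_def)

lemma aro_tens_diag_mor:
  "aro_tens (diag_mor s t a) (diag_mor s' t' b) = diag_mor (s + s') (t + t') (diag_tens s t a b)"
  by (simp add: diag_mor_def aro_tens_eq)

lemma aro_scl_1: "aro_scl 1 m = m"
  by (cases m) (simp add: poly_mapping_eq_iff Poly_Mapping.map.rep_eq when_def fun_eq_iff)

lemma ob_aRo: "ob (aRo \<beta>) (\<lambda>_. 1) a = length a"
  by (induction a) (simp_all add: aRo_simps)

definition diagram_ev :: "'k::field \<Rightarrow> (unit, rook_gen, 'k) mterm \<Rightarrow> 'k aro_mor" where
  "diagram_ev \<beta> = ev (aRo \<beta>) (\<lambda>_. 1) rook_gen_mor"

lemma diagram_ev_simps [simp]: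
  "diagram_ev \<beta> (TGen g) = rook_gen_mor g"
  "diagram_ev \<beta> (TId a) = diag_mor (length a) (length a) (diag_id (length a))"
  "diagram_ev \<beta> (TZero a b) = (length a, length b, 0)"
  "diagram_ev \<beta> (t \<circ>\<^sub>t u) = aro_comp \<beta> (diagram_ev \<beta> t) (diagram_ev \<beta> u)"
  "diagram_ev \<beta> (t \<otimes>\<^sub>t u) = aro_tens (diagram_ev \<beta> t) (diagram_ev \<beta> u)"
  "diagram_ev \<beta> (TAdd t u) = aro_add (diagram_ev \<beta> t) (diagram_ev \<beta> u)"
  "diagram_ev \<beta> (TScl c t) = aro_scl c (diagram_ev \<beta> t)"
  unfolding diagram_ev_def ev.simps ob_aRo by (simp_all add: aRo_def)

lemma rook_gen_mor_hom:
  "rook_gen_mor g \<in> Hom (aRo \<beta>) (rook_gen_dom g) (rook_gen_cod g)"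
  by (cases g) (auto simp: aRo_simps diag_mor_def intro!: adiagsI split: if_splits)

text \<open>In each relation except \<open>\<epsilon> \<circ> \<eta> = \<beta>\<close>, one factor of every composite has a strand at each
  middle vertex, so no closed components appear and the two sides can be compared as partial
  maps.\<close>

lemma model_aRo: "model (aRo \<beta>) (rook_presentation \<beta>) (\<lambda>_. 1) rook_gen_mor"
proof (intro model.intro model_axioms.intro strict_linear_monoidal_aRo)
  fix g
  show "rook_gen_mor g \<in> Hom (aRo \<beta>) (ob (aRo \<beta>) (\<lambda>_. 1) (gdom (rook_presentation \<beta>) g))
      (ob (aRo \<beta>) (\<lambda>_. 1) (gcod (rook_presentation \<beta>) g))"
    unfolding ob_aRo using rook_gen_mor_hom by (simp add: rook_presentation_def)
next
  fix l r :: "(unit, rook_gen, 'a) mterm"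
  assume rel: "(l, r) \<in> rels (rook_presentation \<beta>)"
  define swap :: adiag where "swap = [1 \<mapsto> (2, 0), 2 \<mapsto> (1, 0)]"
  have swap: "swap (Suc 0) = Some (Suc (Suc 0), 0)" "swap (Suc (Suc 0)) = Some (Suc 0, 0)"
      "i \<noteq> Suc 0 \<Longrightarrow> i \<noteq> Suc (Suc 0) \<Longrightarrow> swap i = None" for i
    by (simp_all add: swap_def)
  have X: "rook_gen_mor GX = diag_mor (Suc (Suc 0)) (Suc (Suc 0)) swap"
    by (simp add: swap_def numeral_2_eq_2)
  define total where "total s d \<longleftrightarrow> {1..s} \<subseteq> dom d" for s and d :: adiag
  have comp: "aro_comp \<beta> (diag_mor t u a) (diag_mor s t b) = diag_mor s u (diag_comp a b)"
    if "total t a \<or> {1..t} \<subseteq> fst ` ran b" for t u s a b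
    using that by (simp add: total_def aro_comp_diag_mor closed_components_eq_0 aro_scl_1)
  have total_tens: "total s (diag_tens s' t' d d')"
    if "s' \<le> s" "total s' d" "total (s - s') d'" for s s' t' d d'
  proof -
    have "i \<in> dom (diag_tens s' t' d d')" if "i \<in> {1..s}" for i
    proof (cases "i \<le> s'")
      case True
      then show ?thesis
        using that \<open>total s' d\<close> by (auto simp: total_def diag_tens_def dom_def subset_iff)
    next
      case False
      then have "i - s' \<in> {1..s - s'}"
        using that by auto
      then show ?thesis
        using False \<open>total (s - s') d'\<close> by (auto simp: total_def diag_tens_def dom_def subset_iff)
    qed
    then show ?thesis
      unfolding total_def by blast
  qed
  have total: "total s (diag_id s)" "total (Suc 0) [Suc 0 \<mapsto> x]" "total (Suc (Suc 0)) swap"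
    for s and x :: "nat \<times> int"
    by (auto simp: total_def diag_id_def swap_def subset_iff dom_def numeral_2_eq_2 le_Suc_eq)
  have swap_top: "Suc 0 \<in> fst ` ran swap" "Suc (Suc 0) \<in> fst ` ran swap"
    unfolding in_top_iff using swap by blast+
  have surj: "{Suc 0..Suc 0} \<subseteq> fst ` ran [Suc 0 \<mapsto> (Suc 0, n)]"
      "{Suc 0..Suc (Suc 0)} \<subseteq> fst ` ran swap" for n :: int
    using swap_top by (auto simp: subset_iff le_Suc_eq)
  have swap_eq: "swap = (\<lambda>i. if i = Suc 0 then Some (Suc (Suc 0), 0) else if i
      = Suc (Suc 0) then Some (Suc 0, 0) else None)"
    by (auto simp: swap_def fun_eq_iff)
  have total_braid: "total (Suc (Suc (Suc 0))) (diag_comp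
        (diag_tens (Suc (Suc 0)) (Suc (Suc 0)) swap (diag_id (Suc 0)))
        (diag_tens (Suc 0) (Suc 0) (diag_id (Suc 0)) swap))"
    "total (Suc (Suc (Suc 0))) (diag_comp
        (diag_tens (Suc 0) (Suc 0) (diag_id (Suc 0)) swap)
        (diag_tens (Suc (Suc 0)) (Suc (Suc 0)) swap (diag_id (Suc 0))))"
    by (auto simp: total_def swap_eq diag_comp_def diag_tens_def diag_id_def le_Suc_eq
        split: option.splits if_splits)
  have loop: "aro_comp \<beta> (diag_mor (Suc 0) 0 Map.empty) (diag_mor 0 (Suc 0) Map.empty)
      = aro_scl \<beta> (diag_mor 0 0 (diag_id 0))"
    by (simp add: aro_comp_diag_mor closed_components_def diag_id_0 diag_comp_def)
  have braid: "diag_comp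
        (diag_comp (diag_tens (Suc (Suc 0)) (Suc (Suc 0)) swap (diag_id (Suc 0)))
          (diag_tens (Suc 0) (Suc 0) (diag_id (Suc 0)) swap))
        (diag_tens (Suc (Suc 0)) (Suc (Suc 0)) swap (diag_id (Suc 0)))
      = diag_comp
        (diag_comp (diag_tens (Suc 0) (Suc 0) (diag_id (Suc 0)) swap)
          (diag_tens (Suc (Suc 0)) (Suc (Suc 0)) swap (diag_id (Suc 0))))
        (diag_tens (Suc 0) (Suc 0) (diag_id (Suc 0)) swap)"
  proof (rule ext, goal_cases)
    case (1 i)
    consider "i = Suc 0" | "i = Suc (Suc 0)" | "i = Suc (Suc (Suc 0))" | "i = 0" |
        "Suc (Suc (Suc 0)) < i"
      by linarith
    then show ?case
      by cases (auto simp: swap_eq diag_comp_def diag_tens_def diag_id_def)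
  qed
  note diag_defs = swap_eq diag_comp_def diag_tens_def diag_id_def
  have naturality:
    "diag_comp (diag_tens (Suc 0) (Suc 0) [Suc 0 \<mapsto> (Suc 0, n)] (diag_id (Suc 0))) swap
      = diag_comp swap (diag_tens (Suc 0) (Suc 0) (diag_id (Suc 0)) [Suc 0 \<mapsto> (Suc 0, n)])"
    "diag_comp (diag_tens (Suc 0) (Suc 0) (diag_id (Suc 0)) [Suc 0 \<mapsto> (Suc 0, n)]) swap
      = diag_comp swap (diag_tens (Suc 0) (Suc 0) [Suc 0 \<mapsto> (Suc 0, n)] (diag_id (Suc 0)))"
    "diag_comp (diag_tens (Suc 0) (Suc 0) (diag_id (Suc 0)) Map.empty) swap
      = diag_tens (Suc 0) 0 Map.empty (diag_id (Suc 0))"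
    "diag_comp swap (diag_tens (Suc 0) (Suc 0) (diag_id (Suc 0)) Map.empty)
      = diag_tens 0 (Suc 0) Map.empty (diag_id (Suc 0))" for n
    by (rule ext, auto simp: diag_defs)+
  have inverse: "diag_comp swap swap = diag_id (Suc (Suc 0))"
    "m + n = 0 \<Longrightarrow> diag_comp [Suc 0 \<mapsto> (Suc 0, n)] [Suc 0 \<mapsto> (Suc 0, m)] = diag_id (Suc 0)" for m n
    by (rule ext, auto simp: diag_defs)+
  have absorb: "diag_comp a Map.empty = Map.empty" "diag_comp Map.empty a = Map.empty" for a
    by (rule ext, simp add: diag_comp_def split: option.splits)+
  have "diagram_ev \<beta> l = diagram_ev \<beta> r"
    using rel unfolding rook_presentation_def rook_rels_def Let_def
    by (auto simp: aro_tens_diag_mor comp X total total_tens surj total_braid braid loop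
      naturality inverse absorb numeral_2_eq_2 simp del: rook_gen_mor.simps(1))
  then show "ev (aRo \<beta>) (\<lambda>_. 1) rook_gen_mor l = ev (aRo \<beta>) (\<lambda>_. 1) rook_gen_mor r"
    unfolding diagram_ev_def .
qed (simp add: aRo_simps)

text \<open>The value of \<open>cycle_term k\<close>.\<close>

definition cycle_diag :: "nat \<Rightarrow> adiag" where
  "cycle_diag k = (\<lambda>i. if i \<in> {1..k} then Some (Suc i, 0) else if i = Suc k then Some (1, 0)
      else None)"

lemma diagram_ev_cycle:
  "diagram_ev \<beta> (cycle_term k) = diag_mor (Suc k) (Suc k) (cycle_diag k)"
proof (induction k)
  case 0
  have "cycle_diag 0 = diag_id (Suc 0)"
    by (rule ext) (auto simp: cycle_diag_def diag_id_def)
  then show ?case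
    by (simp add: word_def)
next
  case (Suc k)
  let ?X = "[1 \<mapsto> (2, 0), 2 \<mapsto> (1, 0)] :: adiag"
  have "{1..Suc (Suc k)} \<subseteq> dom (diag_tens 2 2 ?X (diag_id k))"
    by (auto simp: diag_tens_def diag_id_def dom_def le_Suc_eq numeral_2_eq_2)
  then have "closed_components (Suc (Suc k)) (diag_tens 2 2 ?X (diag_id k)) b = 0" for b
    by (intro closed_components_eq_0) blast
  moreover have "diag_comp (diag_tens 2 2 ?X (diag_id k))
      (diag_tens 1 1 (diag_id 1) (cycle_diag k)) = cycle_diag (Suc k)"
  proof (rule ext)
    fix i
    consider "i = 0" | "i = 1" | "1 < i" "i \<le> Suc k" | "i = Suc (Suc k)" | "Suc (Suc k) < i"
      by linarith
    then show "diag_comp (diag_tens 2 2 ?X (diag_id k)) (diag_tens 1 1 (diag_id 1) (cycle_diag k))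
        i = cycle_diag (Suc k) i"
      by cases (auto simp: diag_comp_def diag_tens_def diag_id_def cycle_diag_def)
  qed
  ultimately show ?case
    using Suc by (simp add: word_def aro_tens_diag_mor aro_comp_diag_mor aro_scl_1)
qed

lemma diagram_ev_phi:
  "diagram_ev \<beta> (phi_term n) = diag_mor 1 1 [1 \<mapsto> (1, n)]"
proof -
  define strand :: "int \<Rightarrow> adiag" where "strand n = [Suc 0 \<mapsto> (Suc 0, n)]" for n
  have comp: "aro_comp \<beta> (diag_mor (Suc 0) (Suc 0) (strand x)) (diag_mor (Suc 0) (Suc 0) (strand y))
      = diag_mor (Suc 0) (Suc 0) (strand (y + x))" for x y
  proof -
    have "diag_comp (strand x) (strand y) = strand (y + x)"
      by (rule ext) (simp add: diag_comp_def strand_def)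
    then show ?thesis
      by (simp add: aro_comp_diag_mor closed_components_eq_0 aro_scl_1 strand_def)
  qed
  have one: "diag_id (Suc 0) = strand 0"
    by (rule ext) (auto simp: diag_id_def strand_def)
  have gen: "rook_gen_mor GPhiPlus = diag_mor (Suc 0) (Suc 0) (strand 1)"
      "rook_gen_mor GPhiMinus = diag_mor (Suc 0) (Suc 0) (strand (- 1))"
    by (simp_all add: strand_def)
  have plus: "diagram_ev \<beta> (iterate_term GPhiPlus m) = diag_mor (Suc 0) (Suc 0) (strand (int m))"
      for m
    by (induction m) (simp_all add: word_def one comp gen add.commute del: rook_gen_mor.simps)
  have minus: "diagram_ev \<beta> (iterate_term GPhiMinus m)
      = diag_mor (Suc 0) (Suc 0) (strand (- int m))" for m
    by (induction m) (simp_all add: word_def one comp gen minus_diff_commute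
        del: rook_gen_mor.simps)
  have "diagram_ev \<beta> (phi_term n) = diag_mor (Suc 0) (Suc 0) (strand n)"
    using plus[of "nat n"] minus[of "nat (- n)"] by (simp add: phi_term_def)
  then show ?thesis
    by (simp add: strand_def)
qed

lemma diagram_ev_etas: "diagram_ev \<beta> (etas_term n) = diag_mor 0 n Map.empty"
proof (induction n)
  case 0
  then show ?case by (simp add: word_def diag_id_0)
next
  case (Suc n)
  have "diag_tens 0 (Suc 0) Map.empty Map.empty = Map.empty"
    by (rule ext) (simp add: diag_tens_def)
  then show ?case
    using Suc by (simp add: aro_tens_diag_mor)
qed

text \<open>Evaluation of the normal form inverts the peeling off of bottom vertices. In particular the
  normal forms of different diagrams have linearly independent values.\<close>

lemma diagram_ev_normal_form:
  assumes "d \<in> adiags s t"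
  shows "diagram_ev \<beta> (normal_form s t d) = diag_mor s t d"
  using assms
proof (induction rule: adiags_induct)
  case (empty t)
  then show ?case by (simp add: normal_form.simps diagram_ev_etas)
next
  case (isolated s t d)
  have "diag_tens s t d Map.empty = d"
    using diag_tens_unit(2)[OF isolated.hyps] by (simp add: diag_id_0)
  then show ?case
    using isolated by (simp add: normal_form_isolated aro_tens_diag_mor)
next
  case (matched s p k n d)
  have range: "j \<le> p + k" "1 \<le> j" "i \<le> s" "1 \<le> i" if "d i = Some (j, m)" for i j m
    using adiags_range[OF matched.hyps that] by auto
  have "{1..Suc (p + k)} \<subseteq> dom (diag_tens p p (diag_id p) (cycle_diag k))"
    by (auto simp: diag_tens_def diag_id_def cycle_diag_def dom_def)
  then have "closed_components (Suc (p + k)) (diag_tens p p (diag_id p) (cycle_diag k)) b = 0" for b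
    by (intro closed_components_eq_0) blast
  moreover have "diag_comp (diag_tens p p (diag_id p) (cycle_diag k))
      (diag_tens s (p + k) d [1 \<mapsto> (1, n)]) = insert_strand s p n d"
  proof (rule ext)
    fix i
    consider "i = Suc s" | "Suc s < i" | "i \<le> s" by linarith
    then show "diag_comp (diag_tens p p (diag_id p) (cycle_diag k))
        (diag_tens s (p + k) d [1 \<mapsto> (1, n)]) i
        = insert_strand s p n d i"
    proof cases
      case 1
      then show ?thesis
        by (simp add: diag_comp_def diag_tens_def diag_id_def cycle_diag_def insert_strand_def)
    next
      case 2
      then have "i - s \<noteq> Suc 0"
        by linarith
      with 2 show ?thesis
        using adiags_None[OF matched.hyps, of i] \<open>i - s \<noteq> Suc 0\<close>
        by (simp add: diag_comp_def diag_tens_def insert_strand_def)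
    next
      case 3
      then show ?thesis
        using range[of i]
        by (cases "d i") (auto simp: diag_comp_def diag_tens_def diag_id_def cycle_diag_def
            insert_strand_def)
    qed
  qed
  ultimately show ?case
    using matched.IH
    by (simp add: normal_form_matched[OF matched.hyps] word_def diagram_ev_cycle
        diagram_ev_phi aro_tens_diag_mor aro_comp_diag_mor aro_scl_1)
qed

lemma diagram_ev_lincomb:
  assumes "set ds \<subseteq> adiags s t" "distinct ds"
  shows "diagram_ev \<beta> (lincomb_term s t ds c)
    = (s, t, \<Sum>d\<in>set ds. Poly_Mapping.single d (c d))"
  using assms
  by (induction ds)
    (simp_all add: word_def diagram_ev_normal_form diag_mor_def pm_scale_single flip: pm_scale_def)

lemma diagram_ev_lincomb_lookup:
  assumes "set ds \<subseteq> adiags s t" "distinct ds" "Poly_Mapping.keys q \<subseteq> set ds"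
  shows "diagram_ev \<beta> (lincomb_term s t ds (Poly_Mapping.lookup q)) = (s, t, q)"
proof -
  have "(\<Sum>d\<in>set ds. Poly_Mapping.single d (Poly_Mapping.lookup q d)) = q"
    using assms(3) by (intro poly_mapping_eqI)
        (auto simp: lookup_sum lookup_single when_def in_keys_iff)
  then show ?thesis
    using diagram_ev_lincomb[OF assms(1,2), of \<beta> "Poly_Mapping.lookup q"] by (simp only:)
qed

section \<open>The presentation\<close>

theorem proposition2p4p3:
  fixes \<beta> :: "'k::field"
  shows "is_presentation_of (rook_presentation \<beta>) (aRo \<beta>) (\<lambda>_. 1) rook_gen_mor"
proof -
  let ?P = "rook_presentation \<beta>" and ?ev = "ev (aRo \<beta>) (\<lambda>_. 1) rook_gen_mor"
  note diagram_ev = diagram_ev_def[of \<beta>, symmetric]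
  interpret A: model "aRo \<beta>" ?P "\<lambda>_. 1" rook_gen_mor
    by (rule model_aRo)
  interpret U: rook_model "presented_category ?P" \<beta> "\<lambda>x. [x]" "\<lambda>g. pclass ?P (TGen g)"
    by (rule rook_model.intro[OF model_presented_category[OF wf_rook_presentation]])
  show ?thesis
  proof (rule A.presentation_criterion[OF wf_rook_presentation])
    show "bij (ob (aRo \<beta>) (\<lambda>_::unit. 1))"
      unfolding ob_aRo
    proof (rule bijI)
      show "inj (length :: unit list \<Rightarrow> nat)"
        by (rule injI) (simp add: unit_list_eq_iff)
      show "surj (length :: unit list \<Rightarrow> nat)"
        by (rule surjI[of _ word]) simp
    qed
    show "Obj (aRo \<beta>) = UNIV"
      by (simp add: aRo_simps)
  next
    fix a b :: "unit list" and f
    assume "f \<in> Hom (aRo \<beta>) (ob (aRo \<beta>) (\<lambda>_::unit. 1) a) (ob (aRo \<beta>) (\<lambda>_. 1) b)"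
    then obtain q where q: "f = (length a, length b, q)"
        "Poly_Mapping.keys q \<subseteq> adiags (length a) (length b)"
      unfolding ob_aRo aRo_simps by blast
    obtain ds where ds: "set ds = Poly_Mapping.keys q" "distinct ds"
      using finite_distinct_list[of "Poly_Mapping.keys q"] by auto
    show "\<exists>t. wt ?P t a b \<and> ?ev t = f"
    proof (intro exI conjI)
      show "wt ?P (lincomb_term (length a) (length b) ds (Poly_Mapping.lookup q)) a b"
        using wt_lincomb_term[of ds "length a" "length b" \<beta>] ds q by simp
      show "?ev (lincomb_term (length a) (length b) ds (Poly_Mapping.lookup q)) = f"
        using diagram_ev_lincomb_lookup[of ds "length a" "length b" q \<beta>] ds q
        unfolding diagram_ev by simp
    qed
  next
    fix t u a b
    assume t: "wt ?P t a b" and u: "wt ?P u a b" and eq: "?ev t = ?ev u"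
    have pclass: "U.eval t' = pclass ?P t'" if "wt ?P t' a' b'" for t' a' b'
      using that ev_presented_category[of ?P t'] unfolding wt_iff by blast
    \<comment> \<open>The coefficients of an expansion in the presented category are those of the value in the
      affine rook category.\<close>
    have coefficients: "?ev t' = (length a, length b, q)"
      if t': "wt ?P t' a b" and q: "U.expands (length a) (length b) (U.eval t') q" for t' q
    proof -
      obtain ds where ds: "distinct ds" "Poly_Mapping.keys q \<subseteq> set ds"
          "set ds \<subseteq> adiags (length a) (length b)"
        and eval: "U.eval t' = U.eval (lincomb_term (length a) (length b) ds
            (Poly_Mapping.lookup q))"
        using U.expands_list[OF q] by blast
      have l: "wt ?P (lincomb_term (length a) (length b) ds (Poly_Mapping.lookup q)) a b"
        using wt_lincomb_term[OF ds(3)] by simp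
      have "?P \<turnstile> lincomb_term (length a) (length b) ds (Poly_Mapping.lookup q) \<approx> t'"
        using eval t' unfolding pclass[OF t'] pclass[OF l] by (simp add: pclass_eq_iff wt_iff)
      from A.soundness[OF this] show ?thesis
        using diagram_ev_lincomb_lookup[OF ds(3,1,2), of \<beta>] unfolding diagram_ev by simp
    qed
    obtain q where q: "U.expands (length a) (length b) (U.eval t) q"
      by (rule U.expansion[OF t])
    obtain q' where q': "U.expands (length a) (length b) (U.eval u) q'"
      by (rule U.expansion[OF u])
    have "q = q'"
      using coefficients[OF t q] coefficients[OF u q'] eq by simp
    then have "U.eval t = U.eval u"
      using U.expands_unique q q' by blast
    then show "?P \<turnstile> t \<approx> u"
      using u unfolding pclass[OF t] pclass[OF u] by (metis pclass_eq_iff wt_iff)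
  qed
qed

end
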